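(* Let $d,T\in\mathbb N$, $p\ge1$, $\mu,\nu\in\mathcal P_p(\mathbb R^{dT})$, and let $$c_t=\nu\text{-}\operatorname{ess\,sup}\ \frac{\mathbb E_\nu\big[|X_t|^p\,\big|\,X_1,\dots,X_{t-1}\big]}{1+\sum_{s=1}^{t-1}|X_s|^p},\qquad t=2,\dots,T,$$ be real numbers. Then $$\mathcal{AW}_p^p(\mu,\nu)\le2^p\,\mathrm{ATV}_p^p(\mu,\nu)\le2^p\Big(1+2\sum_{t=1}^{T-1}\prod_{s=t+1}^{T}(1+c_s)\Big)\mathrm{TV}_p^p(\mu,\nu).$$ If, moreover, $\mu$ and $\nu$ are concentrated on a Borel set $\mathcal K\subseteq\mathbb R^{dT}$ with $\mathrm{diam}(\mathcal K):=\sup_{x,y\in\mathcal K}|x-y|<\infty$, then $$\mathcal{AW}_p^p(\mu,\nu)\le\mathrm{diam}(\mathcal K)^p\,\mathrm{ATV}(\mu,\nu)\le(2T-1)\,\mathrm{diam}(\mathcal K)^p\,\mathrm{TV}(\mu,\nu).$$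
   Context: Paths are $x=(x_1,\dots,x_T)\in\mathbb R^{dT}$ with $x_t\in\mathbb R^d$, and $x_{1:t}=(x_1,\dots,x_t)$. $X=(X_t)_{t=1}^T$ is the canonical process on $\mathbb R^{dT}$, and $\mathbb E_\nu$ is expectation when $X\sim\nu$. For $x\in\mathbb R^n$, $|x|^p=|x|_p^p=\sum_{k=1}^n|x_k|^p$; thus $|\cdot|$ is the $\ell^p$-norm, also in $\mathrm{diam}$. $\mathcal P_p(\mathbb R^{dT})$ is the set of Borel probability measures with finite $p$-th moment. For such $\mu$, $\mu_1$ is the law of $X_1$ and $\mu_{x_{1:t}}$ is the regular conditional law of $X_{t+1}$ given $X_{1:t}=x_{1:t}$ (similarly for $\nu$). $\mathrm{Cpl}(\mu,\nu)$ is the set of couplings. $\mathrm{Cpl}_{\mathrm{bc}}(\mu,\nu)$ is the set of bicausal couplings: those $\pi\in \mathrm{Cpl}(\mu,\nu)$ such that the law of $(X_1,Y_1)$ under $\pi$ is in $\mathrm{Cpl}(\mu_1,\nu_1)$ and, for $t=1,\dots,T-1$ and $\pi$-a.e. $(x,y)$, the conditional law of $(X_{t+1},Y_{t+1})$ given $(X_{1:t},Y_{1:t})=(x_{1:t},y_{1:t})$ is in $\mathrm{Cpl}(\mu_{x_{1:t}},\nu_{y_{1:t}})$. Define $$\mathcal{AW}_p^p(\mu,\nu)=\inf_{\pi\in\mathrm{Cpl}_{\mathrm{bc}}(\mu,\nu)}\int|x-y|_p^p\,d\pi.$$ For measurable $w\ge0$, let $\mathrm{TV}_w(\mu,\nu)$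 and $\mathrm{ATV}_w(\mu,\nu)$ be the infimum of $\int_{\{x\neq y\}}(w(x)+w(y))\,d\pi(x,y)$ over $\pi\in\mathrm{Cpl}(\mu,\nu)$ and $\pi\in\mathrm{Cpl}_{\mathrm{bc}}(\mu,\nu)$, respectively. For $w\equiv1$ write $\mathrm{TV},\mathrm{ATV}$ (so $\mathrm{TV}(\mu,\nu)=|\mu-\nu|(\mathbb R^{dT})$). For $w(x)=1+|x|_p^p$, $\mathrm{TV}_p^p:=\mathrm{TV}_w$ and $\mathrm{ATV}_p^p:=\mathrm{ATV}_w$. *)

theory Defs
  imports "HOL-Probability.Probability"
begin

text \<open>The dimension \<open>d\<close> of a single time step is the cardinality of the index type
  \<open>'d\<close>. A path with \<open>T\<close> steps is a function on times that is extensional on \<open>{1..T}\<close>, so that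
  equality of paths is equality of their values at the times \<open>1, \<dots>, T\<close>.\<close>

type_synonym 'd path = "nat \<Rightarrow> real ^ 'd"

definition path_space :: "nat \<Rightarrow> ('d::finite) path measure" where
  "path_space T = (\<Pi>\<^sub>M t\<in>{1..T}. borel)"

abbreviation history :: "nat \<Rightarrow> 'd path \<Rightarrow> 'd path" where
  "history t x \<equiv> restrict x {1..t}"

definition lp_pow :: "real \<Rightarrow> real ^ ('d::finite) \<Rightarrow> real" where
  "lp_pow p v = (\<Sum>k\<in>UNIV. \<bar>v $ k\<bar> powr p)"

definition path_lp_pow :: "real \<Rightarrow> nat \<Rightarrow> ('d::finite) path \<Rightarrow> real" where
  "path_lp_pow p T x = (\<Sum>t\<in>{1..T}. lp_pow p (x t))"

definition path_lp_dist :: "real \<Rightarrow> nat \<Rightarrow> ('d::finite) path \<Rightarrow> 'd path \<Rightarrow> real" where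
  "path_lp_dist p T x y = path_lp_pow p T (\<lambda>t. x t - y t) powr (1 / p)"

definition path_diam :: "real \<Rightarrow> nat \<Rightarrow> ('d::finite) path set \<Rightarrow> ennreal" where
  "path_diam p T K = (SUP x\<in>K. SUP y\<in>K. ennreal (path_lp_dist p T x y))"

definition finite_moment_measures :: "real \<Rightarrow> nat \<Rightarrow> ('d::finite) path measure set" where
  "finite_moment_measures p T =
     {\<mu>. prob_space \<mu> \<and> sets \<mu> = sets (path_space T) \<and> integrable \<mu> (path_lp_pow p T)}"


definition couplings :: "'a measure \<Rightarrow> 'b measure \<Rightarrow> ('a \<times> 'b) measure set" where
  "couplings M N =
     {\<pi>. prob_space \<pi> \<and> sets \<pi> = sets (M \<Otimes>\<^sub>M N) \<and> distr \<pi> M fst = M \<and> distr \<pi> N snd = N}"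

text \<open>\<open>\<kappa>\<close> is a version of the regular conditional law under \<open>P\<close> of the \<open>L\<close>-valued variable \<open>Y\<close> given
  the \<open>N\<close>-valued variable \<open>X\<close>.\<close>

definition regular_cond_law ::
  "'a measure \<Rightarrow> 'b measure \<Rightarrow> 'c measure \<Rightarrow> ('a \<Rightarrow> 'b) \<Rightarrow> ('a \<Rightarrow> 'c) \<Rightarrow> ('b \<Rightarrow> 'c measure) \<Rightarrow> bool"
where
  "regular_cond_law P N L X Y \<kappa> \<longleftrightarrow>
     \<kappa> \<in> N \<rightarrow>\<^sub>M prob_algebra L \<and>
     (\<forall>A\<in>sets N. \<forall>B\<in>sets L.
        emeasure P {\<omega> \<in> space P. X \<omega> \<in> A \<and> Y \<omega> \<in> B} =
        (\<integral>\<^sup>+\<omega>. indicator A (X \<omega>) * emeasure (\<kappa> (X \<omega>)) B \<partial>P))"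

definition step_cond_law ::
  "('d::finite) path measure \<Rightarrow> nat \<Rightarrow> ('d path \<Rightarrow> (real ^ 'd) measure) \<Rightarrow> bool" where
  "step_cond_law \<mu> t \<kappa> \<longleftrightarrow>
     regular_cond_law \<mu> (path_space t) borel (history t) (\<lambda>x. x (Suc t)) \<kappa>"

definition joint_step_cond_law ::
  "(('d::finite) path \<times> 'd path) measure \<Rightarrow> nat \<Rightarrow>
   ('d path \<times> 'd path \<Rightarrow> ((real ^ 'd) \<times> (real ^ 'd)) measure) \<Rightarrow> bool" where
  "joint_step_cond_law \<pi> t \<kappa> \<longleftrightarrow>
     regular_cond_law \<pi> (path_space t \<Otimes>\<^sub>M path_space t) (borel \<Otimes>\<^sub>M borel)
       (\<lambda>(x, y). (history t x, history t y)) (\<lambda>(x, y). (x (Suc t), y (Suc t))) \<kappa>"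

text \<open>Regular conditional laws on these spaces exist and are unique up to null sets of the
  conditioning variable. Hence the condition below does not depend on the chosen versions.\<close>

definition bicausal_couplings ::
  "nat \<Rightarrow> ('d::finite) path measure \<Rightarrow> 'd path measure \<Rightarrow> ('d path \<times> 'd path) measure set" where
  "bicausal_couplings T \<mu> \<nu> =
     {\<pi> \<in> couplings \<mu> \<nu>.
        distr \<pi> (borel \<Otimes>\<^sub>M borel) (\<lambda>(x, y). (x 1, y 1))
          \<in> couplings (distr \<mu> borel (\<lambda>x. x 1)) (distr \<nu> borel (\<lambda>y. y 1)) \<and>
        (\<forall>t\<in>{1..<T}. \<exists>\<kappa> \<kappa>\<^sub>\<mu> \<kappa>\<^sub>\<nu>.
           joint_step_cond_law \<pi> t \<kappa> \<and> step_cond_law \<mu> t \<kappa>\<^sub>\<mu> \<and> step_cond_law \<nu> t \<kappa>\<^sub>\<nu> \<and>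
           (AE (x, y) in \<pi>.
              \<kappa> (history t x, history t y)
                \<in> couplings (\<kappa>\<^sub>\<mu> (history t x)) (\<kappa>\<^sub>\<nu> (history t y))))}"


text \<open>The \<open>p\<close>-th power of the adapted Wasserstein distance.\<close>

definition AW_pow :: "real \<Rightarrow> nat \<Rightarrow> ('d::finite) path measure \<Rightarrow> 'd path measure \<Rightarrow> ennreal" where
  "AW_pow p T \<mu> \<nu> =
     (INF \<pi>\<in>bicausal_couplings T \<mu> \<nu>.
        \<integral>\<^sup>+(x, y). ennreal (path_lp_pow p T (\<lambda>t. x t - y t)) \<partial>\<pi>)"

definition weighted_mismatch :: "('a \<Rightarrow> real) \<Rightarrow> ('a \<times> 'a) measure \<Rightarrow> ennreal" where
  "weighted_mismatch w \<pi> =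
     (\<integral>\<^sup>+(x, y). ennreal (w x + w y) * indicator {(x, y). x \<noteq> y} (x, y) \<partial>\<pi>)"

definition TV_w :: "('a \<Rightarrow> real) \<Rightarrow> 'a measure \<Rightarrow> 'a measure \<Rightarrow> ennreal" where
  "TV_w w \<mu> \<nu> = (INF \<pi>\<in>couplings \<mu> \<nu>. weighted_mismatch w \<pi>)"

definition ATV_w ::
  "nat \<Rightarrow> (('d::finite) path \<Rightarrow> real) \<Rightarrow> 'd path measure \<Rightarrow> 'd path measure \<Rightarrow> ennreal" where
  "ATV_w T w \<mu> \<nu> = (INF \<pi>\<in>bicausal_couplings T \<mu> \<nu>. weighted_mismatch w \<pi>)"

abbreviation "TV \<equiv> TV_w (\<lambda>_. 1)"

abbreviation "ATV T \<equiv> ATV_w T (\<lambda>_. 1)"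

abbreviation "TV_pow p T \<equiv> TV_w (\<lambda>x. 1 + path_lp_pow p T x)"

abbreviation "ATV_pow p T \<equiv> ATV_w T (\<lambda>x. 1 + path_lp_pow p T x)"


definition history_algebra :: "('d::finite) path measure \<Rightarrow> nat \<Rightarrow> 'd path measure" where
  "history_algebra \<nu> t = vimage_algebra (space \<nu>) (history t) (path_space t)"

text \<open>The constant \<open>c\<^sub>t\<close>; meant for \<open>t \<ge> 2\<close>.\<close>

definition growth_const :: "real \<Rightarrow> ('d::finite) path measure \<Rightarrow> nat \<Rightarrow> ereal" where
  "growth_const p \<nu> t =
     esssup \<nu> (\<lambda>x. ereal (
       real_cond_exp \<nu> (history_algebra \<nu> (t - 1)) (\<lambda>x. lp_pow p (x t)) x
       / (1 + path_lp_pow p (t - 1) x)))"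

end

theory Submission
  imports Defs
begin

text \<open>Couple the two laws step by step: as long as the two pasts agree, draw the next steps from a
  coupling of the two conditional laws that keeps as much mass on the diagonal as possible, and once
  the paths have separated, draw them independently. The resulting greedy coupling is bicausal, and the
  claim is that its weighted mismatch is at most a constant times that of any other coupling.

  Write \<open>w\<close> for the weight. For any coupling, the mismatch plus twice the \<open>w\<close>-mass of the diagonal is
  \<open>E\<^sub>\<mu> w + E\<^sub>\<nu> w\<close>. So it suffices to compare diagonals. With densities \<open>F, G\<close> of \<open>\<mu>, \<nu>\<close> with respect to a common
  reference law, no coupling has a diagonal larger than \<open>min F G\<close>. If \<open>f\<^sub>t, g\<^sub>t\<close> are the conditional
  densities of the steps, the greedy coupling has at least the diagonal \<open>\<Prod>\<^sub>t min f\<^sub>t g\<^sub>t\<close>. The difference between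
  the two is controlled one step at a time. If \<open>a, b\<close> are the densities of the pasts and \<open>\<alpha>, \<beta>\<close> those of
  the next step, then \<open>min (a\<alpha>) (b\<beta>) - min a b * min \<alpha> \<beta> \<le> \<bar>a - b\<bar> \<beta>\<close>, and the left side vanishes for \<open>b = 0\<close>
  (\<open>min_product_excess_le\<close>). The factor \<open>\<beta>\<close> belongs to \<open>\<nu>\<close> alone, which is why growth constants of \<open>\<nu>\<close> alone suffice:
  integrating \<open>w\<close> at time \<open>t + 1\<close> against \<open>\<beta>\<close> costs a factor \<open>1 + c\<^sub>t\<^sub>+\<^sub>1\<close> over \<open>w\<close> at time \<open>t\<close>. The integral of
  \<open>w \<bar>a - b\<bar>\<close> is at most the mismatch of any coupling. Hence the loss \<open>l\<^sub>t\<close> satisfies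
  \<open>l\<^sub>t\<^sub>+\<^sub>1 \<le> (1 + c\<^sub>t\<^sub>+\<^sub>1) (l\<^sub>t + V)\<close> and \<open>l\<^sub>1 = 0\<close>, where \<open>V\<close> is the mismatch of the competitor, and this recursion
  sums to the stated constant (\<open>overlap_deficit_bound\<close>, \<open>greedy_coupling_cost_le\<close>). The weight \<open>1 + \<bar>x\<bar>\<^sup>p\<close> gives the
  first estimate and the weight \<open>1\<close>, where no growth occurs, gives \<open>1 + 2 (T - 1)\<close>. The bounds of the
  Wasserstein cost by the mismatch are pointwise.

  The construction rests on conditional laws. Only the reference law has to be disintegrated, by
  \<open>vec_regular_cond_law_exists\<close>; the kernels of \<open>\<mu>\<close> and \<open>\<nu>\<close> then have jointly measurable densities with
  respect to its kernels, and the maximal couplings depend measurably on the past.\<close>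

section \<open>Regular conditional laws of vector-valued random variables\<close>

lemma AE_le_if_set_integrals_le:
  fixes f g :: "'a \<Rightarrow> ennreal"
  assumes [measurable]: "f \<in> borel_measurable M" "g \<in> borel_measurable M"
    and fin: "(\<integral>\<^sup>+x. g x \<partial>M) < \<infinity>"
    and le: "\<And>A. A \<in> sets M \<Longrightarrow> (\<integral>\<^sup>+x. f x * indicator A x \<partial>M) \<le> (\<integral>\<^sup>+x. g x * indicator A x \<partial>M)"
  shows "AE x in M. f x \<le> g x"
proof -
  define A where "A = {x \<in> space M. g x < f x}"
  have A [measurable]: "A \<in> sets M"
    unfolding A_def by measurable
  have "(\<integral>\<^sup>+x. g x * indicator A x \<partial>M) \<le> (\<integral>\<^sup>+x. g x \<partial>M)"
    by (intro nn_integral_mono) (auto split: split_indicator)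
  then have fin': "(\<integral>\<^sup>+x. g x * indicator A x \<partial>M) < \<infinity>"
    using fin by (rule le_less_trans)
  have "(\<integral>\<^sup>+x. (f x - g x) * indicator A x \<partial>M) + (\<integral>\<^sup>+x. g x * indicator A x \<partial>M)
      = (\<integral>\<^sup>+x. f x * indicator A x \<partial>M)"
    by (subst nn_integral_add[symmetric])
      (auto intro!: nn_integral_cong simp: A_def diff_add_cancel_ennreal less_imp_le split: split_indicator)
  also have "\<dots> \<le> 0 + (\<integral>\<^sup>+x. g x * indicator A x \<partial>M)"
    using le[OF A] by simp
  finally have "(\<integral>\<^sup>+x. (f x - g x) * indicator A x \<partial>M) = 0"
    using fin' by (auto simp: ennreal_add_left_cancel_le add.commute)
  then have "AE x in M. (f x - g x) * indicator A x = 0"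
    by (subst (asm) nn_integral_0_iff_AE) auto
  with AE_space show ?thesis
    by eventually_elim (auto simp: A_def diff_eq_0_iff_ennreal not_less split: split_indicator_asm)
qed

lemma AE_eq_if_set_integrals_eq:
  fixes f g :: "'a \<Rightarrow> ennreal"
  assumes f: "f \<in> borel_measurable M" and g: "g \<in> borel_measurable M"
    and fin: "(\<integral>\<^sup>+x. g x \<partial>M) < \<infinity>"
    and eq: "\<And>A. A \<in> sets M \<Longrightarrow> (\<integral>\<^sup>+x. f x * indicator A x \<partial>M) = (\<integral>\<^sup>+x. g x * indicator A x \<partial>M)"
  shows "AE x in M. f x = g x"
proof -
  have "(\<integral>\<^sup>+x. f x \<partial>M) = (\<integral>\<^sup>+x. g x \<partial>M)"
    using eq[OF sets.top] by (simp cong: nn_integral_cong)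
  then have "AE x in M. f x \<le> g x" "AE x in M. g x \<le> f x"
    using f g fin eq by (auto intro!: AE_le_if_set_integrals_le)
  then show ?thesis
    by eventually_elim auto
qed

text \<open>The conditional distribution function at \<open>r\<close> is the Radon-Nikodym derivative of
  \<open>A \<mapsto> P (X \<in> A, Y \<le> r)\<close> with respect to the law of \<open>X\<close>. Since \<open>Y\<close> lies in the unit interval, these derivatives
  can be corrected to a distribution function for every value of \<open>X\<close>, without an exceptional null set.\<close>

lemma unit_interval_regular_cond_law_exists:
  fixes Y :: "'a \<Rightarrow> real"
  assumes P: "prob_space P" and X [measurable]: "X \<in> P \<rightarrow>\<^sub>M N" and Y [measurable]: "Y \<in> borel_measurable P"
    and Y01: "\<And>\<omega>. \<omega> \<in> space P \<Longrightarrow> 0 \<le> Y \<omega> \<and> Y \<omega> \<le> 1"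
  shows "\<exists>\<kappa>. regular_cond_law P N borel X Y \<kappa>"
proof -
  interpret P: prob_space P by (rule P)
  define PX where "PX = distr P N X"
  interpret PX: prob_space PX
    unfolding PX_def by (rule P.prob_space_distr) simp
  have sets_PX [measurable_cong, simp]: "sets PX = sets N" and space_PX [simp]: "space PX = space N"
    by (simp_all add: PX_def)

  define L where "L r = distr (density P (\<lambda>\<omega>. indicator {..r} (Y \<omega>))) N X" for r
  have sets_L [measurable_cong, simp]: "sets (L r) = sets N" for r
    by (simp add: L_def)
  have L: "emeasure (L r) A = emeasure P {\<omega> \<in> space P. X \<omega> \<in> A \<and> Y \<omega> \<le> r}" if [measurable]: "A \<in> sets N" for r A
  proof -
    have "emeasure (L r) A = (\<integral>\<^sup>+\<omega>. indicator {\<omega> \<in> space P. X \<omega> \<in> A \<and> Y \<omega> \<le> r} \<omega> \<partial>P)"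
      unfolding L_def
      by (subst emeasure_distr)
        (auto simp: emeasure_density simp del: nn_integral_indicator
          intro!: nn_integral_cong split: split_indicator)
    then show ?thesis by simp
  qed
  have L_mono: "emeasure (L r) A \<le> emeasure (L s) A" if "A \<in> sets N" "r \<le> s" for r s A
    using that by (auto simp: L intro!: emeasure_mono)
  have ac: "absolutely_continuous PX (L r)" for r
    unfolding absolutely_continuous_def
  proof
    fix A assume "A \<in> null_sets PX"
    then have A [measurable]: "A \<in> sets N" and "emeasure P (X -` A \<inter> space P) = 0"
      by (auto simp: null_sets_def PX_def emeasure_distr)
    moreover have "emeasure (L r) A \<le> emeasure P (X -` A \<inter> space P)"
      by (auto simp: L intro!: emeasure_mono)
    ultimately show "A \<in> null_sets (L r)"
      by (auto simp: null_sets_def)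
  qed

  define g where "g r = RN_deriv PX (L r)" for r
  have g_meas [measurable]: "g r \<in> borel_measurable N" for r
    unfolding g_def using borel_measurable_RN_deriv[of PX "L r"] by simp
  have g: "(\<integral>\<^sup>+x. g r x * indicator A x \<partial>PX) = emeasure (L r) A" if "A \<in> sets N" for r A
    using PX.density_RN_deriv[OF ac[of r]] that by (metis emeasure_density g_def g_meas measurable_cong_sets sets_L sets_PX)
  have L_le: "emeasure (L r) A \<le> 1" if "A \<in> sets N" for r A
    using that by (simp add: L P.measure_le_1)
  have g_total: "(\<integral>\<^sup>+x. g r x \<partial>PX) = emeasure (L r) (space N)" for r
  proof -
    have "(\<integral>\<^sup>+x. g r x \<partial>PX) = (\<integral>\<^sup>+x. g r x * indicator (space N) x \<partial>PX)"
      by (intro nn_integral_cong) simp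
    then show ?thesis
      by (simp only: g sets.top)
  qed
  have g_fin: "(\<integral>\<^sup>+x. g r x \<partial>PX) < \<infinity>" for r
  proof -
    have "(\<integral>\<^sup>+x. g r x \<partial>PX) = emeasure (L r) (space N)"
      by (rule g_total)
    also have "\<dots> \<le> 1"
      by (rule L_le) simp
    finally show ?thesis
      by (rule le_less_trans) simp
  qed
  have g_mono: "AE x in PX. g r x \<le> g s x" if "r \<le> s" for r s
    by (rule AE_le_if_set_integrals_le) (use that g_fin in \<open>auto simp: g L_mono\<close>)
  have g_neg: "AE x in PX. g r x = 0" if "r < 0" for r
  proof (rule AE_eq_if_set_integrals_eq)
    fix A assume A: "A \<in> sets PX"
    have "{\<omega> \<in> space P. X \<omega> \<in> A \<and> Y \<omega> \<le> r} = {}"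
      using Y01 that by fastforce
    then have "emeasure (L r) A = 0"
      using A by (subst L) (simp_all del: Collect_empty_eq)
    with A show "(\<integral>\<^sup>+x. g r x * indicator A x \<partial>PX) = (\<integral>\<^sup>+x. 0 * indicator A x \<partial>PX)"
      by (simp add: g)
  qed auto
  have g_one: "AE x in PX. g r x = 1" if "r \<ge> 1" for r
  proof (rule AE_eq_if_set_integrals_eq)
    fix A assume A: "A \<in> sets PX"
    then have [measurable]: "A \<in> sets N" by simp
    have "{\<omega> \<in> space P. X \<omega> \<in> A \<and> Y \<omega> \<le> r} = X -` A \<inter> space P"
      using Y01 that by fastforce
    then have "emeasure (L r) A = emeasure PX A"
      by (simp add: L PX_def emeasure_distr)
    then show "(\<integral>\<^sup>+x. g r x * indicator A x \<partial>PX) = (\<integral>\<^sup>+x. 1 * indicator A x \<partial>PX)"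
      by (simp add: g)
  qed (auto simp: PX.emeasure_space_1[simplified])

  \<comment> \<open>Running suprema over rational arguments, capped at 1, force monotonicity; prescribing the
    values outside the unit interval forces the limits 0 and 1.\<close>
  define H where "H q x = (if q < 0 then 0 else if 1 \<le> q then 1
      else enn2real (min 1 (SUP s\<in>\<rat> \<inter> {..q}. g s x)))" for q :: real and x
  have countable_Q: "countable (\<rat> \<inter> {..q})" "countable (\<rat> \<inter> {q<..})" for q :: real
    by (auto intro: countable_subset[OF _ countable_rat])
  have [measurable]: "(\<lambda>x. SUP s\<in>\<rat> \<inter> {..q}. g s x) \<in> borel_measurable N" for q
    by (rule borel_measurable_SUP[OF countable_Q(1)]) simp
  have H_meas [measurable]: "H q \<in> borel_measurable N" for q
    unfolding H_def by measurable
  have H_bounds: "0 \<le> H q x" "H q x \<le> 1" for q x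
  proof -
    have "enn2real (min 1 z) \<le> 1" for z
      by (rule enn2real_leI) auto
    then show "0 \<le> H q x" "H q x \<le> 1"
      by (auto simp: H_def)
  qed
  have H_mono: "H q x \<le> H s x" if "q \<le> s" for q s x
  proof (cases "0 \<le> q \<and> s < 1")
    case True
    have "(SUP r\<in>\<rat> \<inter> {..q}. g r x) \<le> (SUP r\<in>\<rat> \<inter> {..s}. g r x)"
      using that by (intro SUP_subset_mono) auto
    then show ?thesis
      using True that unfolding H_def
      by (auto intro!: enn2real_mono min.mono simp: min_less_iff_disj)
  next
    case False
    then show ?thesis
      using H_bounds[of s x] H_bounds[of q x] that by (auto simp: H_def)
  qed
  have H_g: "AE x in PX. \<forall>q\<in>\<rat>. ennreal (H q x) = g q x"
  proof -
    have "AE x in PX. \<forall>q\<in>\<rat>. \<forall>s\<in>\<rat>. q \<le> s \<longrightarrow> g q x \<le> g s x"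
      using g_mono by (simp add: AE_ball_countable countable_rat)
    moreover have "AE x in PX. \<forall>q\<in>\<rat>. q < 0 \<longrightarrow> g q x = 0"
      using g_neg by (simp add: AE_ball_countable countable_rat)
    moreover have "AE x in PX. \<forall>q\<in>\<rat>. q \<ge> 1 \<longrightarrow> g q x = 1"
      using g_one by (simp add: AE_ball_countable countable_rat)
    ultimately show ?thesis
    proof eventually_elim
      case (elim x)
      show ?case
      proof
        fix q :: real assume q: "q \<in> \<rat>"
        have "(SUP s\<in>\<rat> \<inter> {..q}. g s x) = g q x"
          using q elim(1) by (intro antisym SUP_least SUP_upper) auto
        moreover have "g q x \<le> 1" if "q < 1"
          using elim(1,3) q that by (metis Rats_1 less_imp_le order_refl)
        ultimately show "ennreal (H q x) = g q x"
          using elim(2,3) q by (auto simp: H_def min_absorb2 le_less_trans intro!: ennreal_enn2real)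
      qed
    qed
  qed

  define F where "F x r = (INF q\<in>\<rat> \<inter> {r<..}. H q x)" for x r
  have Q_ne: "\<rat> \<inter> {r<..} \<noteq> {}" for r :: real
    using Rats_dense_in_real[of r "r + 1"] by auto
  have bdd: "bdd_below ((\<lambda>q. H q x) ` (\<rat> \<inter> {r<..}))" for x r
    by (rule bdd_belowI[of _ 0]) (auto simp: H_bounds)
  have F_le: "F x r \<le> H q x" if "q \<in> \<rat>" "r < q" for x q r
    unfolding F_def using that by (intro cINF_lower bdd) auto
  have F_ge: "z \<le> F x r" if "\<And>q. q \<in> \<rat> \<Longrightarrow> r < q \<Longrightarrow> z \<le> H q x" for x r z
    unfolding F_def using that by (intro cINF_greatest Q_ne) auto
  have F_meas [measurable]: "(\<lambda>x. F x r) \<in> borel_measurable N" for r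
    unfolding F_def using bdd by (intro borel_measurable_cINF countable_Q) auto
  have F_mono: "F x r \<le> F x s" if "r \<le> s" for x r s
    using that by (intro F_ge F_le) auto
  have F_neg: "F x r = 0" if r: "r < 0" for x r
  proof -
    obtain q where "q \<in> \<rat>" "r < q" "q < 0"
      using Rats_dense_in_real[OF r] by blast
    then have "F x r \<le> 0"
      using F_le[of q r x] by (simp add: H_def)
    moreover have "0 \<le> F x r"
      by (intro F_ge H_bounds)
    ultimately show ?thesis by simp
  qed
  have F_one: "F x r = 1" if "1 \<le> r" for x r
  proof (rule antisym)
    obtain q where "q \<in> \<rat>" "r < q"
      using Q_ne[of r] by auto
    then show "F x r \<le> 1"
      using F_le[of q r x] H_bounds(2)[of q x] by linarith
    show "1 \<le> F x r"
      using that by (intro F_ge) (auto simp: H_def)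
  qed
  have F_right: "continuous (at_right a) (F x)" for a x
    unfolding continuous_within
  proof (rule decreasing_tendsto)
    show "\<forall>\<^sub>F s in at_right a. F x a \<le> F x s"
      by (auto simp: eventually_at_right_field intro!: exI[of _ "a + 1"] F_mono)
    fix z assume "F x a < z"
    then obtain q where q: "q \<in> \<rat>" "a < q" "H q x < z"
      unfolding F_def using cINF_less_iff[OF Q_ne bdd] by auto
    have "F x s < z" if "s < q" for s
      using F_le[OF q(1) that, of x] q(3) by simp
    then show "\<forall>\<^sub>F s in at_right a. F x s < z"
      using q by (auto simp: eventually_at_right_field)
  qed
  have F_bot: "(F x \<longlongrightarrow> 0) at_bot" for x
    by (rule tendsto_eventually) (auto simp: eventually_at_bot_dense F_neg intro!: exI[of _ 0])
  have F_top: "(F x \<longlongrightarrow> 1) at_top" for x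
    by (rule tendsto_eventually) (auto simp: eventually_at_top_linorder F_one intro!: exI[of _ 1])

  define \<kappa> where "\<kappa> x = interval_measure (F x)" for x
  have \<kappa>_dist: "real_distribution (\<kappa> x)" for x
    unfolding \<kappa>_def by (rule real_distribution_interval_measure[OF F_mono F_right F_bot F_top])
  have \<kappa>_cdf: "emeasure (\<kappa> x) {..r} = F x r" for x r
    unfolding \<kappa>_def by (rule emeasure_interval_measure_Iic[OF F_mono F_right F_bot])
  have \<kappa>_meas [measurable]: "\<kappa> \<in> N \<rightarrow>\<^sub>M prob_algebra borel"
  proof (rule measurable_prob_algebra_generated[where \<Omega>=UNIV and G="range atMost"])
    show "sets borel = sigma_sets UNIV (range (atMost :: real \<Rightarrow> _))"
      by (subst borel_eq_atMost) (simp add: sets_measure_of)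
    show "Int_stable (range (atMost :: real \<Rightarrow> _))"
      by (auto simp: Int_stable_def)
    show "prob_space (\<kappa> x)" for x
      using \<kappa>_dist by (simp add: real_distribution_def)
  qed (auto simp: \<kappa>_cdf, auto simp: \<kappa>_def)

  \<comment> \<open>One inequality holds pointwise, because the derivative at \<open>r\<close> lies below those at the rationals
    above \<open>r\<close>. Right continuity of the distribution function of \<open>Y\<close> gives equality of the total
    integrals, hence equality almost everywhere.\<close>
  have F_int: "(\<integral>\<^sup>+x. ennreal (F x r) * indicator A x \<partial>PX) = emeasure (L r) A" if A [measurable]: "A \<in> sets N" for r A
  proof -
    have lower: "AE x in PX. g r x \<le> ennreal (F x r)"
    proof -
      have "AE x in PX. \<forall>q\<in>\<rat>. r < q \<longrightarrow> g r x \<le> g q x"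
        using g_mono by (simp add: AE_ball_countable countable_rat)
      with H_g show ?thesis
      proof eventually_elim
        case (elim x)
        have *: "g r x \<le> ennreal (H q x)" if "q \<in> \<rat>" "r < q" for q
          using elim that by simp
        obtain q where "q \<in> \<rat>" "r < q"
          using Q_ne[of r] by auto
        from *[OF this] have "g r x < \<infinity>"
          by (simp add: le_less_trans)
        then obtain z where z: "0 \<le> z" "g r x = ennreal z"
          by (cases "g r x") auto
        have "z \<le> F x r"
          using * z H_bounds by (intro F_ge) (simp add: ennreal_le_iff)
        with z show ?case
          by (simp add: ennreal_leI)
      qed
    qed
    have upper: "(\<integral>\<^sup>+x. ennreal (F x r) \<partial>PX) \<le> emeasure (L r) (space N)"
    proof -
      interpret D: real_distribution "distr P borel Y"
        by (rule P.real_distribution_distr) simp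
      have cdf: "ennreal (cdf (distr P borel Y) s) = emeasure (L s) (space N)" for s
      proof -
        have "emeasure (L s) (space N) = emeasure P (Y -` {..s} \<inter> space P)"
          using measurable_space[OF X] by (auto simp: L intro!: arg_cong[where f="emeasure P"])
        then show ?thesis
          by (simp add: cdf_def measure_distr P.emeasure_eq_measure)
      qed
      have "(\<integral>\<^sup>+x. ennreal (F x r) \<partial>PX) \<le> ennreal (cdf (distr P borel Y) q)" if q: "q \<in> \<rat>" "r < q" for q
      proof -
        have "(\<integral>\<^sup>+x. ennreal (F x r) \<partial>PX) \<le> (\<integral>\<^sup>+x. g q x * indicator (space N) x \<partial>PX)"
          using H_g
        proof (intro nn_integral_mono_AE, elim AE_mp, intro AE_I2 impI)
          fix x assume "x \<in> space PX" "\<forall>q\<in>\<rat>. ennreal (H q x) = g q x"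
          then show "ennreal (F x r) \<le> g q x * indicator (space N) x"
            using q F_le[OF q, of x] by (metis ennreal_leI indicator_simps(1) mult.right_neutral space_PX)
        qed
        then show ?thesis
          using g[of "space N" q] cdf by simp
      qed
      moreover have "(\<integral>\<^sup>+x. ennreal (F x r) \<partial>PX) \<le> ennreal (cdf (distr P borel Y) s)" if rs: "r < s" for s
      proof -
        obtain q where q: "q \<in> \<rat>" "r < q" "q < s"
          using Rats_dense_in_real[OF rs] by blast
        show ?thesis
          using calculation[OF q(1,2)] D.cdf_nondecreasing[of q s] q(3) ennreal_leI order_trans by fastforce
      qed
      then have "\<forall>\<^sub>F s in at_right r. (\<integral>\<^sup>+x. ennreal (F x r) \<partial>PX) \<le> ennreal (cdf (distr P borel Y) s)"
        by (auto simp: eventually_at_right_field intro!: exI[of _ "r + 1"])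
      moreover have "((\<lambda>s. ennreal (cdf (distr P borel Y) s)) \<longlongrightarrow> ennreal (cdf (distr P borel Y) r)) (at_right r)"
        using D.cdf_is_right_cont[of r] by (intro tendsto_ennrealI) (simp add: continuous_within)
      ultimately have "(\<integral>\<^sup>+x. ennreal (F x r) \<partial>PX) \<le> ennreal (cdf (distr P borel Y) r)"
        by (intro tendsto_lowerbound) auto
      then show ?thesis
        by (simp add: cdf)
    qed
    have "(\<integral>\<^sup>+x. (ennreal (F x r) - g r x) \<partial>PX) = (\<integral>\<^sup>+x. ennreal (F x r) \<partial>PX) - (\<integral>\<^sup>+x. g r x \<partial>PX)"
      using g_fin[of r] lower by (intro nn_integral_diff) auto
    also have "(\<integral>\<^sup>+x. g r x \<partial>PX) = emeasure (L r) (space N)"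
      by (rule g_total)
    also have "(\<integral>\<^sup>+x. ennreal (F x r) \<partial>PX) - \<dots> = 0"
      using upper L_le[of "space N" r] by (simp add: diff_eq_0_iff_ennreal le_less_trans top_unique)
    finally have "AE x in PX. ennreal (F x r) - g r x = 0"
      by (subst (asm) nn_integral_0_iff_AE) auto
    with lower have "AE x in PX. ennreal (F x r) = g r x"
      by eventually_elim (auto simp: diff_eq_0_iff_ennreal)
    then have "(\<integral>\<^sup>+x. ennreal (F x r) * indicator A x \<partial>PX) = (\<integral>\<^sup>+x. g r x * indicator A x \<partial>PX)"
      by (intro nn_integral_cong_AE) auto
    then show ?thesis
      by (simp add: g A)
  qed

  have "regular_cond_law P N borel X Y \<kappa>"
    unfolding regular_cond_law_def
  proof (intro conjI ballI)
    show "\<kappa> \<in> N \<rightarrow>\<^sub>M prob_algebra borel" by simp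
    fix A and B :: "real set" assume A [measurable]: "A \<in> sets N" and B [measurable]: "B \<in> sets borel"
    have \<kappa>' [measurable]: "\<kappa> \<in> N \<rightarrow>\<^sub>M subprob_algebra borel"
      using \<kappa>_meas by (rule measurable_prob_algebraD)
    define M1 where "M1 = distr (density P (\<lambda>\<omega>. indicator A (X \<omega>))) borel Y"
    define M2 where "M2 = density PX (indicator A) \<bind> \<kappa>"
    have M1: "emeasure M1 C = emeasure P {\<omega> \<in> space P. X \<omega> \<in> A \<and> Y \<omega> \<in> C}" if [measurable]: "C \<in> sets borel" for C
    proof -
      have "emeasure M1 C = (\<integral>\<^sup>+\<omega>. indicator {\<omega> \<in> space P. X \<omega> \<in> A \<and> Y \<omega> \<in> C} \<omega> \<partial>P)"
        unfolding M1_def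
        by (subst emeasure_distr)
          (auto simp: emeasure_density simp del: nn_integral_indicator
          intro!: nn_integral_cong split: split_indicator)
      then show ?thesis by simp
    qed
    have ne: "space (density PX (indicator A)) \<noteq> {}"
      using PX.not_empty by simp
    have M2: "emeasure M2 C = (\<integral>\<^sup>+x. emeasure (\<kappa> x) C * indicator A x \<partial>PX)" if [measurable]: "C \<in> sets borel" for C
      unfolding M2_def using ne
      by (subst emeasure_bind[where N=borel]) (auto simp: nn_integral_density mult.commute)
    have sets_M2: "sets M2 = sets borel"
      unfolding M2_def using ne by (subst sets_bind[where N=borel]) (auto simp: \<kappa>_def)
    have cdf_eq: "emeasure M1 {..r} = emeasure M2 {..r}" for r
      by (simp add: M1 M2 \<kappa>_cdf F_int L)
    have "M1 = M2"
    proof (rule cdf_unique')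
      have borel_UNIV: "UNIV \<in> sets (borel :: real measure)"
        by simp
      have *: "emeasure (\<kappa> x) UNIV \<le> 1" for x
        using \<kappa>_dist[of x] by (metis prob_space.measure_le_1 real_distribution_def)
      have "emeasure M2 UNIV \<le> (\<integral>\<^sup>+x. 1 \<partial>PX)"
        unfolding M2[OF borel_UNIV]
        using * by (intro nn_integral_mono) (auto split: split_indicator)
      then have "emeasure M2 UNIV \<le> 1"
        by (simp add: PX.emeasure_space_1[simplified])
      moreover have "space M2 = UNIV"
        using sets_eq_imp_space_eq[OF sets_M2] by simp
      ultimately show "finite_borel_measure M2"
        using sets_M2 by (auto intro!: finite_borel_measure.intro finite_measureI
            simp: finite_borel_measure_axioms_def top_unique)
      have "emeasure M1 UNIV \<le> 1"
        by (simp add: M1 P.measure_le_1)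
      then show "finite_borel_measure M1"
        by (auto intro!: finite_borel_measure.intro finite_measureI
            simp: finite_borel_measure_axioms_def top_unique M1_def)
      show "cdf M1 = cdf M2"
        by (simp add: fun_eq_iff cdf_def measure_def cdf_eq)
    qed
    then have "emeasure P {\<omega> \<in> space P. X \<omega> \<in> A \<and> Y \<omega> \<in> B} = (\<integral>\<^sup>+x. emeasure (\<kappa> x) B * indicator A x \<partial>PX)"
      using M1[OF B] M2[OF B] by simp
    also have "\<dots> = (\<integral>\<^sup>+\<omega>. indicator A (X \<omega>) * emeasure (\<kappa> (X \<omega>)) B \<partial>P)"
      unfolding PX_def by (subst nn_integral_distr) (auto simp: mult.commute)
    finally show "emeasure P {\<omega> \<in> space P. X \<omega> \<in> A \<and> Y \<omega> \<in> B} =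
        (\<integral>\<^sup>+\<omega>. indicator A (X \<omega>) * emeasure (\<kappa> (X \<omega>)) B \<partial>P)" .
  qed
  then show ?thesis
    by blast
qed

text \<open>Only the digits 0 and 2 occur, so the codes lie in the Cantor set. Its gap around \<open>1 / 2\<close> makes the
  first bit readable from the code, and \<open>r \<mapsto> 3 r - 2 b\<close> then removes that bit.\<close>

definition ternary_code :: "(nat \<Rightarrow> bool) \<Rightarrow> real" where
  "ternary_code b = (\<Sum>n. (2 * of_bool (b n)) / 3 ^ Suc n)"

primrec ternary_digit :: "nat \<Rightarrow> real \<Rightarrow> bool" where
  "ternary_digit 0 r \<longleftrightarrow> 1 \<le> 2 * r"
| "ternary_digit (Suc n) r = ternary_digit n (3 * r - 2 * of_bool (1 \<le> 2 * r))"

lemma ternary_summable: "summable (\<lambda>n. (2 * of_bool (b n)) / 3 ^ Suc n :: real)"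
proof (rule summable_comparison_test')
  show "summable (\<lambda>n. (2 / 3) * (1 / 3) ^ n :: real)"
    by (intro summable_mult summable_geometric) simp
  show "norm ((2 * of_bool (b n)) / 3 ^ Suc n :: real) \<le> (2 / 3) * (1 / 3) ^ n" for n
    by (simp add: power_one_over)
qed

lemma ternary_code_bounds: "0 \<le> ternary_code b" "ternary_code b \<le> 1"
proof -
  show "0 \<le> ternary_code b"
    unfolding ternary_code_def by (intro suminf_nonneg ternary_summable) simp
  have "ternary_code b \<le> (\<Sum>n. (2 / 3) * (1 / 3) ^ n)"
    unfolding ternary_code_def
    by (intro suminf_le ternary_summable summable_mult summable_geometric) (simp_all add: power_one_over)
  also have "\<dots> = 1"
    by (subst suminf_mult) (simp_all add: suminf_geometric summable_geometric)
  finally show "ternary_code b \<le> 1" .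
qed

lemma ternary_code_Suc: "3 * ternary_code b = 2 * of_bool (b 0) + ternary_code (\<lambda>n. b (Suc n))"
proof -
  have "ternary_code b = (2 * of_bool (b 0)) / 3 + (\<Sum>n. (2 * of_bool (b (Suc n))) / 3 ^ Suc (Suc n))"
    unfolding ternary_code_def using suminf_split_initial_segment[OF ternary_summable[of b], of 1]
    by simp
  also have "(\<Sum>n. (2 * of_bool (b (Suc n))) / 3 ^ Suc (Suc n))
      = (\<Sum>n. (1 / 3) * ((2 * of_bool (b (Suc n))) / 3 ^ Suc n) :: real)"
    by simp
  also have "\<dots> = (1 / 3) * ternary_code (\<lambda>n. b (Suc n))"
    unfolding ternary_code_def by (intro suminf_mult ternary_summable)
  finally show ?thesis by simp
qed

lemma ternary_digit_code: "ternary_digit n (ternary_code b) = b n"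
proof (induction n arbitrary: b)
  have first: "1 \<le> 2 * ternary_code b \<longleftrightarrow> b 0" for b
    using ternary_code_Suc[of b] ternary_code_bounds[of "\<lambda>n. b (Suc n)"] by (cases "b 0") auto
  {
    case 0
    show ?case by (simp add: first)
  next
    case (Suc n)
    have "3 * ternary_code b - 2 * of_bool (1 \<le> 2 * ternary_code b) = ternary_code (\<lambda>n. b (Suc n))"
      using ternary_code_Suc[of b] by (simp add: first)
    then show ?case
      by (simp add: Suc)
  }
qed

lemma measurable_ternary_digit [measurable]: "Measurable.pred borel (ternary_digit n)"
  by (induction n) (auto intro: measurable_compose_rev[of "ternary_digit _"])

text \<open>A vector is determined by the bits that compare its coordinates with the rational numbers: each
  coordinate is the supremum of the rationals below it. Coding these countably many bits gives \<open>e\<close>, and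
  taking suprema over the decoded bits gives \<open>r\<close>, which is measurable on the whole real line.\<close>

lemma borel_vec_unit_interval_embedding:
  obtains e :: "real ^ 'd::finite \<Rightarrow> real" and r :: "real \<Rightarrow> real ^ 'd"
  where "e \<in> borel_measurable borel" "r \<in> borel_measurable borel"
    "\<And>v. 0 \<le> e v \<and> e v \<le> 1" "\<And>v. r (e v) = v"
proof
  define bit where "bit v n = (case from_nat n of (k :: 'd, q :: rat) \<Rightarrow> of_rat q < v $ k)" for v :: "real ^ 'd" and n
  define e where "e v = ternary_code (bit v)" for v
  define r where "r s = (\<chi> k. real_of_ereal (SUP q::rat. if ternary_digit (to_nat (k :: 'd, q)) s
      then ereal (of_rat q) else - \<infinity>))" for s
  have [measurable]: "Measurable.pred borel (\<lambda>v. bit v n)" for n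
    unfolding bit_def by (cases "from_nat n :: 'd \<times> rat") simp
  show "e \<in> borel_measurable borel"
    unfolding e_def ternary_code_def by measurable
  show "r \<in> borel_measurable borel"
  proof (subst borel_measurable_euclidean_space, intro ballI)
    fix i :: "real ^ 'd" assume "i \<in> Basis"
    then obtain k where "i = axis k 1"
      by (auto simp: Basis_vec_def)
    then have "(\<lambda>s. r s \<bullet> i) = (\<lambda>s. real_of_ereal (SUP q::rat. if ternary_digit (to_nat (k, q)) s
        then ereal (of_rat q) else - \<infinity>))"
      by (simp only: r_def inner_axis vec_lambda_beta inner_real_def mult_1_right)
    also have "\<dots> \<in> borel_measurable borel"
      by measurable
    finally show "(\<lambda>s. r s \<bullet> i) \<in> borel_measurable borel" .
  qed
  show "0 \<le> e v \<and> e v \<le> 1" for v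
    by (simp add: e_def ternary_code_bounds)
  show "r (e v) = v" for v
  proof -
    have "(SUP q::rat. if of_rat q < x then ereal (of_rat q) else - \<infinity>) = ereal x" for x :: real
    proof (rule antisym)
      show "(SUP q::rat. if of_rat q < x then ereal (of_rat q) else - \<infinity>) \<le> ereal x"
        by (rule SUP_least) auto
      show "ereal x \<le> (SUP q::rat. if of_rat q < x then ereal (of_rat q) else - \<infinity>)"
      proof (rule dense_le)
        fix z assume "z < ereal x"
        then obtain y where y: "z < ereal y" "y < x"
          by (metis ereal_dense2 less_ereal.simps(1))
        obtain q :: rat where "y < of_rat q" "of_rat q < x"
          using of_rat_dense[OF y(2)] by blast
        with y(1) show "z \<le> (SUP q::rat. if of_rat q < x then ereal (of_rat q) else - \<infinity>)"
          by (intro SUP_upper2[of q]) (auto intro!: less_imp_le less_trans[OF y(1)])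
      qed
    qed
    then show ?thesis
      by (simp add: vec_eq_iff e_def r_def ternary_digit_code bit_def)
  qed
qed

text \<open>Code \<open>Y\<close> as a number, condition, and decode the conditional law.\<close>

theorem vec_regular_cond_law_exists:
  fixes Y :: "'a \<Rightarrow> real ^ 'd::finite"
  assumes P: "prob_space P" and X [measurable]: "X \<in> P \<rightarrow>\<^sub>M N" and Y [measurable]: "Y \<in> borel_measurable P"
  shows "\<exists>\<kappa>. regular_cond_law P N borel X Y \<kappa>"
proof -
  obtain e :: "real ^ 'd \<Rightarrow> real" and r where e [measurable]: "e \<in> borel_measurable borel"
    and r [measurable]: "r \<in> borel_measurable borel"
    and e01: "\<And>v. 0 \<le> e v \<and> e v \<le> 1" and re: "\<And>v. r (e v) = v"
    using borel_vec_unit_interval_embedding by blast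
  have "\<exists>\<kappa>. regular_cond_law P N borel X (\<lambda>\<omega>. e (Y \<omega>)) \<kappa>"
    by (intro unit_interval_regular_cond_law_exists P) (simp_all add: e01)
  then obtain \<kappa> where \<kappa>: "regular_cond_law P N borel X (\<lambda>\<omega>. e (Y \<omega>)) \<kappa>" ..
  then have \<kappa>_meas [measurable]: "\<kappa> \<in> N \<rightarrow>\<^sub>M prob_algebra borel"
    by (simp add: regular_cond_law_def)
  have "regular_cond_law P N borel X Y (\<lambda>x. distr (\<kappa> x) borel r)"
    unfolding regular_cond_law_def
  proof (intro conjI ballI)
    show "(\<lambda>x. distr (\<kappa> x) borel r) \<in> N \<rightarrow>\<^sub>M prob_algebra borel"
      by measurable
    fix A and B :: "(real ^ 'd) set" assume A: "A \<in> sets N" and B: "B \<in> sets borel"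
    have B': "r -` B \<in> sets borel"
      using measurable_sets[OF r B] by simp
    have *: "emeasure (distr (\<kappa> x) borel r) B = emeasure (\<kappa> x) (r -` B)" if "x \<in> space N" for x
    proof -
      have "sets (\<kappa> x) = sets borel"
        using measurable_space[OF \<kappa>_meas that] by (simp add: space_prob_algebra)
      then have "r \<in> borel_measurable (\<kappa> x)" "space (\<kappa> x) = UNIV"
        using sets_eq_imp_space_eq[of "\<kappa> x" borel] by (simp_all cong: measurable_cong_sets)
      then show ?thesis
        using B by (simp add: emeasure_distr)
    qed
    have "emeasure P {\<omega> \<in> space P. X \<omega> \<in> A \<and> Y \<omega> \<in> B}
        = emeasure P {\<omega> \<in> space P. X \<omega> \<in> A \<and> e (Y \<omega>) \<in> r -` B}"
      by (simp add: re)
    also have "\<dots> = (\<integral>\<^sup>+\<omega>. indicator A (X \<omega>) * emeasure (\<kappa> (X \<omega>)) (r -` B) \<partial>P)"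
      using \<kappa> A B' unfolding regular_cond_law_def by blast
    also have "\<dots> = (\<integral>\<^sup>+\<omega>. indicator A (X \<omega>) * emeasure (distr (\<kappa> (X \<omega>)) borel r) B \<partial>P)"
      using measurable_space[OF X] by (intro nn_integral_cong) (simp add: *)
    finally show "emeasure P {\<omega> \<in> space P. X \<omega> \<in> A \<and> Y \<omega> \<in> B} =
        (\<integral>\<^sup>+\<omega>. indicator A (X \<omega>) * emeasure (distr (\<kappa> (X \<omega>)) borel r) B \<partial>P)" .
  qed
  then show ?thesis
    by blast
qed

section \<open>Conditional laws as iterated integrals\<close>

text \<open>Both sides integrate \<open>h\<close> against a probability measure on the product space. The defining
  property of a regular conditional law says that the two measures agree on rectangles.\<close>

lemma regular_cond_law_nn_integral:
  assumes P: "prob_space P" and X [measurable]: "X \<in> P \<rightarrow>\<^sub>M N" and Y [measurable]: "Y \<in> P \<rightarrow>\<^sub>M L"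
    and \<kappa>: "regular_cond_law P N L X Y \<kappa>" and h [measurable]: "h \<in> borel_measurable (N \<Otimes>\<^sub>M L)"
  shows "(\<integral>\<^sup>+\<omega>. h (X \<omega>, Y \<omega>) \<partial>P) = (\<integral>\<^sup>+\<omega>. (\<integral>\<^sup>+y. h (X \<omega>, y) \<partial>\<kappa> (X \<omega>)) \<partial>P)"
proof -
  interpret P: prob_space P by (rule P)
  have \<kappa>_meas [measurable]: "\<kappa> \<in> N \<rightarrow>\<^sub>M prob_algebra L"
    and eq: "\<And>A B. A \<in> sets N \<Longrightarrow> B \<in> sets L \<Longrightarrow> emeasure P {\<omega> \<in> space P. X \<omega> \<in> A \<and> Y \<omega> \<in> B} =
        (\<integral>\<^sup>+\<omega>. indicator A (X \<omega>) * emeasure (\<kappa> (X \<omega>)) B \<partial>P)"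
    using \<kappa> by (auto simp: regular_cond_law_def)
  have [measurable]: "(\<lambda>x. distr (\<kappa> x) (N \<Otimes>\<^sub>M L) (Pair x)) \<in> N \<rightarrow>\<^sub>M prob_algebra (N \<Otimes>\<^sub>M L)"
    by (rule measurable_distr_prob_space2) measurable
  define J where "J = distr P (N \<Otimes>\<^sub>M L) (\<lambda>\<omega>. (X \<omega>, Y \<omega>))"
  define D where "D = distr P N X \<bind> (\<lambda>x. distr (\<kappa> x) (N \<Otimes>\<^sub>M L) (Pair x))"
  have DX: "distr P N X \<in> space (prob_algebra N)"
    by (simp add: space_prob_algebra P.prob_space_distr)
  have sets_D: "sets D = sets (N \<Otimes>\<^sub>M L)"
    unfolding D_def by (rule sets_bind'[OF DX]) measurable
  have sets_\<kappa>: "sets (\<kappa> x) = sets L" if "x \<in> space N" for x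
    using measurable_space[OF \<kappa>_meas that] by (simp add: space_prob_algebra)
  have D_int: "(\<integral>\<^sup>+z. h z \<partial>D) = (\<integral>\<^sup>+\<omega>. (\<integral>\<^sup>+y. h (X \<omega>, y) \<partial>\<kappa> (X \<omega>)) \<partial>P)"
    if [measurable]: "h \<in> borel_measurable (N \<Otimes>\<^sub>M L)" for h
  proof -
    have "(\<integral>\<^sup>+z. h z \<partial>D) = (\<integral>\<^sup>+x. (\<integral>\<^sup>+z. h z \<partial>distr (\<kappa> x) (N \<Otimes>\<^sub>M L) (Pair x)) \<partial>distr P N X)"
      unfolding D_def by (rule nn_integral_bind[where B="N \<Otimes>\<^sub>M L"]) (auto intro: measurable_prob_algebraD)
    also have "\<dots> = (\<integral>\<^sup>+x. (\<integral>\<^sup>+y. h (x, y) \<partial>\<kappa> x) \<partial>distr P N X)"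
    proof (intro nn_integral_cong)
      fix x assume "x \<in> space (distr P N X)"
      then have x: "x \<in> space N" by simp
      have [measurable]: "Pair x \<in> \<kappa> x \<rightarrow>\<^sub>M N \<Otimes>\<^sub>M L"
        using x sets_\<kappa>[OF x] by (simp cong: measurable_cong_sets)
      show "(\<integral>\<^sup>+z. h z \<partial>distr (\<kappa> x) (N \<Otimes>\<^sub>M L) (Pair x)) = (\<integral>\<^sup>+y. h (x, y) \<partial>\<kappa> x)"
        by (subst nn_integral_distr) auto
    qed
    also have "\<dots> = (\<integral>\<^sup>+\<omega>. (\<integral>\<^sup>+y. h (X \<omega>, y) \<partial>\<kappa> (X \<omega>)) \<partial>P)"
      by (rule nn_integral_distr[OF X])
        (auto intro!: nn_integral_measurable_subprob_algebra2[where N=L] measurable_prob_algebraD)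
    finally show ?thesis .
  qed
  have "J = D"
  proof (rule measure_eqI_generator_eq)
    let ?E = "{a \<times> b | a b. a \<in> sets N \<and> b \<in> sets L}"
    show "Int_stable ?E"
      by (rule Int_stable_pair_measure_generator)
    show "?E \<subseteq> Pow (space N \<times> space L)"
      using sets.sets_into_space[of _ N] sets.sets_into_space[of _ L] by auto
    show "sets J = sigma_sets (space N \<times> space L) ?E" "sets D = sigma_sets (space N \<times> space L) ?E"
      by (simp_all add: J_def sets_D sets_pair_measure)
    show "range (\<lambda>i::nat. space N \<times> space L) \<subseteq> ?E" "(\<Union>i::nat. space N \<times> space L) = space N \<times> space L"
      by auto
    interpret J: prob_space J
      unfolding J_def by (rule P.prob_space_distr) simp
    show "emeasure J (space N \<times> space L) \<noteq> \<infinity>" for i :: nat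
      by simp
    fix Z assume "Z \<in> ?E"
    then obtain A B where Z: "Z = A \<times> B" and [measurable]: "A \<in> sets N" "B \<in> sets L" by auto
    have "emeasure J Z = emeasure P {\<omega> \<in> space P. X \<omega> \<in> A \<and> Y \<omega> \<in> B}"
      unfolding J_def Z by (subst emeasure_distr) (auto intro!: arg_cong[where f="emeasure P"])
    also have "\<dots> = (\<integral>\<^sup>+\<omega>. indicator A (X \<omega>) * emeasure (\<kappa> (X \<omega>)) B \<partial>P)"
      by (rule eq) auto
    also have "\<dots> = (\<integral>\<^sup>+\<omega>. (\<integral>\<^sup>+y. indicator Z (X \<omega>, y) \<partial>\<kappa> (X \<omega>)) \<partial>P)"
    proof (intro nn_integral_cong)
      fix \<omega> assume "\<omega> \<in> space P"
      then have "X \<omega> \<in> space N"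
        by (rule measurable_space[OF X])
      then have "B \<in> sets (\<kappa> (X \<omega>))"
        using sets_\<kappa> by auto
      then show "indicator A (X \<omega>) * emeasure (\<kappa> (X \<omega>)) B = (\<integral>\<^sup>+y. indicator Z (X \<omega>, y) \<partial>\<kappa> (X \<omega>))"
        by (simp add: Z indicator_times nn_integral_cmult)
    qed
    also have "\<dots> = (\<integral>\<^sup>+z. indicator Z z \<partial>D)"
      by (rule D_int[symmetric]) (simp add: Z)
    also have "\<dots> = emeasure D Z"
      by (rule nn_integral_indicator) (simp add: sets_D Z)
    finally show "emeasure J Z = emeasure D Z" .
  qed
  have "(\<integral>\<^sup>+\<omega>. h (X \<omega>, Y \<omega>) \<partial>P) = (\<integral>\<^sup>+z. h z \<partial>J)"
    unfolding J_def by (subst nn_integral_distr) auto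
  also have "\<dots> = (\<integral>\<^sup>+\<omega>. (\<integral>\<^sup>+y. h (X \<omega>, y) \<partial>\<kappa> (X \<omega>)) \<partial>P)"
    unfolding \<open>J = D\<close> by (rule D_int) simp
  finally show ?thesis .
qed

lemma regular_cond_lawI:
  assumes X [measurable]: "X \<in> P \<rightarrow>\<^sub>M N" and Y [measurable]: "Y \<in> P \<rightarrow>\<^sub>M L"
    and \<kappa> [measurable]: "\<kappa> \<in> N \<rightarrow>\<^sub>M prob_algebra L"
    and int: "\<And>h. h \<in> borel_measurable (N \<Otimes>\<^sub>M L) \<Longrightarrow>
      (\<integral>\<^sup>+\<omega>. h (X \<omega>, Y \<omega>) \<partial>P) = (\<integral>\<^sup>+\<omega>. (\<integral>\<^sup>+y. h (X \<omega>, y) \<partial>\<kappa> (X \<omega>)) \<partial>P)"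
  shows "regular_cond_law P N L X Y \<kappa>"
  unfolding regular_cond_law_def
proof (intro conjI ballI \<kappa>)
  fix A B assume [measurable]: "A \<in> sets N" "B \<in> sets L"
  have "emeasure P {\<omega> \<in> space P. X \<omega> \<in> A \<and> Y \<omega> \<in> B} = (\<integral>\<^sup>+\<omega>. indicator {\<omega> \<in> space P. X \<omega> \<in> A \<and> Y \<omega> \<in> B} \<omega> \<partial>P)"
    by (rule nn_integral_indicator[symmetric]) measurable
  also have "\<dots> = (\<integral>\<^sup>+\<omega>. indicator (A \<times> B) (X \<omega>, Y \<omega>) \<partial>P)"
    by (intro nn_integral_cong) (auto split: split_indicator)
  also have "\<dots> = (\<integral>\<^sup>+\<omega>. (\<integral>\<^sup>+y. indicator (A \<times> B) (X \<omega>, y) \<partial>\<kappa> (X \<omega>)) \<partial>P)"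
    by (rule int) measurable
  also have "\<dots> = (\<integral>\<^sup>+\<omega>. indicator A (X \<omega>) * emeasure (\<kappa> (X \<omega>)) B \<partial>P)"
  proof (intro nn_integral_cong)
    fix \<omega> assume "\<omega> \<in> space P"
    then have "X \<omega> \<in> space N"
      by (rule measurable_space[OF X])
    then have "B \<in> sets (\<kappa> (X \<omega>))"
      using measurable_space[OF \<kappa>] \<open>B \<in> sets L\<close> by (auto simp: space_prob_algebra)
    then show "(\<integral>\<^sup>+y. indicator (A \<times> B) (X \<omega>, y) \<partial>\<kappa> (X \<omega>)) = indicator A (X \<omega>) * emeasure (\<kappa> (X \<omega>)) B"
      by (simp add: indicator_times nn_integral_cmult)
  qed
  finally show "emeasure P {\<omega> \<in> space P. X \<omega> \<in> A \<and> Y \<omega> \<in> B} =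
      (\<integral>\<^sup>+\<omega>. indicator A (X \<omega>) * emeasure (\<kappa> (X \<omega>)) B \<partial>P)" .
qed

text \<open>The quotient of \<open>F'\<close> by its fibre integral. Where that integral is 0 or infinite, \<open>f\<close> is set to 1, so that
  \<open>f\<close> is a probability density on every fibre; the last equation survives, because \<open>F'\<close> vanishes almost
  everywhere on fibres with vanishing integral, and almost no fibre has an infinite one.\<close>

lemma conditional_density_exists:
  fixes F :: "'a \<Rightarrow> ennreal" and F' :: "'a \<times> 'b \<Rightarrow> ennreal"
  assumes R [measurable_cong]: "sets R = sets N" and k [measurable]: "k \<in> N \<rightarrow>\<^sub>M prob_algebra L"
    and [measurable]: "F \<in> borel_measurable N" "F' \<in> borel_measurable (N \<Otimes>\<^sub>M L)"
    and int: "AE x in R. (\<integral>\<^sup>+v. F' (x, v) \<partial>k x) = F x" and fin: "AE x in R. F x < \<infinity>"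
  obtains f where "f \<in> borel_measurable (N \<Otimes>\<^sub>M L)" "\<And>x. x \<in> space N \<Longrightarrow> (\<integral>\<^sup>+v. f (x, v) \<partial>k x) = 1"
    "AE x in R. AE v in k x. F' (x, v) = F x * f (x, v)"
proof
  define I where "I x = (\<integral>\<^sup>+v. F' (x, v) \<partial>k x)" for x
  define f where "f z = (if 0 < I (fst z) \<and> I (fst z) < \<infinity> then F' z / I (fst z) else 1)" for z
  have k' [measurable]: "k \<in> N \<rightarrow>\<^sub>M subprob_algebra L"
    using k by (rule measurable_prob_algebraD)
  have I [measurable]: "I \<in> borel_measurable N"
    unfolding I_def by (intro nn_integral_measurable_subprob_algebra2[where N=L]) auto
  show "f \<in> borel_measurable (N \<Otimes>\<^sub>M L)"
    unfolding f_def by measurable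
  have F'_x: "(\<lambda>v. F' (x, v)) \<in> borel_measurable (k x)" if "x \<in> space N" for x
  proof -
    have "sets (k x) = sets L"
      using measurable_space[OF k that] by (simp add: space_prob_algebra)
    then show ?thesis
      using that by (simp cong: measurable_cong_sets)
  qed
  show "(\<integral>\<^sup>+v. f (x, v) \<partial>k x) = 1" if x: "x \<in> space N" for x
  proof (cases "0 < I x \<and> I x < \<infinity>")
    case True
    then have "(\<integral>\<^sup>+v. f (x, v) \<partial>k x) = (\<integral>\<^sup>+v. F' (x, v) \<partial>k x) / I x"
      unfolding f_def by (simp add: nn_integral_divide F'_x[OF x])
    then show ?thesis
      using True by (auto simp: I_def[symmetric] intro: ennreal_divide_self)
  next
    case False
    interpret prob_space "k x"
      using measurable_space[OF k x] by (simp add: space_prob_algebra)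
    show ?thesis
      using False by (auto simp: f_def emeasure_space_1)
  qed
  show "AE x in R. AE v in k x. F' (x, v) = F x * f (x, v)"
    using int fin AE_space
  proof eventually_elim
    case (elim x)
    then have x: "x \<in> space N" and Ix: "I x = F x"
      using sets_eq_imp_space_eq[OF R] by (simp_all add: I_def)
    show ?case
    proof (cases "I x = 0")
      case True
      then have "AE v in k x. F' (x, v) = 0"
        unfolding I_def using F'_x[OF x] by (simp add: nn_integral_0_iff_AE)
      then show ?thesis
        by eventually_elim (use True Ix in simp)
    next
      case False
      then have "F' (x, v) = F x * f (x, v)" for v
        using elim(2) Ix by (simp add: f_def zero_less_iff_neq_zero ennreal_times_divide mult.commute[of "F x"] mult_divide_eq_ennreal)
      then show ?thesis by simp
    qed
  qed
qed

section \<open>Couplings with a prescribed diagonal part\<close>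

lemma couplings_nn_integral:
  assumes \<pi>: "\<pi> \<in> couplings M N"
  shows "h \<in> borel_measurable M \<Longrightarrow> (\<integral>\<^sup>+z. h (fst z) \<partial>\<pi>) = (\<integral>\<^sup>+x. h x \<partial>M)"
    and "h' \<in> borel_measurable N \<Longrightarrow> (\<integral>\<^sup>+z. h' (snd z) \<partial>\<pi>) = (\<integral>\<^sup>+y. h' y \<partial>N)"
proof -
  have [measurable_cong]: "sets \<pi> = sets (M \<Otimes>\<^sub>M N)"
    and fst: "distr \<pi> M fst = M" and snd: "distr \<pi> N snd = N"
    using \<pi> by (simp_all add: couplings_def)
  show "(\<integral>\<^sup>+z. h (fst z) \<partial>\<pi>) = (\<integral>\<^sup>+x. h x \<partial>M)" if [measurable]: "h \<in> borel_measurable M"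
    using nn_integral_distr[of fst \<pi> M h] by (simp add: fst)
  show "(\<integral>\<^sup>+z. h' (snd z) \<partial>\<pi>) = (\<integral>\<^sup>+y. h' y \<partial>N)" if [measurable]: "h' \<in> borel_measurable N"
    using nn_integral_distr[of snd \<pi> N h'] by (simp add: snd)
qed

lemma couplingsI:
  assumes prob: "prob_space \<pi>" and sets [measurable_cong]: "sets \<pi> = sets (M \<Otimes>\<^sub>M N)"
    and fst: "\<And>h. h \<in> borel_measurable M \<Longrightarrow> (\<integral>\<^sup>+z. h (fst z) \<partial>\<pi>) = (\<integral>\<^sup>+x. h x \<partial>M)"
    and snd: "\<And>h. h \<in> borel_measurable N \<Longrightarrow> (\<integral>\<^sup>+z. h (snd z) \<partial>\<pi>) = (\<integral>\<^sup>+y. h y \<partial>N)"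
  shows "\<pi> \<in> couplings M N"
proof -
  have *: "distr \<pi> L p = L" if [measurable]: "p \<in> \<pi> \<rightarrow>\<^sub>M L"
    and int: "\<And>h. h \<in> borel_measurable L \<Longrightarrow> (\<integral>\<^sup>+z. h (p z) \<partial>\<pi>) = (\<integral>\<^sup>+x. h x \<partial>L)" for L and p :: "_ \<Rightarrow> 'c"
  proof (rule measure_eqI)
    fix A assume "A \<in> sets (distr \<pi> L p)"
    then have A: "A \<in> sets L" by simp
    then have "(\<integral>\<^sup>+x. indicator A x \<partial>distr \<pi> L p) = (\<integral>\<^sup>+x. indicator A x \<partial>L)"
      using int[of "indicator A"] by (simp add: nn_integral_distr del: nn_integral_indicator)
    with A show "emeasure (distr \<pi> L p) A = emeasure L A"
      by simp
  qed simp
  have "distr \<pi> M fst = M" "distr \<pi> N snd = N"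
    by (auto intro!: * fst snd)
  then show ?thesis
    using prob sets by (simp add: couplings_def)
qed

text \<open>The Boolean chooses between a diagonal part with density \<open>m\<close> and the product of the
  residuals \<open>f - m\<close> and \<open>g - m\<close>, normalised by their common mass. For \<open>r = r'\<close> and \<open>m = min f g\<close> this is the maximal
  coupling of the laws with densities \<open>f\<close> and \<open>g\<close>, and for \<open>m = 0\<close> it is their independent coupling.\<close>

definition partial_diagonal_coupling ::
  "'a measure \<Rightarrow> 'a measure \<Rightarrow> ('a \<Rightarrow> ennreal) \<Rightarrow> ('a \<Rightarrow> ennreal) \<Rightarrow> ('a \<Rightarrow> ennreal) \<Rightarrow> ('a \<times> 'a) measure" where
  "partial_diagonal_coupling r r' f g m =
     distr (density (count_space UNIV \<Otimes>\<^sub>M (r \<Otimes>\<^sub>M r'))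
         (\<lambda>(b, v, v'). if b then m v else (f v - m v) * (g v' - m v') / (\<integral>\<^sup>+u. (f u - m u) \<partial>r)))
       (r \<Otimes>\<^sub>M r') (\<lambda>(b, v, v'). if b then (v, v) else (v, v'))"

lemma sets_partial_diagonal_coupling [simp, measurable_cong]:
  "sets (partial_diagonal_coupling r r' f g m) = sets (r \<Otimes>\<^sub>M r')"
  by (simp add: partial_diagonal_coupling_def)

lemma nn_integral_count_space_bool: "(\<integral>\<^sup>+b. F b \<partial>count_space UNIV) = F True + F False" for F :: "bool \<Rightarrow> ennreal"
  by (simp add: nn_integral_count_space_finite UNIV_bool add.commute)

context
  fixes r r' :: "'a measure" and f g m :: "'a \<Rightarrow> ennreal"
  assumes r: "prob_space r" and r': "prob_space r'" and sets_eq [measurable_cong]: "sets r' = sets r"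
    and f [measurable]: "f \<in> borel_measurable r" and g [measurable]: "g \<in> borel_measurable r"
    and m [measurable]: "m \<in> borel_measurable r"
begin

interpretation r: prob_space r by (rule r)
interpretation r': prob_space r' by (rule r')
interpretation rr: pair_prob_space r r' ..

lemma nn_integral_partial_diagonal_coupling:
  assumes h [measurable]: "h \<in> borel_measurable (r \<Otimes>\<^sub>M r)"
  shows "(\<integral>\<^sup>+z. h z \<partial>partial_diagonal_coupling r r' f g m) =
    (\<integral>\<^sup>+v. m v * h (v, v) \<partial>r) +
    (\<integral>\<^sup>+v. (\<integral>\<^sup>+v'. (f v - m v) * (g v' - m v') / (\<integral>\<^sup>+u. (f u - m u) \<partial>r) * h (v, v') \<partial>r') \<partial>r)"
proof -
  let ?a = "\<integral>\<^sup>+u. (f u - m u) \<partial>r"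
  let ?d = "\<lambda>(b, v, v'). if b then m v else (f v - m v) * (g v' - m v') / ?a"
  let ?B = "count_space (UNIV :: bool set) \<Otimes>\<^sub>M (r \<Otimes>\<^sub>M r')"
  let ?p = "\<lambda>(b, v, v'). if b then (v, v) else (v, v')"
  have p [measurable]: "?p \<in> ?B \<rightarrow>\<^sub>M r \<Otimes>\<^sub>M r'"
    by measurable
  have d [measurable]: "?d \<in> borel_measurable ?B"
    by measurable
  have h' [measurable]: "h \<in> borel_measurable (r \<Otimes>\<^sub>M r')"
    by measurable
  have "(\<integral>\<^sup>+z. h z \<partial>partial_diagonal_coupling r r' f g m) = (\<integral>\<^sup>+z. ?d z * h (?p z) \<partial>?B)"
    unfolding partial_diagonal_coupling_def
    by (subst nn_integral_distr) (auto simp: nn_integral_density)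
  also have "\<dots> = (\<integral>\<^sup>+b. (\<integral>\<^sup>+z. ?d (b, z) * h (?p (b, z)) \<partial>(r \<Otimes>\<^sub>M r')) \<partial>count_space UNIV)"
    by (rule rr.P.nn_integral_fst[symmetric]) measurable
  also have "\<dots> = (\<integral>\<^sup>+z. m (fst z) * h (fst z, fst z) \<partial>(r \<Otimes>\<^sub>M r')) +
      (\<integral>\<^sup>+z. (f (fst z) - m (fst z)) * (g (snd z) - m (snd z)) / ?a * h z \<partial>(r \<Otimes>\<^sub>M r'))"
    unfolding nn_integral_count_space_bool by (simp add: case_prod_beta)
  also have "(\<integral>\<^sup>+z. m (fst z) * h (fst z, fst z) \<partial>(r \<Otimes>\<^sub>M r')) = (\<integral>\<^sup>+v. m v * h (v, v) \<partial>r)"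
    by (subst r'.nn_integral_fst[symmetric]) (auto simp: r'.emeasure_space_1)
  also have "(\<integral>\<^sup>+z. (f (fst z) - m (fst z)) * (g (snd z) - m (snd z)) / ?a * h z \<partial>(r \<Otimes>\<^sub>M r')) =
      (\<integral>\<^sup>+v. (\<integral>\<^sup>+v'. (f v - m v) * (g v' - m v') / ?a * h (v, v') \<partial>r') \<partial>r)"
    by (subst r'.nn_integral_fst[symmetric]) auto
  finally show ?thesis .
qed

text \<open>The two residuals have the same mass \<open>a\<close>, because \<open>f\<close> and \<open>g\<close> have integral 1. Integrating one of them
  out cancels the denominator and leaves \<open>m + (f - m) = f\<close> or \<open>m + (g - m) = g\<close>. For \<open>a = 0\<close> the quotient \<open>a / a\<close> is not
  1, but then the residuals vanish almost everywhere.\<close>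

lemma partial_diagonal_coupling_marginals:
  assumes f1: "(\<integral>\<^sup>+v. f v \<partial>r) = 1" and g1: "(\<integral>\<^sup>+v. g v \<partial>r') = 1"
    and mf: "\<And>v. m v \<le> f v" and mg: "\<And>v. m v \<le> g v"
    and eq: "r = r' \<or> (\<forall>v. m v = 0)"
    and h [measurable]: "h \<in> borel_measurable r"
  shows "(\<integral>\<^sup>+z. h (fst z) \<partial>partial_diagonal_coupling r r' f g m) = (\<integral>\<^sup>+v. f v * h v \<partial>r)"
    and "(\<integral>\<^sup>+z. h (snd z) \<partial>partial_diagonal_coupling r r' f g m) = (\<integral>\<^sup>+v. g v * h v \<partial>r')"
proof -
  define a where "a = (\<integral>\<^sup>+u. (f u - m u) \<partial>r)"
  have m_fin: "(\<integral>\<^sup>+u. m u \<partial>r) < \<infinity>"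
    using nn_integral_mono[of r m f] mf f1 by (simp add: le_less_trans)
  have mm: "(\<integral>\<^sup>+u. m u \<partial>r) = (\<integral>\<^sup>+u. m u \<partial>r')" "(\<integral>\<^sup>+u. m u * h u \<partial>r) = (\<integral>\<^sup>+u. m u * h u \<partial>r')"
    using eq by auto
  have a_f: "a + (\<integral>\<^sup>+u. m u \<partial>r) = 1"
    unfolding a_def f1[symmetric]
    by (subst nn_integral_add[symmetric]) (auto intro!: nn_integral_cong diff_add_cancel_ennreal mf)
  have "(\<integral>\<^sup>+u. (g u - m u) \<partial>r') + (\<integral>\<^sup>+u. m u \<partial>r') = 1"
    unfolding g1[symmetric]
    by (subst nn_integral_add[symmetric]) (auto intro!: nn_integral_cong diff_add_cancel_ennreal mg)
  then have a_g: "(\<integral>\<^sup>+u. (g u - m u) \<partial>r') = a"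
    using a_f m_fin unfolding mm(1) by (metis ennreal_add_diff_cancel_right infinity_ennreal_def less_top)
  have a_le: "a < \<infinity>"
    using a_f by (metis ennreal_add_eq_top ennreal_one_neq_top infinity_ennreal_def less_top)
  have cancel: "c * (a / a) = c" if "a = 0 \<Longrightarrow> c = 0" for c
    using that a_le by (cases "a = 0") (auto simp: ennreal_divide_self)
  have zf: "(\<integral>\<^sup>+v. (f v - m v) * k v \<partial>r) = 0" if "a = 0" and [measurable]: "k \<in> borel_measurable r" for k
  proof -
    have "AE v in r. f v - m v = 0"
      using that(1) unfolding a_def by (subst (asm) nn_integral_0_iff_AE) auto
    then have "AE v in r. (f v - m v) * k v = 0"
      by eventually_elim simp
    then show ?thesis
      by (subst nn_integral_0_iff_AE) auto
  qed
  have zg: "(\<integral>\<^sup>+v. (g v - m v) * k v \<partial>r') = 0" if "a = 0" and [measurable]: "k \<in> borel_measurable r'" for k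
  proof -
    have "AE v in r'. g v - m v = 0"
      using that(1) unfolding a_g[symmetric] by (subst (asm) nn_integral_0_iff_AE) auto
    then have "AE v in r'. (g v - m v) * k v = 0"
      by eventually_elim simp
    then show ?thesis
      by (subst nn_integral_0_iff_AE) auto
  qed
  have "(\<integral>\<^sup>+z. h (fst z) \<partial>partial_diagonal_coupling r r' f g m) =
      (\<integral>\<^sup>+v. m v * h v \<partial>r) + (\<integral>\<^sup>+v. (\<integral>\<^sup>+v'. (f v - m v) * (g v' - m v') / a * h v \<partial>r') \<partial>r)"
    unfolding a_def by (subst nn_integral_partial_diagonal_coupling) auto
  also have "(\<integral>\<^sup>+v. (\<integral>\<^sup>+v'. (f v - m v) * (g v' - m v') / a * h v \<partial>r') \<partial>r) =
      (\<integral>\<^sup>+v. (f v - m v) * h v * (a / a) \<partial>r)"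
  proof (intro nn_integral_cong)
    fix v
    have "(\<integral>\<^sup>+v'. (f v - m v) * (g v' - m v') / a * h v \<partial>r') = (\<integral>\<^sup>+v'. (f v - m v) * h v / a * (g v' - m v') \<partial>r')"
      by (intro nn_integral_cong) (simp add: divide_ennreal_def mult_ac)
    also have "\<dots> = (f v - m v) * h v / a * a"
      by (subst nn_integral_cmult) (auto simp: a_g)
    finally show "(\<integral>\<^sup>+v'. (f v - m v) * (g v' - m v') / a * h v \<partial>r') = (f v - m v) * h v * (a / a)"
      by (simp add: divide_ennreal_def mult_ac)
  qed
  also have "\<dots> = (\<integral>\<^sup>+v. (f v - m v) * h v \<partial>r)"
    using zf[OF _ h] by (simp add: nn_integral_multc cancel)
  also have "(\<integral>\<^sup>+v. m v * h v \<partial>r) + \<dots> = (\<integral>\<^sup>+v. f v * h v \<partial>r)"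
    by (subst nn_integral_add[symmetric])
      (auto intro!: nn_integral_cong simp: distrib_right[symmetric] add_diff_inverse_ennreal mf)
  finally show "(\<integral>\<^sup>+z. h (fst z) \<partial>partial_diagonal_coupling r r' f g m) = (\<integral>\<^sup>+v. f v * h v \<partial>r)" .

  have [measurable]: "h \<in> borel_measurable r'"
    by measurable
  have "(\<integral>\<^sup>+z. h (snd z) \<partial>partial_diagonal_coupling r r' f g m) =
      (\<integral>\<^sup>+v. m v * h v \<partial>r') + (\<integral>\<^sup>+v. (\<integral>\<^sup>+v'. (f v - m v) * (g v' - m v') / a * h v' \<partial>r') \<partial>r)"
    unfolding a_def mm(2)[symmetric] by (subst nn_integral_partial_diagonal_coupling) auto
  also have "(\<integral>\<^sup>+v. (\<integral>\<^sup>+v'. (f v - m v) * (g v' - m v') / a * h v' \<partial>r') \<partial>r) =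
      (\<integral>\<^sup>+v. (f v - m v) * ((\<integral>\<^sup>+v'. (g v' - m v') * h v' \<partial>r') / a) \<partial>r)"
  proof (intro nn_integral_cong)
    fix v
    have "(\<integral>\<^sup>+v'. (f v - m v) * (g v' - m v') / a * h v' \<partial>r') = (\<integral>\<^sup>+v'. (f v - m v) / a * ((g v' - m v') * h v') \<partial>r')"
      by (intro nn_integral_cong) (simp add: divide_ennreal_def mult_ac)
    also have "\<dots> = (f v - m v) / a * (\<integral>\<^sup>+v'. (g v' - m v') * h v' \<partial>r')"
      by (subst nn_integral_cmult) auto
    finally show "(\<integral>\<^sup>+v'. (f v - m v) * (g v' - m v') / a * h v' \<partial>r') =
        (f v - m v) * ((\<integral>\<^sup>+v'. (g v' - m v') * h v' \<partial>r') / a)"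
      by (simp add: divide_ennreal_def mult_ac)
  qed
  also have "\<dots> = (\<integral>\<^sup>+v'. (g v' - m v') * h v' \<partial>r') * (a / a)"
    by (subst nn_integral_multc) (auto simp: a_def[symmetric] divide_ennreal_def mult_ac)
  also have "\<dots> = (\<integral>\<^sup>+v'. (g v' - m v') * h v' \<partial>r')"
    using zg[of h] by (intro cancel) simp
  also have "(\<integral>\<^sup>+v. m v * h v \<partial>r') + \<dots> = (\<integral>\<^sup>+v. g v * h v \<partial>r')"
    by (subst nn_integral_add[symmetric])
      (auto intro!: nn_integral_cong simp: distrib_right[symmetric] add_diff_inverse_ennreal mg)
  finally show "(\<integral>\<^sup>+z. h (snd z) \<partial>partial_diagonal_coupling r r' f g m) = (\<integral>\<^sup>+v. g v * h v \<partial>r')" .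
qed

lemma partial_diagonal_coupling_in_couplings:
  assumes f1: "(\<integral>\<^sup>+v. f v \<partial>r) = 1" and g1: "(\<integral>\<^sup>+v. g v \<partial>r') = 1"
    and mf: "\<And>v. m v \<le> f v" and mg: "\<And>v. m v \<le> g v"
    and eq: "r = r' \<or> (\<forall>v. m v = 0)"
  shows "partial_diagonal_coupling r r' f g m \<in> couplings (density r f) (density r' g)"
proof -
  let ?K = "partial_diagonal_coupling r r' f g m"
  note marg = partial_diagonal_coupling_marginals[OF assms]
  show ?thesis
  proof (rule couplingsI)
    have "emeasure ?K (space ?K) = 1"
      using marg(1)[of "\<lambda>_. 1"] f1 by simp
    then show "prob_space ?K"
      by (rule prob_spaceI)
    show "sets ?K = sets (density r f \<Otimes>\<^sub>M density r' g)"
      by (simp cong: sets_pair_measure_cong)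
    show "(\<integral>\<^sup>+z. h (fst z) \<partial>?K) = (\<integral>\<^sup>+v. h v \<partial>density r f)" if "h \<in> borel_measurable (density r f)" for h
      using that marg(1) by (simp add: nn_integral_density)
    show "(\<integral>\<^sup>+z. h (snd z) \<partial>?K) = (\<integral>\<^sup>+v. h v \<partial>density r' g)" if "h \<in> borel_measurable (density r' g)" for h
    proof -
      have [measurable]: "h \<in> borel_measurable r"
        using that by (simp add: measurable_cong_sets[OF sets_eq refl])
      show ?thesis
        by (simp add: marg(2) nn_integral_density)
    qed
  qed
qed

end

text \<open>The mass of a fixed set is a sum of iterated integrals against the kernels, hence measurable in
  the parameter.\<close>

lemma measurable_partial_diagonal_coupling:
  assumes r [measurable]: "r \<in> N \<rightarrow>\<^sub>M prob_algebra L" and r' [measurable]: "r' \<in> N \<rightarrow>\<^sub>M prob_algebra L"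
    and f [measurable]: "f \<in> borel_measurable (N \<Otimes>\<^sub>M L)" and g [measurable]: "g \<in> borel_measurable (N \<Otimes>\<^sub>M L)"
    and m [measurable]: "m \<in> borel_measurable (N \<Otimes>\<^sub>M L)"
    and prob: "\<And>z. z \<in> space N \<Longrightarrow> prob_space (partial_diagonal_coupling (r z) (r' z)
        (\<lambda>v. f (z, v)) (\<lambda>v. g (z, v)) (\<lambda>v. m (z, v)))"
  shows "(\<lambda>z. partial_diagonal_coupling (r z) (r' z) (\<lambda>v. f (z, v)) (\<lambda>v. g (z, v)) (\<lambda>v. m (z, v)))
    \<in> N \<rightarrow>\<^sub>M prob_algebra (L \<Otimes>\<^sub>M L)" (is "?K \<in> _")
proof -
  have rs [measurable]: "r \<in> N \<rightarrow>\<^sub>M subprob_algebra L" "r' \<in> N \<rightarrow>\<^sub>M subprob_algebra L"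
    using r r' by (auto intro: measurable_prob_algebraD)
  have sets_r: "sets (r z) = sets L" "sets (r' z) = sets L" "prob_space (r z)" "prob_space (r' z)" if "z \<in> space N" for z
    using measurable_space[OF r that] measurable_space[OF r' that] by (simp_all add: space_prob_algebra)
  have sets_K: "sets (?K z) = sets (L \<Otimes>\<^sub>M L)" if "z \<in> space N" for z
    using sets_r[OF that] by (simp cong: sets_pair_measure_cong)
  show ?thesis
  proof (rule measurable_prob_algebraI[OF prob], assumption, rule measurable_subprob_algebra)
    show "subprob_space (?K z)" if "z \<in> space N" for z
      using prob[OF that] by (rule prob_space_imp_subprob_space)
    show "sets (?K z) = sets (L \<Otimes>\<^sub>M L)" if "z \<in> space N" for z
      by (rule sets_K[OF that])
    fix A assume [measurable]: "A \<in> sets (L \<Otimes>\<^sub>M L)"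
    define a where "a z = (\<integral>\<^sup>+u. (f (z, u) - m (z, u)) \<partial>r z)" for z
    have [measurable]: "a \<in> borel_measurable N"
      unfolding a_def by (rule nn_integral_measurable_subprob_algebra2[where N=L]) auto
    have "emeasure (?K z) A = (\<integral>\<^sup>+v. m (z, v) * indicator A (v, v) \<partial>r z) +
       (\<integral>\<^sup>+v. (\<integral>\<^sup>+v'. (f (z, v) - m (z, v)) * (g (z, v') - m (z, v')) / a z * indicator A (v, v') \<partial>r' z) \<partial>r z)"
      if z: "z \<in> space N" for z
    proof -
      have [measurable]: "(\<lambda>x. x) \<in> r z \<rightarrow>\<^sub>M L"
        by (rule measurable_ident_sets[OF sets_r(1)[OF z]])
      have [measurable]: "A \<in> sets (r z \<Otimes>\<^sub>M r z)"
        using sets_pair_measure_cong[OF sets_r(1)[OF z] sets_r(1)[OF z]] by simp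
      have "emeasure (?K z) A = (\<integral>\<^sup>+y. indicator A y \<partial>?K z)"
        by (rule nn_integral_indicator[symmetric]) (simp add: sets_K z del: sets_partial_diagonal_coupling)
      also have "\<dots> = (\<integral>\<^sup>+v. m (z, v) * indicator A (v, v) \<partial>r z) +
       (\<integral>\<^sup>+v. (\<integral>\<^sup>+v'. (f (z, v) - m (z, v)) * (g (z, v') - m (z, v')) / a z * indicator A (v, v') \<partial>r' z) \<partial>r z)"
        unfolding a_def
      proof (rule nn_integral_partial_diagonal_coupling[OF sets_r(3)[OF z] sets_r(4)[OF z]])
        show "sets (r' z) = sets (r z)"
          using z by (simp add: sets_r)
      qed (use z in measurable)
      finally show ?thesis .
    qed
    moreover have "(\<lambda>z. (\<integral>\<^sup>+v. m (z, v) * indicator A (v, v) \<partial>r z) +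
       (\<integral>\<^sup>+v. (\<integral>\<^sup>+v'. (f (z, v) - m (z, v)) * (g (z, v') - m (z, v')) / a z * indicator A (v, v') \<partial>r' z) \<partial>r z))
       \<in> borel_measurable N"
    proof (rule borel_measurable_add)
      show "(\<lambda>z. \<integral>\<^sup>+v. m (z, v) * indicator A (v, v) \<partial>r z) \<in> borel_measurable N"
        by (rule nn_integral_measurable_subprob_algebra2[where N=L]) auto
      show "(\<lambda>z. \<integral>\<^sup>+v. (\<integral>\<^sup>+v'. (f (z, v) - m (z, v)) * (g (z, v') - m (z, v')) / a z * indicator A (v, v') \<partial>r' z) \<partial>r z)
        \<in> borel_measurable N"
      proof (rule nn_integral_measurable_subprob_algebra2[where N=L])
        show "(\<lambda>(z, v). \<integral>\<^sup>+v'. (f (z, v) - m (z, v)) * (g (z, v') - m (z, v')) / a z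
              * indicator A (v, v') \<partial>r' z) \<in> borel_measurable (N \<Otimes>\<^sub>M L)"
          unfolding case_prod_beta'
          by (rule nn_integral_measurable_subprob_algebra2[where N=L]) auto
      qed simp
    qed
    ultimately show "(\<lambda>z. emeasure (?K z) A) \<in> borel_measurable N"
      by (simp cong: measurable_cong)
  qed
qed

section \<open>Paths and histories\<close>

lemma in_space_path_space: "x \<in> space (path_space t) \<longleftrightarrow> x \<in> extensional {1..t}"
  by (simp add: path_space_def space_PiM PiE_def)

lemma measurable_history: "t \<le> T \<Longrightarrow> history t \<in> path_space T \<rightarrow>\<^sub>M path_space t"
  unfolding path_space_def by (rule measurable_restrict_subset) auto

lemma measurable_path_coordinate: "t \<in> {1..T} \<Longrightarrow> (\<lambda>x. x t) \<in> path_space T \<rightarrow>\<^sub>M borel"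
  unfolding path_space_def by (rule measurable_component_singleton)

lemma measurable_path_extend:
  assumes [measurable]: "X \<in> M \<rightarrow>\<^sub>M path_space t" "V \<in> M \<rightarrow>\<^sub>M borel"
  shows "(\<lambda>\<omega>. (X \<omega>)(Suc t := V \<omega>)) \<in> M \<rightarrow>\<^sub>M path_space (Suc t)"
proof -
  have *: "{1..Suc t} = insert (Suc t) {1..t}"
    by auto
  have "(\<lambda>(x, v). x(Suc t := v)) \<in> path_space t \<Otimes>\<^sub>M borel \<rightarrow>\<^sub>M path_space (Suc t)"
    unfolding path_space_def * by (rule measurable_add_dim)
  from measurable_compose[OF _ this, of "\<lambda>\<omega>. (X \<omega>, V \<omega>)" M] show ?thesis
    by simp
qed

lemma history_extend: "x \<in> space (path_space t) \<Longrightarrow> history t (x(Suc t := v)) = x"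
  by (auto simp: in_space_path_space fun_eq_iff extensional_def)

lemma history_history: "s \<le> t \<Longrightarrow> history s (history t x) = history s x"
  by (auto simp: fun_eq_iff)

lemma history_full: "x \<in> space (path_space t) \<Longrightarrow> history t x = x"
  by (auto simp: in_space_path_space fun_eq_iff extensional_def)

lemma space_path_space_0: "space (path_space 0) = {\<lambda>_. undefined}"
  by (auto simp: in_space_path_space fun_eq_iff extensional_def)

text \<open>The product \<open>\<sigma>\<close>-algebra sees the diagonal, because extensional paths are compared at finitely
  many times.\<close>

lemma measurable_path_eq [measurable]:
  "Measurable.pred (path_space t \<Otimes>\<^sub>M path_space t) (\<lambda>z. fst z = snd z)"
proof -
  have *: "Measurable.pred (path_space t \<Otimes>\<^sub>M path_space t) (\<lambda>z. \<forall>i\<in>{1..t}. fst z i = snd z i)"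
  proof (rule pred_intros_finite(3))
    fix i assume "i \<in> {1..t}"
    then have [measurable]: "(\<lambda>x. x i) \<in> path_space t \<rightarrow>\<^sub>M borel"
      by (rule measurable_path_coordinate)
    show "Measurable.pred (path_space t \<Otimes>\<^sub>M path_space t) (\<lambda>z. fst z i = snd z i)"
      by measurable
  qed simp
  have "fst z = snd z \<longleftrightarrow> (\<forall>i\<in>{1..t}. fst z i = snd z i)"
    if "z \<in> space (path_space t \<Otimes>\<^sub>M path_space t)" for z
    using that by (auto simp: space_pair_measure in_space_path_space intro: extensionalityI)
  from measurable_cong[THEN iffD2, OF this *] show ?thesis .
qed

section \<open>The greedy bicausal coupling\<close>

lemma couplings_push_forward:
  assumes \<pi>: "\<pi> \<in> couplings \<mu> \<nu>" and [measurable]: "\<phi> \<in> \<mu> \<rightarrow>\<^sub>M N" "\<psi> \<in> \<nu> \<rightarrow>\<^sub>M L"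
  shows "distr \<pi> (N \<Otimes>\<^sub>M L) (\<lambda>(x, y). (\<phi> x, \<psi> y)) \<in> couplings (distr \<mu> N \<phi>) (distr \<nu> L \<psi>)"
proof -
  have prob: "prob_space \<pi>" and sets [measurable_cong]: "sets \<pi> = sets (\<mu> \<Otimes>\<^sub>M \<nu>)"
    using \<pi> by (auto simp: couplings_def)
  let ?p = "\<lambda>(x, y). (\<phi> x, \<psi> y)"
  have p [measurable]: "?p \<in> \<pi> \<rightarrow>\<^sub>M N \<Otimes>\<^sub>M L"
    unfolding case_prod_beta' by measurable
  show ?thesis
  proof (rule couplingsI)
    show "prob_space (distr \<pi> (N \<Otimes>\<^sub>M L) ?p)"
      by (rule prob_space.prob_space_distr[OF prob p])
    show "sets (distr \<pi> (N \<Otimes>\<^sub>M L) ?p) = sets (distr \<mu> N \<phi> \<Otimes>\<^sub>M distr \<nu> L \<psi>)"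
      by (simp cong: sets_pair_measure_cong)
    show "(\<integral>\<^sup>+z. h (fst z) \<partial>distr \<pi> (N \<Otimes>\<^sub>M L) ?p) = (\<integral>\<^sup>+x. h x \<partial>distr \<mu> N \<phi>)"
      if "h \<in> borel_measurable (distr \<mu> N \<phi>)" for h
      using that couplings_nn_integral(1)[OF \<pi>, of "\<lambda>x. h (\<phi> x)"]
      by (simp add: nn_integral_distr case_prod_beta')
    show "(\<integral>\<^sup>+z. h (snd z) \<partial>distr \<pi> (N \<Otimes>\<^sub>M L) ?p) = (\<integral>\<^sup>+y. h y \<partial>distr \<nu> L \<psi>)"
      if "h \<in> borel_measurable (distr \<nu> L \<psi>)" for h
      using that couplings_nn_integral(2)[OF \<pi>, of "\<lambda>y. h (\<psi> y)"]
      by (simp add: nn_integral_distr case_prod_beta')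
  qed
qed

text \<open>Here \<open>R t\<close> is the law of the history up to time \<open>t\<close> under a reference law that dominates both
  path laws, and \<open>r t\<close> is the conditional law of the next step. The path laws enter through the densities
  \<open>F t, G t\<close> of their histories and the conditional densities \<open>f t, g t\<close> of their steps. Time starts at 0, where the
  history space has one point, so that the first step is a transition like the others.\<close>

locale density_disintegration =
  fixes T :: nat
    and R :: "nat \<Rightarrow> ('d::finite) path measure"
    and r :: "nat \<Rightarrow> 'd path \<Rightarrow> (real ^ 'd) measure"
    and F G :: "nat \<Rightarrow> 'd path \<Rightarrow> ennreal"
    and f g :: "nat \<Rightarrow> 'd path \<times> (real ^ 'd) \<Rightarrow> ennreal"
  assumes prob_R: "t \<le> T \<Longrightarrow> prob_space (R t)"
    and sets_R: "t \<le> T \<Longrightarrow> sets (R t) = sets (path_space t)"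
    and r: "t < T \<Longrightarrow> r t \<in> path_space t \<rightarrow>\<^sub>M prob_algebra borel"
    and R_Suc: "t < T \<Longrightarrow> h \<in> borel_measurable (path_space (Suc t)) \<Longrightarrow>
      (\<integral>\<^sup>+x. h x \<partial>R (Suc t)) = (\<integral>\<^sup>+x. (\<integral>\<^sup>+v. h (x(Suc t := v)) \<partial>r t x) \<partial>R t)"
    and F: "t \<le> T \<Longrightarrow> F t \<in> borel_measurable (path_space t)"
    and G: "t \<le> T \<Longrightarrow> G t \<in> borel_measurable (path_space t)"
    and F_finite: "t \<le> T \<Longrightarrow> x \<in> space (path_space t) \<Longrightarrow> F t x < \<infinity>"
    and G_finite: "t \<le> T \<Longrightarrow> x \<in> space (path_space t) \<Longrightarrow> G t x < \<infinity>"
    and F_0: "(\<integral>\<^sup>+x. F 0 x \<partial>R 0) = 1"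
    and G_0: "(\<integral>\<^sup>+x. G 0 x \<partial>R 0) = 1"
    and f: "t < T \<Longrightarrow> f t \<in> borel_measurable (path_space t \<Otimes>\<^sub>M borel)"
    and g: "t < T \<Longrightarrow> g t \<in> borel_measurable (path_space t \<Otimes>\<^sub>M borel)"
    and f_1: "t < T \<Longrightarrow> x \<in> space (path_space t) \<Longrightarrow> (\<integral>\<^sup>+v. f t (x, v) \<partial>r t x) = 1"
    and g_1: "t < T \<Longrightarrow> x \<in> space (path_space t) \<Longrightarrow> (\<integral>\<^sup>+v. g t (x, v) \<partial>r t x) = 1"
    and F_Suc: "t < T \<Longrightarrow> AE x in R t. AE v in r t x. F (Suc t) (x(Suc t := v)) = F t x * f t (x, v)"
    and G_Suc: "t < T \<Longrightarrow> AE x in R t. AE v in r t x. G (Suc t) (x(Suc t := v)) = G t x * g t (x, v)"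
begin

text \<open>Once the pasts differ the overlap is 0, which makes the next steps conditionally independent.\<close>

definition step_overlap :: "nat \<Rightarrow> ('d path \<times> 'd path) \<times> (real ^ 'd) \<Rightarrow> ennreal" where
  "step_overlap t = (\<lambda>(z, v). if fst z = snd z then min (f t (fst z, v)) (g t (fst z, v)) else 0)"

definition step_coupling :: "nat \<Rightarrow> 'd path \<times> 'd path \<Rightarrow> ((real ^ 'd) \<times> (real ^ 'd)) measure" where
  "step_coupling t z = partial_diagonal_coupling (r t (fst z)) (r t (snd z))
     (\<lambda>v. f t (fst z, v)) (\<lambda>v. g t (snd z, v)) (\<lambda>v. step_overlap t (z, v))"

definition extend_pair :: "nat \<Rightarrow> 'd path \<times> 'd path \<Rightarrow> (real ^ 'd) \<times> (real ^ 'd) \<Rightarrow> 'd path \<times> 'd path" where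
  "extend_pair t z u = ((fst z)(Suc t := fst u), (snd z)(Suc t := snd u))"

abbreviation pair_space :: "nat \<Rightarrow> ('d path \<times> 'd path) measure" where
  "pair_space t \<equiv> path_space t \<Otimes>\<^sub>M path_space t"

primrec greedy_coupling :: "nat \<Rightarrow> ('d path \<times> 'd path) measure" where
  "greedy_coupling 0 = return (pair_space 0) (\<lambda>_. undefined, \<lambda>_. undefined)"
| "greedy_coupling (Suc t) =
     greedy_coupling t \<bind> (\<lambda>z. distr (step_coupling t z) (pair_space (Suc t)) (extend_pair t z))"

lemma r_space:
  assumes "t < T" "x \<in> space (path_space t)"
  shows "prob_space (r t x)" "sets (r t x) = sets borel" "space (r t x) = UNIV"
proof -
  show "prob_space (r t x)" and *: "sets (r t x) = sets borel"
    using measurable_space[OF r[OF assms(1)] assms(2)] by (simp_all add: space_prob_algebra)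
  show "space (r t x) = UNIV"
    using sets_eq_imp_space_eq[OF *] by simp
qed

lemma measurable_r_section:
  assumes "t < T" "x \<in> space (path_space t)" "h \<in> path_space t \<Otimes>\<^sub>M borel \<rightarrow>\<^sub>M M"
  shows "(\<lambda>v. h (x, v)) \<in> r t x \<rightarrow>\<^sub>M M"
  using assms(2,3) by (simp add: measurable_cong_sets[OF r_space(2)[OF assms(1,2)] refl])

lemma measurable_step_overlap [measurable]:
  assumes t: "t < T"
  shows "step_overlap t \<in> borel_measurable (pair_space t \<Otimes>\<^sub>M borel)"
proof -
  note [measurable] = f[OF t] g[OF t]
  show ?thesis
    unfolding step_overlap_def case_prod_beta' by measurable
qed

lemma step_coupling_prems:
  assumes t: "t < T" and z: "z \<in> space (pair_space t)"
  shows "prob_space (r t (fst z))" "prob_space (r t (snd z))" "sets (r t (snd z)) = sets (r t (fst z))"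
    "(\<lambda>v. f t (fst z, v)) \<in> borel_measurable (r t (fst z))"
    "(\<lambda>v. g t (snd z, v)) \<in> borel_measurable (r t (fst z))"
    "(\<lambda>v. step_overlap t (z, v)) \<in> borel_measurable (r t (fst z))"
    "(\<integral>\<^sup>+v. f t (fst z, v) \<partial>r t (fst z)) = 1" "(\<integral>\<^sup>+v. g t (snd z, v) \<partial>r t (snd z)) = 1"
    "step_overlap t (z, v) \<le> f t (fst z, v)" "step_overlap t (z, v) \<le> g t (snd z, v)"
    "r t (fst z) = r t (snd z) \<or> (\<forall>v. step_overlap t (z, v) = 0)"
proof -
  have x: "fst z \<in> space (path_space t)" "snd z \<in> space (path_space t)"
    using z by (auto simp: space_pair_measure)
  note sets = r_space(2)[OF t x(1)] r_space(2)[OF t x(2)]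
  note [measurable] = f[OF t] g[OF t] measurable_step_overlap[OF t]
  show "prob_space (r t (fst z))" "prob_space (r t (snd z))" "sets (r t (snd z)) = sets (r t (fst z))"
    using r_space[OF t] x by simp_all
  show "(\<lambda>v. f t (fst z, v)) \<in> borel_measurable (r t (fst z))"
    "(\<lambda>v. g t (snd z, v)) \<in> borel_measurable (r t (fst z))"
    "(\<lambda>v. step_overlap t (z, v)) \<in> borel_measurable (r t (fst z))"
    using x z by (simp_all add: measurable_cong_sets[OF sets(1) refl])
  show "(\<integral>\<^sup>+v. f t (fst z, v) \<partial>r t (fst z)) = 1" "(\<integral>\<^sup>+v. g t (snd z, v) \<partial>r t (snd z)) = 1"
    using f_1[OF t x(1)] g_1[OF t x(2)] by simp_all
  show "step_overlap t (z, v) \<le> f t (fst z, v)" "step_overlap t (z, v) \<le> g t (snd z, v)"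
    "r t (fst z) = r t (snd z) \<or> (\<forall>v. step_overlap t (z, v) = 0)"
    by (auto simp: step_overlap_def)
qed

lemma step_coupling_in_couplings:
  assumes "t < T" "z \<in> space (pair_space t)"
  shows "step_coupling t z \<in>
    couplings (density (r t (fst z)) (\<lambda>v. f t (fst z, v))) (density (r t (snd z)) (\<lambda>v. g t (snd z, v)))"
  unfolding step_coupling_def
  by (rule partial_diagonal_coupling_in_couplings; rule step_coupling_prems[OF assms])

lemma measurable_step_coupling:
  assumes t: "t < T"
  shows "step_coupling t \<in> pair_space t \<rightarrow>\<^sub>M prob_algebra (borel \<Otimes>\<^sub>M borel)"
proof -
  note [measurable] = f[OF t] g[OF t] r[OF t] measurable_step_overlap[OF t]
  have "(\<lambda>z. partial_diagonal_coupling (r t (fst z)) (r t (snd z))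
      (\<lambda>v. (\<lambda>(z, v). f t (fst z, v)) (z, v)) (\<lambda>v. (\<lambda>(z, v). g t (snd z, v)) (z, v)) (\<lambda>v. step_overlap t (z, v)))
      \<in> pair_space t \<rightarrow>\<^sub>M prob_algebra (borel \<Otimes>\<^sub>M borel)"
  proof (rule measurable_partial_diagonal_coupling)
    fix z assume "z \<in> space (pair_space t)"
    from step_coupling_in_couplings[OF t this]
    show "prob_space (partial_diagonal_coupling (r t (fst z)) (r t (snd z))
      (\<lambda>v. (\<lambda>(z, v). f t (fst z, v)) (z, v)) (\<lambda>v. (\<lambda>(z, v). g t (snd z, v)) (z, v)) (\<lambda>v. step_overlap t (z, v)))"
      by (simp add: couplings_def step_coupling_def)
  qed measurable
  then show ?thesis
    by (simp add: step_coupling_def[abs_def])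
qed

lemma measurable_extend_pair:
  "(\<lambda>(z, u). extend_pair t z u) \<in> pair_space t \<Otimes>\<^sub>M (borel \<Otimes>\<^sub>M borel) \<rightarrow>\<^sub>M pair_space (Suc t)"
  unfolding extend_pair_def case_prod_beta'
  by (intro measurable_Pair measurable_path_extend) measurable

lemma measurable_transition:
  assumes t: "t < T"
  shows "(\<lambda>z. distr (step_coupling t z) (pair_space (Suc t)) (extend_pair t z))
    \<in> pair_space t \<rightarrow>\<^sub>M prob_algebra (pair_space (Suc t))"
  by (rule measurable_distr_prob_space2[OF measurable_step_coupling[OF t] measurable_extend_pair])

lemma greedy_coupling_prob_algebra: "t \<le> T \<Longrightarrow> greedy_coupling t \<in> space (prob_algebra (pair_space t))"
proof (induction t)
  case 0
  show ?case
    by (auto simp: space_prob_algebra space_pair_measure space_path_space_0 intro!: prob_space_return)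
next
  case (Suc t)
  then have "t < T" "greedy_coupling t \<in> space (prob_algebra (pair_space t))"
    by auto
  then show ?case
    using prob_space_bind'[OF _ measurable_transition] sets_bind'[OF _ measurable_transition]
    by (simp add: space_prob_algebra)
qed

lemma
  assumes "t \<le> T"
  shows prob_space_greedy_coupling: "prob_space (greedy_coupling t)"
    and sets_greedy_coupling: "sets (greedy_coupling t) = sets (pair_space t)"
    and space_greedy_coupling: "space (greedy_coupling t) = space (pair_space t)"
  using greedy_coupling_prob_algebra[OF assms] sets_eq_imp_space_eq
  by (auto simp: space_prob_algebra)

lemma nn_integral_greedy_coupling_Suc:
  assumes t: "t < T" and h: "h \<in> borel_measurable (pair_space (Suc t))"
  shows "(\<integral>\<^sup>+z. h z \<partial>greedy_coupling (Suc t)) =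
    (\<integral>\<^sup>+z. (\<integral>\<^sup>+u. h (extend_pair t z u) \<partial>step_coupling t z) \<partial>greedy_coupling t)"
proof -
  have "(\<integral>\<^sup>+z. h z \<partial>greedy_coupling (Suc t)) =
    (\<integral>\<^sup>+z. (\<integral>\<^sup>+y. h y \<partial>distr (step_coupling t z) (pair_space (Suc t)) (extend_pair t z)) \<partial>greedy_coupling t)"
    unfolding greedy_coupling.simps
  proof (rule nn_integral_bind[OF h])
    show "(\<lambda>z. distr (step_coupling t z) (pair_space (Suc t)) (extend_pair t z))
      \<in> greedy_coupling t \<rightarrow>\<^sub>M subprob_algebra (pair_space (Suc t))"
      using measurable_prob_algebraD[OF measurable_transition[OF t]] t
      by (simp add: measurable_cong_sets[OF sets_greedy_coupling refl])
  qed
  also have "\<dots> = (\<integral>\<^sup>+z. (\<integral>\<^sup>+u. h (extend_pair t z u) \<partial>step_coupling t z) \<partial>greedy_coupling t)"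
  proof (intro nn_integral_cong)
    fix z assume "z \<in> space (greedy_coupling t)"
    then have z: "z \<in> space (pair_space t)"
      using t by (simp add: space_greedy_coupling)
    have sets: "sets (step_coupling t z) = sets (borel \<Otimes>\<^sub>M borel)"
      using measurable_space[OF measurable_step_coupling[OF t] z] by (simp add: space_prob_algebra)
    have "extend_pair t z \<in> step_coupling t z \<rightarrow>\<^sub>M pair_space (Suc t)"
      using measurable_compose[OF measurable_Pair1'[OF z] measurable_extend_pair]
      by (simp add: measurable_cong_sets[OF sets refl])
    then show "(\<integral>\<^sup>+y. h y \<partial>distr (step_coupling t z) (pair_space (Suc t)) (extend_pair t z))
        = (\<integral>\<^sup>+u. h (extend_pair t z u) \<partial>step_coupling t z)"
      using h by (subst nn_integral_distr) simp_all
  qed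
  finally show ?thesis .
qed

lemma step_coupling_marginals:
  assumes t: "t < T" and z: "z \<in> space (pair_space t)" and h: "h \<in> borel_measurable borel"
  shows "(\<integral>\<^sup>+u. h (fst u) \<partial>step_coupling t z) = (\<integral>\<^sup>+v. f t (fst z, v) * h v \<partial>r t (fst z))"
    and "(\<integral>\<^sup>+u. h (snd u) \<partial>step_coupling t z) = (\<integral>\<^sup>+v. g t (snd z, v) * h v \<partial>r t (snd z))"
proof -
  have "fst z \<in> space (path_space t)"
    using z by (auto simp: space_pair_measure)
  then have "h \<in> borel_measurable (r t (fst z))"
    using h by (simp add: measurable_cong_sets[OF r_space(2)[OF t] refl])
  from partial_diagonal_coupling_marginals[OF step_coupling_prems[OF t z] this]
  show "(\<integral>\<^sup>+u. h (fst u) \<partial>step_coupling t z) = (\<integral>\<^sup>+v. f t (fst z, v) * h v \<partial>r t (fst z))"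
    and "(\<integral>\<^sup>+u. h (snd u) \<partial>step_coupling t z) = (\<integral>\<^sup>+v. g t (snd z, v) * h v \<partial>r t (snd z))"
    by (simp_all add: step_coupling_def)
qed

lemma borel_measurable_r_integral:
  assumes t: "t < T" and h: "h \<in> borel_measurable (path_space t \<Otimes>\<^sub>M borel)"
  shows "(\<lambda>x. \<integral>\<^sup>+v. h (x, v) \<partial>r t x) \<in> borel_measurable (path_space t)"
  by (rule nn_integral_measurable_subprob_algebra2[where N=borel])
    (use h measurable_prob_algebraD[OF r[OF t]] in auto)

lemma measurable_extend:
  assumes "h \<in> path_space (Suc t) \<rightarrow>\<^sub>M M"
  shows "(\<lambda>z. h ((fst z)(Suc t := snd z))) \<in> path_space t \<Otimes>\<^sub>M borel \<rightarrow>\<^sub>M M"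
  by (rule measurable_compose[OF measurable_path_extend assms]) measurable

lemma nn_integral_density_Suc:
  assumes t: "t < T" and h: "h \<in> borel_measurable (path_space (Suc t))"
  shows "(\<integral>\<^sup>+x. F (Suc t) x * h x \<partial>R (Suc t)) =
      (\<integral>\<^sup>+x. F t x * (\<integral>\<^sup>+v. f t (x, v) * h (x(Suc t := v)) \<partial>r t x) \<partial>R t)"
    and "(\<integral>\<^sup>+x. G (Suc t) x * h x \<partial>R (Suc t)) =
      (\<integral>\<^sup>+x. G t x * (\<integral>\<^sup>+v. g t (x, v) * h (x(Suc t := v)) \<partial>r t x) \<partial>R t)"
proof -
  have *: "(\<integral>\<^sup>+x. F' (Suc t) x * h x \<partial>R (Suc t)) =
      (\<integral>\<^sup>+x. F' t x * (\<integral>\<^sup>+v. f' t (x, v) * h (x(Suc t := v)) \<partial>r t x) \<partial>R t)"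
    if F'[measurable]: "F' (Suc t) \<in> borel_measurable (path_space (Suc t))"
      and f'[measurable]: "f' t \<in> borel_measurable (path_space t \<Otimes>\<^sub>M borel)"
      and eq: "AE x in R t. AE v in r t x. F' (Suc t) (x(Suc t := v)) = F' t x * f' t (x, v)" for F' f'
  proof -
    note h[measurable] and measurable_extend[OF h, measurable]
    have prod: "(\<lambda>z. f' t z * h ((fst z)(Suc t := snd z))) \<in> borel_measurable (path_space t \<Otimes>\<^sub>M borel)"
      by measurable
    have "(\<integral>\<^sup>+x. F' (Suc t) x * h x \<partial>R (Suc t)) =
        (\<integral>\<^sup>+x. (\<integral>\<^sup>+v. F' (Suc t) (x(Suc t := v)) * h (x(Suc t := v)) \<partial>r t x) \<partial>R t)"
      by (rule R_Suc[OF t]) measurable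
    also have "\<dots> = (\<integral>\<^sup>+x. F' t x * (\<integral>\<^sup>+v. f' t (x, v) * h (x(Suc t := v)) \<partial>r t x) \<partial>R t)"
    proof (rule nn_integral_cong_AE)
      show "AE x in R t. (\<integral>\<^sup>+v. F' (Suc t) (x(Suc t := v)) * h (x(Suc t := v)) \<partial>r t x) =
          F' t x * (\<integral>\<^sup>+v. f' t (x, v) * h (x(Suc t := v)) \<partial>r t x)"
        using eq AE_space
      proof eventually_elim
        case (elim x)
        then have x: "x \<in> space (path_space t)"
          using sets_eq_imp_space_eq[OF sets_R] t by simp
        have m: "(\<lambda>v. f' t (x, v) * h (x(Suc t := v))) \<in> borel_measurable (r t x)"
          using measurable_r_section[OF t x prod] by simp
        have "(\<integral>\<^sup>+v. F' (Suc t) (x(Suc t := v)) * h (x(Suc t := v)) \<partial>r t x) =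
            (\<integral>\<^sup>+v. F' t x * (f' t (x, v) * h (x(Suc t := v))) \<partial>r t x)"
          using elim(1) by (intro nn_integral_cong_AE) (auto simp: mult_ac)
        also have "\<dots> = F' t x * (\<integral>\<^sup>+v. f' t (x, v) * h (x(Suc t := v)) \<partial>r t x)"
          by (rule nn_integral_cmult[OF m])
        finally show ?case .
      qed
    qed
    finally show ?thesis .
  qed
  show "(\<integral>\<^sup>+x. F (Suc t) x * h x \<partial>R (Suc t)) =
      (\<integral>\<^sup>+x. F t x * (\<integral>\<^sup>+v. f t (x, v) * h (x(Suc t := v)) \<partial>r t x) \<partial>R t)"
    by (rule *[of F f, OF F f F_Suc]) (use t in auto)
  show "(\<integral>\<^sup>+x. G (Suc t) x * h x \<partial>R (Suc t)) =
      (\<integral>\<^sup>+x. G t x * (\<integral>\<^sup>+v. g t (x, v) * h (x(Suc t := v)) \<partial>r t x) \<partial>R t)"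
    by (rule *[of G g, OF G g G_Suc]) (use t in auto)
qed

lemma nn_integral_space_0:
  "(\<integral>\<^sup>+x. h x \<partial>R 0) = h (\<lambda>_. undefined)"
proof -
  interpret prob_space "R 0"
    by (rule prob_R) simp
  have "space (R 0) = {\<lambda>_. undefined}"
    using sets_eq_imp_space_eq[OF sets_R[of 0]] space_path_space_0 by simp
  then have "(\<integral>\<^sup>+x. h x \<partial>R 0) = (\<integral>\<^sup>+x. h (\<lambda>_. undefined) \<partial>R 0)"
    by (intro nn_integral_cong) simp
  then show ?thesis
    by (simp add: emeasure_space_1)
qed

lemma greedy_coupling_marginals:
  assumes "t \<le> T" "h \<in> borel_measurable (path_space t)"
  shows "(\<integral>\<^sup>+z. h (fst z) \<partial>greedy_coupling t) = (\<integral>\<^sup>+x. F t x * h x \<partial>R t) \<and>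
    (\<integral>\<^sup>+z. h (snd z) \<partial>greedy_coupling t) = (\<integral>\<^sup>+x. G t x * h x \<partial>R t)"
  using assms
proof (induction t arbitrary: h)
  case 0
  then have [measurable]: "h \<in> borel_measurable (path_space 0)" by simp
  have "F 0 (\<lambda>_. undefined) = 1" "G 0 (\<lambda>_. undefined) = 1"
    using F_0 G_0 by (simp_all add: nn_integral_space_0)
  then show ?case
    by (simp add: nn_integral_return nn_integral_space_0 space_pair_measure space_path_space_0)
next
  case (Suc t)
  then have t: "t < T" and h [measurable]: "h \<in> borel_measurable (path_space (Suc t))" by auto
  have h_x: "(\<lambda>v. h (x(Suc t := v))) \<in> borel_measurable borel" if "x \<in> space (path_space t)" for x
    using that by (intro measurable_compose[OF measurable_path_extend h]) auto
  note [measurable] = f[OF t] g[OF t] measurable_extend[OF h]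
  have prod: "(\<lambda>z. f t z * h ((fst z)(Suc t := snd z))) \<in> borel_measurable (path_space t \<Otimes>\<^sub>M borel)"
    "(\<lambda>z. g t z * h ((fst z)(Suc t := snd z))) \<in> borel_measurable (path_space t \<Otimes>\<^sub>M borel)"
    by measurable
  have "(\<integral>\<^sup>+z. h (fst z) \<partial>greedy_coupling (Suc t)) =
      (\<integral>\<^sup>+z. (\<integral>\<^sup>+u. h ((fst z)(Suc t := fst u)) \<partial>step_coupling t z) \<partial>greedy_coupling t)"
    by (subst nn_integral_greedy_coupling_Suc[OF t]) (auto simp: extend_pair_def)
  also have "\<dots> = (\<integral>\<^sup>+z. (\<integral>\<^sup>+v. f t (fst z, v) * h ((fst z)(Suc t := v)) \<partial>r t (fst z)) \<partial>greedy_coupling t)"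
  proof (intro nn_integral_cong)
    fix z assume "z \<in> space (greedy_coupling t)"
    then have "z \<in> space (pair_space t)" "fst z \<in> space (path_space t)"
      using t by (auto simp: space_greedy_coupling space_pair_measure)
    then show "(\<integral>\<^sup>+u. h ((fst z)(Suc t := fst u)) \<partial>step_coupling t z) =
        (\<integral>\<^sup>+v. f t (fst z, v) * h ((fst z)(Suc t := v)) \<partial>r t (fst z))"
      by (intro step_coupling_marginals[OF t] h_x)
  qed
  also have "\<dots> = (\<integral>\<^sup>+x. F (Suc t) x * h x \<partial>R (Suc t))"
    unfolding nn_integral_density_Suc[OF t h]
    using Suc.IH[of "\<lambda>x. \<integral>\<^sup>+v. f t (x, v) * h (x(Suc t := v)) \<partial>r t x"]
      borel_measurable_r_integral[OF t prod(1)] t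
    by simp
  finally have 1: "(\<integral>\<^sup>+z. h (fst z) \<partial>greedy_coupling (Suc t)) = (\<integral>\<^sup>+x. F (Suc t) x * h x \<partial>R (Suc t))" .
  have "(\<integral>\<^sup>+z. h (snd z) \<partial>greedy_coupling (Suc t)) =
      (\<integral>\<^sup>+z. (\<integral>\<^sup>+u. h ((snd z)(Suc t := snd u)) \<partial>step_coupling t z) \<partial>greedy_coupling t)"
    by (subst nn_integral_greedy_coupling_Suc[OF t]) (auto simp: extend_pair_def)
  also have "\<dots> = (\<integral>\<^sup>+z. (\<integral>\<^sup>+v. g t (snd z, v) * h ((snd z)(Suc t := v)) \<partial>r t (snd z)) \<partial>greedy_coupling t)"
  proof (intro nn_integral_cong)
    fix z assume "z \<in> space (greedy_coupling t)"
    then have "z \<in> space (pair_space t)" "snd z \<in> space (path_space t)"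
      using t by (auto simp: space_greedy_coupling space_pair_measure)
    then show "(\<integral>\<^sup>+u. h ((snd z)(Suc t := snd u)) \<partial>step_coupling t z) =
        (\<integral>\<^sup>+v. g t (snd z, v) * h ((snd z)(Suc t := v)) \<partial>r t (snd z))"
      by (intro step_coupling_marginals[OF t] h_x)
  qed
  also have "\<dots> = (\<integral>\<^sup>+x. G (Suc t) x * h x \<partial>R (Suc t))"
    unfolding nn_integral_density_Suc[OF t h]
    using Suc.IH[of "\<lambda>x. \<integral>\<^sup>+v. g t (x, v) * h (x(Suc t := v)) \<partial>r t x"]
      borel_measurable_r_integral[OF t prod(2)] t
    by simp
  finally have 2: "(\<integral>\<^sup>+z. h (snd z) \<partial>greedy_coupling (Suc t)) = (\<integral>\<^sup>+x. G (Suc t) x * h x \<partial>R (Suc t))" .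
  from 1 2 show ?case ..
qed

text \<open>The transition kernels are probability measures, so later steps do not change the law of
  the first \<open>s\<close> coordinates.\<close>

lemma nn_integral_greedy_coupling_history:
  assumes "s \<le> t" "t \<le> T" "h \<in> borel_measurable (pair_space s)"
  shows "(\<integral>\<^sup>+z. h (history s (fst z), history s (snd z)) \<partial>greedy_coupling t) = (\<integral>\<^sup>+z. h z \<partial>greedy_coupling s)"
  using assms(1,2)
proof (induction t rule: dec_induct)
  case base
  show ?case
  proof (intro nn_integral_cong)
    fix z assume "z \<in> space (greedy_coupling s)"
    then have "fst z \<in> space (path_space s)" "snd z \<in> space (path_space s)"
      using base by (auto simp: space_greedy_coupling space_pair_measure)
    then show "h (history s (fst z), history s (snd z)) = h z"
      by (simp only: history_full prod.collapse)
  qed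
next
  case (step t)
  then have t: "t < T" by simp
  have [measurable]: "history s \<in> path_space (Suc t) \<rightarrow>\<^sub>M path_space s"
    using step by (intro measurable_history) simp
  note assms(3)[measurable]
  have "(\<integral>\<^sup>+z. h (history s (fst z), history s (snd z)) \<partial>greedy_coupling (Suc t)) =
    (\<integral>\<^sup>+z. (\<integral>\<^sup>+u. h (history s (fst (extend_pair t z u)), history s (snd (extend_pair t z u))) \<partial>step_coupling t z) \<partial>greedy_coupling t)"
    by (rule nn_integral_greedy_coupling_Suc[OF t]) measurable
  also have "\<dots> = (\<integral>\<^sup>+z. h (history s (fst z), history s (snd z)) \<partial>greedy_coupling t)"
  proof (intro nn_integral_cong)
    fix z assume "z \<in> space (greedy_coupling t)"
    then have z: "z \<in> space (pair_space t)"
      using t by (simp add: space_greedy_coupling)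
    interpret prob_space "step_coupling t z"
      using measurable_space[OF measurable_step_coupling[OF t] z] by (simp add: space_prob_algebra)
    have "history s (x(Suc t := v)) = history s x" for x :: "'d path" and v
      using step(1) by (auto simp: fun_eq_iff)
    then show "(\<integral>\<^sup>+u. h (history s (fst (extend_pair t z u)), history s (snd (extend_pair t z u))) \<partial>step_coupling t z)
       = h (history s (fst z), history s (snd z))"
      by (simp add: extend_pair_def emeasure_space_1)
  qed
  also have "\<dots> = (\<integral>\<^sup>+z. h z \<partial>greedy_coupling s)"
    by (rule step.IH) (use t in simp)
  finally show ?case .
qed

lemma greedy_coupling_in_couplings:
  assumes sets: "sets \<mu> = sets (path_space T)" "sets \<nu> = sets (path_space T)"
    and \<mu>: "\<mu> = density (R T) (F T)" and \<nu>: "\<nu> = density (R T) (G T)"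
  shows "greedy_coupling T \<in> couplings \<mu> \<nu>"
proof -
  have *: "(\<integral>\<^sup>+x. h x \<partial>\<mu>) = (\<integral>\<^sup>+x. F T x * h x \<partial>R T)" "(\<integral>\<^sup>+x. h x \<partial>\<nu>) = (\<integral>\<^sup>+x. G T x * h x \<partial>R T)"
    if "h \<in> borel_measurable (path_space T)" for h
    unfolding \<mu> \<nu> using that F G
    by (simp_all add: nn_integral_density measurable_cong_sets[OF sets_R[OF order_refl] refl])
  show ?thesis
    by (rule couplingsI)
      (use prob_space_greedy_coupling[OF order_refl] greedy_coupling_marginals[OF order_refl] in
        \<open>simp_all add: * sets_greedy_coupling sets measurable_cong_sets[OF sets(1) refl]
          measurable_cong_sets[OF sets(2) refl] cong: sets_pair_measure_cong\<close>)
qed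

text \<open>By the projection property, integrals over the first \<open>Suc t\<close> coordinates may be computed under
  the coupling at time \<open>Suc t\<close>, which is composed from the coupling at time \<open>t\<close> and the step kernel.\<close>

lemma joint_step_cond_law_greedy_coupling:
  assumes t: "t < T"
  shows "joint_step_cond_law (greedy_coupling T) t (step_coupling t)"
  unfolding joint_step_cond_law_def
proof (rule regular_cond_lawI)
  note [measurable_cong] = sets_greedy_coupling[OF order_refl]
  have [measurable]: "history t \<in> path_space T \<rightarrow>\<^sub>M path_space t"
    by (rule measurable_history) (use t in simp)
  have [measurable]: "(\<lambda>x. x (Suc t)) \<in> path_space T \<rightarrow>\<^sub>M borel"
    by (rule measurable_path_coordinate) (use t in simp)
  show "(\<lambda>(x, y). (history t x, history t y)) \<in> greedy_coupling T \<rightarrow>\<^sub>M pair_space t"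
    unfolding case_prod_beta' by measurable
  show "(\<lambda>(x, y). (x (Suc t), y (Suc t))) \<in> greedy_coupling T \<rightarrow>\<^sub>M borel \<Otimes>\<^sub>M borel"
    unfolding case_prod_beta' by measurable
  show k: "step_coupling t \<in> pair_space t \<rightarrow>\<^sub>M prob_algebra (borel \<Otimes>\<^sub>M borel)"
    by (rule measurable_step_coupling[OF t])
  fix h :: "('d path \<times> 'd path) \<times> (real ^ 'd) \<times> (real ^ 'd) \<Rightarrow> ennreal"
  assume h [measurable]: "h \<in> borel_measurable (pair_space t \<Otimes>\<^sub>M (borel \<Otimes>\<^sub>M borel))"
  define H where "H z = h ((history t (fst z), history t (snd z)), fst z (Suc t), snd z (Suc t))" for z
  have [measurable]: "history t \<in> path_space (Suc t) \<rightarrow>\<^sub>M path_space t"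
    by (rule measurable_history) simp
  have [measurable]: "(\<lambda>x. x (Suc t)) \<in> path_space (Suc t) \<rightarrow>\<^sub>M borel"
    by (rule measurable_path_coordinate) simp
  have H: "H \<in> borel_measurable (pair_space (Suc t))"
    unfolding H_def by measurable
  have I: "(\<lambda>z. \<integral>\<^sup>+u. h (z, u) \<partial>step_coupling t z) \<in> borel_measurable (pair_space t)"
    by (rule nn_integral_measurable_subprob_algebra2[where N="borel \<Otimes>\<^sub>M borel"])
      (use measurable_prob_algebraD[OF k] in auto)
  have "(\<integral>\<^sup>+z. H (history (Suc t) (fst z), history (Suc t) (snd z)) \<partial>greedy_coupling T) =
      (\<integral>\<^sup>+z. H z \<partial>greedy_coupling (Suc t))"
    by (rule nn_integral_greedy_coupling_history[OF _ _ H]) (use t in auto)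
  also have "\<dots> = (\<integral>\<^sup>+z. (\<integral>\<^sup>+u. H (extend_pair t z u) \<partial>step_coupling t z) \<partial>greedy_coupling t)"
    by (rule nn_integral_greedy_coupling_Suc[OF t H])
  also have "\<dots> = (\<integral>\<^sup>+z. (\<integral>\<^sup>+u. h (z, u) \<partial>step_coupling t z) \<partial>greedy_coupling t)"
  proof (intro nn_integral_cong)
    fix z and u :: "(real ^ 'd) \<times> (real ^ 'd)" assume "z \<in> space (greedy_coupling t)"
    then have z: "fst z \<in> space (path_space t)" "snd z \<in> space (path_space t)"
      using t by (auto simp: space_greedy_coupling space_pair_measure)
    have "H (extend_pair t z u) = h ((history t ((fst z)(Suc t := fst u)), history t ((snd z)(Suc t := snd u))), u)"
      by (simp only: H_def extend_pair_def fst_conv snd_conv fun_upd_same prod.collapse)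
    then show "H (extend_pair t z u) = h (z, u)"
      by (simp only: history_extend[OF z(1)] history_extend[OF z(2)] prod.collapse)
  qed
  also have "\<dots> = (\<integral>\<^sup>+z. (\<integral>\<^sup>+u. h ((history t (fst z), history t (snd z)), u)
      \<partial>step_coupling t (history t (fst z), history t (snd z))) \<partial>greedy_coupling T)"
    by (rule nn_integral_greedy_coupling_history[OF _ _ I, symmetric]) (use t in auto)
  also have "(\<lambda>z. H (history (Suc t) (fst z), history (Suc t) (snd z))) =
      (\<lambda>z. h ((history t (fst z), history t (snd z)), fst z (Suc t), snd z (Suc t)))"
    by (simp add: H_def history_history del: One_nat_def)
  finally show "(\<integral>\<^sup>+\<omega>. h (case \<omega> of (x, y) \<Rightarrow> (history t x, history t y), case \<omega> of (x, y) \<Rightarrow> (x (Suc t), y (Suc t))) \<partial>greedy_coupling T) =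
    (\<integral>\<^sup>+\<omega>. (\<integral>\<^sup>+y. h (case \<omega> of (x, y) \<Rightarrow> (history t x, history t y), y) \<partial>step_coupling t (case \<omega> of (x, y) \<Rightarrow> (history t x, history t y))) \<partial>greedy_coupling T)"
    unfolding case_prod_beta' .
qed

lemma measurable_density_kernel:
  assumes t: "t < T" and f': "f' \<in> borel_measurable (path_space t \<Otimes>\<^sub>M borel)"
    and f'_1: "\<And>x. x \<in> space (path_space t) \<Longrightarrow> (\<integral>\<^sup>+v. f' (x, v) \<partial>r t x) = 1"
  shows "(\<lambda>x. density (r t x) (\<lambda>v. f' (x, v))) \<in> path_space t \<rightarrow>\<^sub>M prob_algebra borel"
proof (rule measurable_prob_algebraI)
  show prob: "prob_space (density (r t x) (\<lambda>v. f' (x, v)))" if x: "x \<in> space (path_space t)" for x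
    using f'_1[OF x] measurable_r_section[OF t x f'] r_space(2,3)[OF t x]
    by (intro prob_spaceI) (simp add: emeasure_density)
  show "(\<lambda>x. density (r t x) (\<lambda>v. f' (x, v))) \<in> path_space t \<rightarrow>\<^sub>M subprob_algebra borel"
  proof (rule measurable_subprob_algebra)
    show "subprob_space (density (r t x) (\<lambda>v. f' (x, v)))" if "x \<in> space (path_space t)" for x
      using prob[OF that] by (rule prob_space_imp_subprob_space)
    show "sets (density (r t x) (\<lambda>v. f' (x, v))) = sets borel" if "x \<in> space (path_space t)" for x
      using r_space(2)[OF t that] by simp
    fix A :: "(real ^ 'd) set" assume A [measurable]: "A \<in> sets borel"
    have "emeasure (density (r t x) (\<lambda>v. f' (x, v))) A = (\<integral>\<^sup>+v. f' (x, v) * indicator A v \<partial>r t x)"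
      if x: "x \<in> space (path_space t)" for x
      using measurable_r_section[OF t x f'] A r_space(2)[OF t x] by (simp add: emeasure_density)
    moreover have "(\<lambda>x. \<integral>\<^sup>+v. f' (x, v) * indicator A v \<partial>r t x) \<in> borel_measurable (path_space t)"
      using borel_measurable_r_integral[OF t, of "\<lambda>z. f' z * indicator A (snd z)"] f' by simp
    ultimately show "(\<lambda>x. emeasure (density (r t x) (\<lambda>v. f' (x, v))) A) \<in> borel_measurable (path_space t)"
      by (simp cong: measurable_cong)
  qed
qed

end

context density_disintegration
begin

text \<open>The two path laws play the same role here, so that facts about \<open>F\<close> and \<open>f\<close> transfer to \<open>G\<close> and \<open>g\<close>.\<close>

lemma swap: "density_disintegration T R r G F g f"
  by (rule density_disintegration.intro;
    (rule prob_R sets_R r R_Suc F G F_finite G_finite F_0 G_0 f g f_1 g_1 F_Suc G_Suc; assumption))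

text \<open>The left side is the first marginal of the greedy coupling at time \<open>T\<close> and the right side that at
  time \<open>s\<close>, and the couplings are consistent under projection.\<close>

lemma nn_integral_density_history:
  assumes s: "s \<le> T" and h: "h \<in> borel_measurable (path_space s)"
  shows "(\<integral>\<^sup>+x. F T x * h (history s x) \<partial>R T) = (\<integral>\<^sup>+x. F s x * h x \<partial>R s)"
proof -
  have "(\<lambda>x. h (history s x)) \<in> borel_measurable (path_space T)"
    by (rule measurable_compose[OF measurable_history[OF s] h])
  then have "(\<integral>\<^sup>+x. F T x * h (history s x) \<partial>R T) = (\<integral>\<^sup>+z. h (history s (fst z)) \<partial>greedy_coupling T)"
    using greedy_coupling_marginals[of T "\<lambda>x. h (history s x)"] by simp
  also have "\<dots> = (\<integral>\<^sup>+z. h (fst z) \<partial>greedy_coupling s)"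
    using nn_integral_greedy_coupling_history[of s T "\<lambda>z. h (fst z)"] s h by simp
  also have "\<dots> = (\<integral>\<^sup>+x. F s x * h x \<partial>R s)"
    using greedy_coupling_marginals[of s h] s h by simp
  finally show ?thesis .
qed

text \<open>\<open>F s\<close> is a version of the density of the history law at time \<open>s\<close>.\<close>

lemma nn_integral_history:
  assumes \<mu>: "\<mu> = density (R T) (F T)" and s: "s \<le> T" and h: "h \<in> borel_measurable (path_space s)"
  shows "(\<integral>\<^sup>+x. h (history s x) \<partial>\<mu>) = (\<integral>\<^sup>+x. F s x * h x \<partial>R s)"
proof -
  have "(\<lambda>x. h (history s x)) \<in> borel_measurable (path_space T)"
    by (rule measurable_compose[OF measurable_history[OF s] h])
  then show ?thesis
    unfolding nn_integral_density_history[OF s h, symmetric] \<mu>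
    using F[OF order_refl] by (subst nn_integral_density) (simp_all add: measurable_cong_sets[OF sets_R[OF order_refl] refl])
qed

lemma step_cond_law_density:
  assumes sets: "sets \<mu> = sets (path_space T)" and \<mu>: "\<mu> = density (R T) (F T)" and t: "t < T"
  shows "step_cond_law \<mu> t (\<lambda>x. density (r t x) (\<lambda>v. f t (x, v)))"
  unfolding step_cond_law_def
proof (rule regular_cond_lawI)
  note [measurable_cong] = sets sets_R[OF order_refl]
  have [measurable]: "history t \<in> path_space T \<rightarrow>\<^sub>M path_space t"
    by (rule measurable_history) (use t in simp)
  have [measurable]: "(\<lambda>x. x (Suc t)) \<in> path_space T \<rightarrow>\<^sub>M borel"
    by (rule measurable_path_coordinate) (use t in simp)
  show "history t \<in> \<mu> \<rightarrow>\<^sub>M path_space t" "(\<lambda>x. x (Suc t)) \<in> \<mu> \<rightarrow>\<^sub>M borel"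
    by measurable
  show k: "(\<lambda>x. density (r t x) (\<lambda>v. f t (x, v))) \<in> path_space t \<rightarrow>\<^sub>M prob_algebra borel"
    by (rule measurable_density_kernel[OF t f[OF t] f_1[OF t]])
  fix h :: "'d path \<times> (real ^ 'd) \<Rightarrow> ennreal"
  assume h [measurable]: "h \<in> borel_measurable (path_space t \<Otimes>\<^sub>M borel)"
  define H where "H x = h (history t x, x (Suc t))" for x
  have [measurable]: "history t \<in> path_space (Suc t) \<rightarrow>\<^sub>M path_space t"
    by (rule measurable_history) simp
  have [measurable]: "(\<lambda>x. x (Suc t)) \<in> path_space (Suc t) \<rightarrow>\<^sub>M borel"
    by (rule measurable_path_coordinate) simp
  have H: "H \<in> borel_measurable (path_space (Suc t))"
    unfolding H_def by measurable
  define I where "I x = (\<integral>\<^sup>+v. h (x, v) \<partial>density (r t x) (\<lambda>v. f t (x, v)))" for x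
  have I [measurable]: "I \<in> borel_measurable (path_space t)"
    unfolding I_def by (rule nn_integral_measurable_subprob_algebra2[where N=borel])
      (use measurable_prob_algebraD[OF k] in auto)
  have I_eq: "I x = (\<integral>\<^sup>+v. f t (x, v) * H (x(Suc t := v)) \<partial>r t x)" if x: "x \<in> space (path_space t)" for x
    using measurable_r_section[OF t x h] measurable_r_section[OF t x f[OF t]]
    by (simp add: I_def nn_integral_density H_def history_extend[OF x] del: One_nat_def)
  have "(\<integral>\<^sup>+x. h (history t x, x (Suc t)) \<partial>\<mu>) = (\<integral>\<^sup>+x. H (history (Suc t) x) \<partial>\<mu>)"
    by (simp add: H_def history_history del: One_nat_def)
  also have "\<dots> = (\<integral>\<^sup>+x. F (Suc t) x * H x \<partial>R (Suc t))"
    by (rule nn_integral_history[OF \<mu> _ H]) (use t in simp)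
  also have "\<dots> = (\<integral>\<^sup>+x. F t x * (\<integral>\<^sup>+v. f t (x, v) * H (x(Suc t := v)) \<partial>r t x) \<partial>R t)"
    by (rule nn_integral_density_Suc[OF t H])
  also have "\<dots> = (\<integral>\<^sup>+x. F t x * I x \<partial>R t)"
    using sets_eq_imp_space_eq[OF sets_R] t by (intro nn_integral_cong) (simp add: I_eq)
  also have "\<dots> = (\<integral>\<^sup>+x. I (history t x) \<partial>\<mu>)"
    by (rule nn_integral_history[OF \<mu> _ I, symmetric]) (use t in simp)
  finally show "(\<integral>\<^sup>+x. h (history t x, x (Suc t)) \<partial>\<mu>) =
      (\<integral>\<^sup>+x. (\<integral>\<^sup>+v. h (history t x, v) \<partial>density (r t (history t x)) (\<lambda>v. f t (history t x, v))) \<partial>\<mu>)"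
    by (simp add: I_def)
qed

theorem greedy_coupling_bicausal:
  assumes sets: "sets \<mu> = sets (path_space T)" "sets \<nu> = sets (path_space T)"
    and \<mu>: "\<mu> = density (R T) (F T)" and \<nu>: "\<nu> = density (R T) (G T)" and T: "1 \<le> T"
  shows "greedy_coupling T \<in> bicausal_couplings T \<mu> \<nu>"
  unfolding bicausal_couplings_def
proof (intro CollectI conjI ballI)
  interpret swap: density_disintegration T R r G F g f
    by (rule swap)
  show coupling: "greedy_coupling T \<in> couplings \<mu> \<nu>"
    by (rule greedy_coupling_in_couplings[OF assms(1-4)])
  have coord: "(\<lambda>x. x 1) \<in> path_space T \<rightarrow>\<^sub>M borel"
    using T by (intro measurable_path_coordinate) simp
  show "distr (greedy_coupling T) (borel \<Otimes>\<^sub>M borel) (\<lambda>(x, y). (x 1, y 1))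
      \<in> couplings (distr \<mu> borel (\<lambda>x. x 1)) (distr \<nu> borel (\<lambda>y. y 1))"
    by (rule couplings_push_forward[OF coupling])
      (use coord in \<open>simp_all only: measurable_cong_sets[OF sets(1) refl] measurable_cong_sets[OF sets(2) refl]\<close>)
  fix t assume "t \<in> {1..<T}"
  then have t: "t < T" by simp
  have hist: "history t x \<in> space (path_space t)" for x :: "'d path"
    by (simp add: in_space_path_space)
  have "step_coupling t (history t x, history t y) \<in>
      couplings (density (r t (history t x)) (\<lambda>v. f t (history t x, v)))
        (density (r t (history t y)) (\<lambda>v. g t (history t y, v)))" for x y
    using step_coupling_in_couplings[OF t, of "(history t x, history t y)"] hist
    by (simp add: space_pair_measure)
  then show "\<exists>\<kappa> \<kappa>\<^sub>\<mu> \<kappa>\<^sub>\<nu>. joint_step_cond_law (greedy_coupling T) t \<kappa> \<and> step_cond_law \<mu> t \<kappa>\<^sub>\<mu> \<and> step_cond_law \<nu> t \<kappa>\<^sub>\<nu> \<and>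
      (AE (x, y) in greedy_coupling T. \<kappa> (history t x, history t y) \<in> couplings (\<kappa>\<^sub>\<mu> (history t x)) (\<kappa>\<^sub>\<nu> (history t y)))"
    using joint_step_cond_law_greedy_coupling[OF t] step_cond_law_density[OF sets(1) \<mu> t]
      swap.step_cond_law_density[OF sets(2) \<nu> t] by fast
qed

end

section \<open>The diagonal of the greedy coupling\<close>

context density_disintegration
begin

text \<open>The part of the diagonal that the maximal couplings of the individual steps keep.\<close>

primrec diagonal_density :: "nat \<Rightarrow> 'd path \<Rightarrow> ennreal" where
  "diagonal_density 0 = (\<lambda>x. min (F 0 x) (G 0 x))"
| "diagonal_density (Suc t) = (\<lambda>x. diagonal_density t (history t x)
     * min (f t (history t x, x (Suc t))) (g t (history t x, x (Suc t))))"

lemma measurable_diagonal_density: "t \<le> T \<Longrightarrow> diagonal_density t \<in> borel_measurable (path_space t)"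
proof (induction t)
  case 0
  note [measurable] = F[OF 0] G[OF 0]
  show ?case by simp
next
  case (Suc t)
  then have t: "t < T" and [measurable]: "diagonal_density t \<in> borel_measurable (path_space t)" by auto
  note [measurable] = f[OF t] g[OF t]
  have [measurable]: "history t \<in> path_space (Suc t) \<rightarrow>\<^sub>M path_space t"
    by (rule measurable_history) simp
  have [measurable]: "(\<lambda>x. x (Suc t)) \<in> path_space (Suc t) \<rightarrow>\<^sub>M borel"
    by (rule measurable_path_coordinate) simp
  show ?case
    unfolding diagonal_density.simps by measurable
qed

text \<open>The diagonal parts of the step couplings compose to this density, and a lower bound for the diagonal
  is an upper bound for the mismatch.\<close>

lemma diagonal_density_le_greedy_coupling:
  assumes "t \<le> T" "h \<in> borel_measurable (path_space t)"
  shows "(\<integral>\<^sup>+x. diagonal_density t x * h x \<partial>R t) \<le>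
    (\<integral>\<^sup>+z. h (fst z) * indicator {z. fst z = snd z} z \<partial>greedy_coupling t)"
  using assms
proof (induction t arbitrary: h)
  case 0
  then have [measurable]: "h \<in> borel_measurable (path_space 0)" by simp
  have "F 0 (\<lambda>_. undefined) = 1" "G 0 (\<lambda>_. undefined) = 1"
    using F_0 G_0 by (simp_all add: nn_integral_space_0)
  moreover have "(\<lambda>z. h (fst z) * indicator {z. fst z = snd z} z) \<in> borel_measurable (pair_space 0)"
    by measurable
  ultimately show ?case
    by (simp add: nn_integral_return nn_integral_space_0 space_pair_measure space_path_space_0)
next
  case (Suc t)
  then have t: "t < T" and h [measurable]: "h \<in> borel_measurable (path_space (Suc t))" by auto
  note [measurable] = f[OF t] g[OF t] measurable_extend[OF h] measurable_diagonal_density[OF Suc.prems(1)]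
  define \<phi> where "\<phi> x = (\<integral>\<^sup>+v. min (f t (x, v)) (g t (x, v)) * h (x(Suc t := v)) \<partial>r t x)" for x
  have mh: "(\<lambda>z. min (f t z) (g t z) * h ((fst z)(Suc t := snd z))) \<in> borel_measurable (path_space t \<Otimes>\<^sub>M borel)"
    by measurable
  have [measurable]: "\<phi> \<in> borel_measurable (path_space t)"
    unfolding \<phi>_def using borel_measurable_r_integral[OF t mh] by simp
  define H where "H z = h (fst z) * indicator {z. fst z = snd z} z" for z :: "'d path \<times> 'd path"
  have H [measurable]: "H \<in> borel_measurable (pair_space (Suc t))"
    unfolding H_def by measurable
  have "(\<integral>\<^sup>+x. diagonal_density (Suc t) x * h x \<partial>R (Suc t)) =
      (\<integral>\<^sup>+x. (\<integral>\<^sup>+v. diagonal_density (Suc t) (x(Suc t := v)) * h (x(Suc t := v)) \<partial>r t x) \<partial>R t)"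
    by (rule R_Suc[OF t]) measurable
  also have "\<dots> = (\<integral>\<^sup>+x. diagonal_density t x * \<phi> x \<partial>R t)"
  proof (intro nn_integral_cong)
    fix x assume "x \<in> space (R t)"
    then have x: "x \<in> space (path_space t)"
      using sets_eq_imp_space_eq[OF sets_R[of t]] t by simp
    have "(\<integral>\<^sup>+v. diagonal_density (Suc t) (x(Suc t := v)) * h (x(Suc t := v)) \<partial>r t x) =
        (\<integral>\<^sup>+v. diagonal_density t x * (min (f t (x, v)) (g t (x, v)) * h (x(Suc t := v))) \<partial>r t x)"
      by (simp add: history_extend[OF x] mult.assoc del: One_nat_def)
    also have "\<dots> = diagonal_density t x * \<phi> x"
      unfolding \<phi>_def using measurable_r_section[OF t x mh] by (intro nn_integral_cmult) simp
    finally show "(\<integral>\<^sup>+v. diagonal_density (Suc t) (x(Suc t := v)) * h (x(Suc t := v)) \<partial>r t x) = diagonal_density t x * \<phi> x" .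
  qed
  also have "\<dots> \<le> (\<integral>\<^sup>+z. \<phi> (fst z) * indicator {z. fst z = snd z} z \<partial>greedy_coupling t)"
    by (rule Suc.IH) (use t in auto)
  also have "\<dots> \<le> (\<integral>\<^sup>+z. (\<integral>\<^sup>+u. H (extend_pair t z u) \<partial>step_coupling t z) \<partial>greedy_coupling t)"
  proof (intro nn_integral_mono)
    fix z assume "z \<in> space (greedy_coupling t)"
    then have z: "z \<in> space (pair_space t)"
      using t by (simp add: space_greedy_coupling)
    show "\<phi> (fst z) * indicator {z. fst z = snd z} z \<le> (\<integral>\<^sup>+u. H (extend_pair t z u) \<partial>step_coupling t z)"
    proof (cases "fst z = snd z")
      case True
      have x: "fst z \<in> space (path_space t)"
        using z by (auto simp: space_pair_measure)
      have "(\<lambda>u. H (extend_pair t z u)) \<in> borel_measurable (borel \<Otimes>\<^sub>M borel)"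
        using measurable_compose[OF measurable_compose[OF measurable_Pair1'[OF z] measurable_extend_pair] H] by simp
      then have m: "(\<lambda>u. H (extend_pair t z u)) \<in> borel_measurable (r t (fst z) \<Otimes>\<^sub>M r t (fst z))"
        by (simp add: measurable_cong_sets[OF sets_pair_measure_cong[OF r_space(2)[OF t x] r_space(2)[OF t x]] refl])
      have "\<phi> (fst z) * indicator {z. fst z = snd z} z =
          (\<integral>\<^sup>+v. step_overlap t (z, v) * H (extend_pair t z (v, v)) \<partial>r t (fst z))"
        using True by (simp add: \<phi>_def step_overlap_def H_def extend_pair_def)
      also have "\<dots> \<le> (\<integral>\<^sup>+u. H (extend_pair t z u) \<partial>step_coupling t z)"
        unfolding step_coupling_def
        by (subst nn_integral_partial_diagonal_coupling[OF step_coupling_prems(1-6)[OF t z] m]) simp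
      finally show ?thesis .
    qed simp
  qed
  also have "\<dots> = (\<integral>\<^sup>+z. H z \<partial>greedy_coupling (Suc t))"
    by (rule nn_integral_greedy_coupling_Suc[OF t H, symmetric])
  finally show ?case
    by (simp only: H_def)
qed

end

section \<open>Estimating the lost overlap\<close>

lemma ennreal_le_add_diff: "z \<le> \<delta> + (z - \<delta>)" for z \<delta> :: ennreal
  by (cases "\<delta> \<le> z") (auto simp: add_diff_inverse_ennreal not_le less_imp_le intro: add_increasing2)

text \<open>Passing from \<open>min a b * min \<alpha> \<beta>\<close> to \<open>min (a * \<alpha>) (b * \<beta>)\<close> matters only when \<open>a, b\<close> and \<open>\<alpha>, \<beta>\<close> are ordered in
  opposite ways, and then replacing the smaller past density by the larger one costs \<open>\<bar>a - b\<bar>\<close> times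
  the smaller of \<open>\<alpha>\<close> and \<open>\<beta>\<close>. Bounding the latter by \<open>\<beta>\<close> keeps only the second law in the estimate. For \<open>b = 0\<close> nothing is
  left to bound. The finiteness assumption excludes \<open>\<infinity> - \<infinity>\<close>, which is \<open>\<infinity>\<close> in the extended
  nonnegative reals.\<close>

lemma min_product_excess_le:
  fixes a b \<alpha> \<beta> \<delta> :: ennreal
  assumes fin: "b * \<beta> < \<infinity>"
  shows "min (a * \<alpha>) (b * \<beta>) - \<delta> * min \<alpha> \<beta> \<le>
    ((min a b - \<delta>) + (if b = 0 then 0 else (a - b) + (b - a))) * \<beta>"
proof -
  let ?X = "if b = 0 then 0 else (a - b) + (b - a)"
  have "min (a * \<alpha>) (b * \<beta>) \<le> min a b * min \<alpha> \<beta> + ?X * \<beta>"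
  proof (cases "b = 0")
    case False
    show ?thesis
    proof (cases "a \<le> b"; cases "\<alpha> \<le> \<beta>")
      assume "a \<le> b" "\<not> \<alpha> \<le> \<beta>"
      then have *: "min a b = a" "min \<alpha> \<beta> = \<beta>" and b: "b = a + (b - a)"
        by (auto simp: add_diff_inverse_ennreal)
      have "min (a * \<alpha>) (b * \<beta>) \<le> (a + (b - a)) * \<beta>"
        using b by auto
      also have "\<dots> \<le> a * \<beta> + ?X * \<beta>"
        using False by (auto simp: distrib_right)
      finally show ?thesis
        unfolding * .
    next
      assume "\<not> a \<le> b" "\<alpha> \<le> \<beta>"
      then have *: "min a b = b" "min \<alpha> \<beta> = \<alpha>" and a: "a = b + (a - b)"
        by (auto simp: add_diff_inverse_ennreal)
      have "min (a * \<alpha>) (b * \<beta>) \<le> (b + (a - b)) * \<alpha>"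
        using a by auto
      also have "\<dots> \<le> b * \<alpha> + ?X * \<beta>"
        using False \<open>\<alpha> \<le> \<beta>\<close> by (auto simp: distrib_right intro!: add_mono mult_mono add_increasing2)
      finally show ?thesis
        unfolding * .
    qed (use False in \<open>auto simp: min_def intro: add_increasing2\<close>)
  qed simp
  also have "\<dots> \<le> (\<delta> + (min a b - \<delta>)) * min \<alpha> \<beta> + ?X * \<beta>"
    by (intro add_mono mult_right_mono order_refl ennreal_le_add_diff) auto
  also have "\<dots> \<le> \<delta> * min \<alpha> \<beta> + ((min a b - \<delta>) + ?X) * \<beta>"
    by (simp only: distrib_right add.assoc) (intro add_mono mult_left_mono order_refl min.cobounded2 zero_le)
  finally show ?thesis
    using fin by (auto simp: ennreal_minus_le_iff min_def)
qed

text \<open>On \<open>{g \<le> f}\<close> the excess is the difference of the \<open>w\<close>-masses of \<open>X\<close> and \<open>Y\<close> in that set. Outcomes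
  with \<open>X = Y\<close> contribute equally to both, and the others contribute at most \<open>c\<close>.\<close>

lemma nn_integral_density_excess_le:
  assumes [measurable]: "f \<in> borel_measurable M" "g \<in> borel_measurable M" "w \<in> borel_measurable M"
    "X \<in> P \<rightarrow>\<^sub>M M" "Y \<in> P \<rightarrow>\<^sub>M M" "c \<in> borel_measurable P"
    and X: "\<And>h. h \<in> borel_measurable M \<Longrightarrow> (\<integral>\<^sup>+x. f x * h x \<partial>M) = (\<integral>\<^sup>+\<omega>. h (X \<omega>) \<partial>P)"
    and Y: "\<And>h. h \<in> borel_measurable M \<Longrightarrow> (\<integral>\<^sup>+x. g x * h x \<partial>M) = (\<integral>\<^sup>+\<omega>. h (Y \<omega>) \<partial>P)"
    and c: "\<And>\<omega>. \<omega> \<in> space P \<Longrightarrow> X \<omega> = Y \<omega> \<or> w (X \<omega>) \<le> c \<omega>"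
    and fin: "(\<integral>\<^sup>+x. g x * w x \<partial>M) < \<infinity>"
  shows "(\<integral>\<^sup>+x. w x * (f x - g x) \<partial>M) \<le> (\<integral>\<^sup>+\<omega>. c \<omega> \<partial>P)"
proof -
  define k where "k x = w x * of_bool (g x \<le> f x)" for x
  have [measurable]: "k \<in> borel_measurable M"
    unfolding k_def by measurable
  have "(\<integral>\<^sup>+x. g x * k x \<partial>M) \<le> (\<integral>\<^sup>+x. g x * w x \<partial>M)"
    by (intro nn_integral_mono) (auto simp: k_def)
  then have fin': "(\<integral>\<^sup>+x. g x * k x \<partial>M) < \<infinity>"
    using fin by (rule le_less_trans)
  have "(\<integral>\<^sup>+x. g x * k x \<partial>M) + (\<integral>\<^sup>+x. w x * (f x - g x) \<partial>M) = (\<integral>\<^sup>+x. f x * k x \<partial>M)"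
  proof (subst nn_integral_add[symmetric])
    have "g x * k x + w x * (f x - g x) = f x * k x" for x
    proof (cases "g x \<le> f x")
      case True
      then have "f x * w x = (g x + (f x - g x)) * w x"
        by (simp add: add_diff_inverse_ennreal)
      then show ?thesis
        using True by (simp add: k_def distrib_left[symmetric] mult.commute[of "g x"])
          (simp add: mult.commute)
    next
      case False
      then have "f x - g x = 0"
        by (auto simp: not_le diff_eq_0_iff_ennreal less_imp_le intro: less_le_trans[OF _ top_greatest])
      then show ?thesis
        using False by (simp add: k_def)
    qed
    then show "(\<integral>\<^sup>+x. g x * k x + w x * (f x - g x) \<partial>M) = (\<integral>\<^sup>+x. f x * k x \<partial>M)"
      by simp
  qed auto
  also have "\<dots> = (\<integral>\<^sup>+\<omega>. k (X \<omega>) \<partial>P)"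
    by (rule X) measurable
  also have "\<dots> \<le> (\<integral>\<^sup>+\<omega>. k (Y \<omega>) + c \<omega> \<partial>P)"
  proof (intro nn_integral_mono)
    fix \<omega> assume "\<omega> \<in> space P"
    moreover have "k x \<le> w x" for x
      by (simp add: k_def)
    ultimately show "k (X \<omega>) \<le> k (Y \<omega>) + c \<omega>"
      using c[of \<omega>] by (metis add_increasing add_increasing2 order_refl order_trans zero_le)
  qed
  also have "\<dots> = (\<integral>\<^sup>+\<omega>. k (Y \<omega>) \<partial>P) + (\<integral>\<^sup>+\<omega>. c \<omega> \<partial>P)"
    by (rule nn_integral_add) auto
  also have "(\<integral>\<^sup>+\<omega>. k (Y \<omega>) \<partial>P) = (\<integral>\<^sup>+x. g x * k x \<partial>M)"
    by (rule Y[symmetric]) measurable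
  finally show ?thesis
    using fin' by (auto simp: ennreal_add_left_cancel_le)
qed

context density_disintegration
begin

definition overlap_density :: "nat \<Rightarrow> 'd path \<Rightarrow> ennreal" where
  "overlap_density t x = min (F t x) (G t x)"

text \<open>Where \<open>G\<close> vanishes the step law of the second path law is arbitrary and its growth is
  uncontrolled. The value 0 there is harmless, because the overlap vanishes as well.\<close>

definition density_gap :: "nat \<Rightarrow> 'd path \<Rightarrow> ennreal" where
  "density_gap t x = (if G t x = 0 then 0 else (F t x - G t x) + (G t x - F t x))"

definition overlap_deficit :: "nat \<Rightarrow> 'd path \<Rightarrow> ennreal" where
  "overlap_deficit t x = overlap_density t x - diagonal_density t x"

lemma measurable_overlap_density: "t \<le> T \<Longrightarrow> overlap_density t \<in> borel_measurable (path_space t)"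
  unfolding overlap_density_def using F[of t] G[of t] by measurable

lemma measurable_density_gap: "t \<le> T \<Longrightarrow> density_gap t \<in> borel_measurable (path_space t)"
  unfolding density_gap_def using F[of t] G[of t] by measurable

lemma measurable_overlap_deficit: "t \<le> T \<Longrightarrow> overlap_deficit t \<in> borel_measurable (path_space t)"
  unfolding overlap_deficit_def using measurable_overlap_density[of t] measurable_diagonal_density[of t] by measurable

lemma overlap_deficit_Suc:
  assumes t: "t < T" and w: "w \<in> borel_measurable (path_space (Suc t))"
  shows "(\<integral>\<^sup>+x. w x * overlap_deficit (Suc t) x \<partial>R (Suc t)) \<le>
    (\<integral>\<^sup>+x. (overlap_deficit t x + density_gap t x) *
      (\<integral>\<^sup>+v. g t (x, v) * w (x(Suc t := v)) \<partial>r t x) \<partial>R t)"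
proof -
  have "t \<le> T" "Suc t \<le> T"
    using t by auto
  note [measurable] = f[OF t] g[OF t] w measurable_extend[OF w] measurable_overlap_deficit[OF \<open>Suc t \<le> T\<close>]
  let ?e = "\<lambda>x. overlap_deficit t x + density_gap t x"
  have "(\<integral>\<^sup>+x. w x * overlap_deficit (Suc t) x \<partial>R (Suc t)) =
    (\<integral>\<^sup>+x. (\<integral>\<^sup>+v. w (x(Suc t := v)) * overlap_deficit (Suc t) (x(Suc t := v)) \<partial>r t x) \<partial>R t)"
    by (rule R_Suc[OF t]) measurable
  also have "\<dots> \<le> (\<integral>\<^sup>+x. ?e x * (\<integral>\<^sup>+v. g t (x, v) * w (x(Suc t := v)) \<partial>r t x) \<partial>R t)"
  proof (rule nn_integral_mono_AE)
    show "AE x in R t. (\<integral>\<^sup>+v. w (x(Suc t := v)) * overlap_deficit (Suc t) (x(Suc t := v)) \<partial>r t x)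
        \<le> ?e x * (\<integral>\<^sup>+v. g t (x, v) * w (x(Suc t := v)) \<partial>r t x)"
      using F_Suc[OF t] G_Suc[OF t] AE_space
    proof eventually_elim
      case (elim x)
      then have x: "x \<in> space (path_space t)"
        using sets_eq_imp_space_eq[OF sets_R[OF \<open>t \<le> T\<close>]] by simp
      have "(\<lambda>z. g t z * w ((fst z)(Suc t := snd z))) \<in> borel_measurable (path_space t \<Otimes>\<^sub>M borel)"
        by measurable
      note m = measurable_r_section[OF t x this]
      have "(\<integral>\<^sup>+v. w (x(Suc t := v)) * overlap_deficit (Suc t) (x(Suc t := v)) \<partial>r t x)
          \<le> (\<integral>\<^sup>+v. ?e x * (g t (x, v) * w (x(Suc t := v))) \<partial>r t x)"
      proof (rule nn_integral_mono_AE)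
        show "AE v in r t x. w (x(Suc t := v)) * overlap_deficit (Suc t) (x(Suc t := v))
            \<le> ?e x * (g t (x, v) * w (x(Suc t := v)))"
          using elim(1,2)
        proof eventually_elim
          case v: (elim v)
          have "x(Suc t := v) \<in> space (path_space (Suc t))"
            using x by (auto simp: in_space_path_space extensional_def)
          from G_finite[OF \<open>Suc t \<le> T\<close> this] have "G t x * g t (x, v) < \<infinity>"
            unfolding v(2) .
          have "overlap_deficit (Suc t) (x(Suc t := v)) =
              min (F t x * f t (x, v)) (G t x * g t (x, v)) - diagonal_density t x * min (f t (x, v)) (g t (x, v))"
            by (simp add: overlap_deficit_def overlap_density_def v history_extend[OF x] del: One_nat_def)
          also have "\<dots> \<le> ?e x * g t (x, v)"
            unfolding overlap_deficit_def overlap_density_def density_gap_def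
            by (rule min_product_excess_le) fact
          finally show ?case
            by (simp add: mult.commute[of "w _"] mult.assoc[symmetric] mult_right_mono)
        qed
      qed
      also have "\<dots> = ?e x * (\<integral>\<^sup>+v. g t (x, v) * w (x(Suc t := v)) \<partial>r t x)"
        using m by (intro nn_integral_cmult) simp
      finally show ?case .
    qed
  qed
  finally show ?thesis .
qed

lemma overlap_deficit_1:
  assumes T: "1 \<le> T" and w: "w \<in> borel_measurable (path_space 1)"
  shows "(\<integral>\<^sup>+x. w x * overlap_deficit 1 x \<partial>R 1) = 0"
proof -
  have "F 0 (\<lambda>_. undefined) = 1" "G 0 (\<lambda>_. undefined) = 1"
    using F_0 G_0 by (simp_all add: nn_integral_space_0)
  then have "overlap_deficit 0 (\<lambda>_. undefined) + density_gap 0 (\<lambda>_. undefined) = 0"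
    by (simp add: overlap_deficit_def overlap_density_def density_gap_def)
  then show ?thesis
    using overlap_deficit_Suc[of 0 w] T w by (simp add: nn_integral_space_0 del: diagonal_density.simps)
qed

text \<open>Both the old deficit and the gap vanish where \<open>G\<close> does, so their sum has the form \<open>\<phi> G\<close>. The
  integral to be bounded is therefore an integral of \<open>\<phi> w'\<close> under the second path law, to which the growth
  assumption applies.\<close>

lemma overlap_deficit_growth:
  fixes C :: ennreal
  assumes t: "t < T" and w: "w \<in> borel_measurable (path_space t)" and w': "w' \<in> borel_measurable (path_space (Suc t))"
    and growth: "\<And>\<phi>. \<phi> \<in> borel_measurable (path_space t) \<Longrightarrow>
      (\<integral>\<^sup>+x. G (Suc t) x * (\<phi> (history t x) * w' x) \<partial>R (Suc t)) \<le> C * (\<integral>\<^sup>+x. G t x * (\<phi> x * w x) \<partial>R t)"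
  shows "(\<integral>\<^sup>+x. w' x * overlap_deficit (Suc t) x \<partial>R (Suc t)) \<le>
    C * ((\<integral>\<^sup>+x. w x * overlap_deficit t x \<partial>R t) + (\<integral>\<^sup>+x. w x * density_gap t x \<partial>R t))"
proof -
  have "t \<le> T"
    using t by simp
  note [measurable] = F[OF \<open>t \<le> T\<close>] G[OF \<open>t \<le> T\<close>] g[OF t] w w' measurable_extend[OF w']
    measurable_overlap_deficit[OF \<open>t \<le> T\<close>] measurable_density_gap[OF \<open>t \<le> T\<close>]
  note [measurable_cong] = sets_R[OF \<open>t \<le> T\<close>]
  define e where "e x = overlap_deficit t x + density_gap t x" for x
  have [measurable]: "e \<in> borel_measurable (path_space t)"
    unfolding e_def by measurable
  define \<phi> where "\<phi> x = e x / G t x" for x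
  have \<phi> [measurable]: "\<phi> \<in> borel_measurable (path_space t)"
    unfolding \<phi>_def by measurable
  have e_\<phi>: "e x = G t x * \<phi> x" if x: "x \<in> space (R t)" for x
  proof (cases "G t x = 0")
    case True
    then show ?thesis
      by (simp add: e_def overlap_deficit_def overlap_density_def density_gap_def)
  next
    case False
    then show ?thesis
      using G_finite[OF \<open>t \<le> T\<close>, of x] x sets_eq_imp_space_eq[OF sets_R[OF \<open>t \<le> T\<close>]]
      by (simp add: \<phi>_def ennreal_times_divide mult.commute mult_divide_eq_ennreal)
  qed
  have hist: "history t \<in> path_space (Suc t) \<rightarrow>\<^sub>M path_space t"
    by (rule measurable_history) simp
  have h: "(\<lambda>x. \<phi> (history t x) * w' x) \<in> borel_measurable (path_space (Suc t))"
    using measurable_compose[OF hist \<phi>] by measurable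
  have "(\<integral>\<^sup>+x. w' x * overlap_deficit (Suc t) x \<partial>R (Suc t)) \<le>
      (\<integral>\<^sup>+x. e x * (\<integral>\<^sup>+v. g t (x, v) * w' (x(Suc t := v)) \<partial>r t x) \<partial>R t)"
    unfolding e_def by (rule overlap_deficit_Suc[OF t w'])
  also have "\<dots> = (\<integral>\<^sup>+x. G t x * (\<integral>\<^sup>+v. g t (x, v) * (\<phi> (history t (x(Suc t := v))) * w' (x(Suc t := v))) \<partial>r t x) \<partial>R t)"
  proof (rule nn_integral_cong)
    fix x assume xR: "x \<in> space (R t)"
    then have x: "x \<in> space (path_space t)"
      using sets_eq_imp_space_eq[OF sets_R[OF \<open>t \<le> T\<close>]] by simp
    show "e x * (\<integral>\<^sup>+v. g t (x, v) * w' (x(Suc t := v)) \<partial>r t x) =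
        G t x * (\<integral>\<^sup>+v. g t (x, v) * (\<phi> (history t (x(Suc t := v))) * w' (x(Suc t := v))) \<partial>r t x)"
    proof -
      have "(\<lambda>z. g t z * w' ((fst z)(Suc t := snd z))) \<in> borel_measurable (path_space t \<Otimes>\<^sub>M borel)"
        by measurable
      note m = measurable_r_section[OF t x this]
      have "(\<integral>\<^sup>+v. g t (x, v) * (\<phi> (history t (x(Suc t := v))) * w' (x(Suc t := v))) \<partial>r t x) =
          (\<integral>\<^sup>+v. \<phi> x * (g t (x, v) * w' (x(Suc t := v))) \<partial>r t x)"
        by (simp only: history_extend[OF x] mult_ac)
      also have "\<dots> = \<phi> x * (\<integral>\<^sup>+v. g t (x, v) * w' (x(Suc t := v)) \<partial>r t x)"
        using m by (intro nn_integral_cmult) simp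
      finally show ?thesis
        by (simp only: e_\<phi>[OF xR] mult.assoc)
    qed
  qed
  also have "\<dots> = (\<integral>\<^sup>+x. G (Suc t) x * (\<phi> (history t x) * w' x) \<partial>R (Suc t))"
    by (rule nn_integral_density_Suc(2)[OF t h, symmetric])
  also have "\<dots> \<le> C * (\<integral>\<^sup>+x. G t x * (\<phi> x * w x) \<partial>R t)"
    by (rule growth) measurable
  also have "(\<integral>\<^sup>+x. G t x * (\<phi> x * w x) \<partial>R t) = (\<integral>\<^sup>+x. w x * overlap_deficit t x + w x * density_gap t x \<partial>R t)"
  proof (rule nn_integral_cong)
    fix x assume "x \<in> space (R t)"
    then have "G t x * (\<phi> x * w x) = w x * e x"
      by (simp only: e_\<phi> mult_ac)
    then show "G t x * (\<phi> x * w x) = w x * overlap_deficit t x + w x * density_gap t x"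
      by (simp only: e_def distrib_left)
  qed
  also have "\<dots> = (\<integral>\<^sup>+x. w x * overlap_deficit t x \<partial>R t) + (\<integral>\<^sup>+x. w x * density_gap t x \<partial>R t)"
    by (rule nn_integral_add) measurable
  finally show ?thesis .
qed

text \<open>The bound solves the recursion \<open>b\<^sub>t\<^sub>+\<^sub>1 = C\<^sub>t\<^sub>+\<^sub>1 (b\<^sub>t + V)\<close> with \<open>b\<^sub>1 = 0\<close>. It starts at 0 because
  the empty pasts always agree, so that the first step coupling loses nothing.\<close>

lemma overlap_deficit_bound:
  fixes w :: "nat \<Rightarrow> 'd path \<Rightarrow> ennreal" and C :: "nat \<Rightarrow> real" and V :: ennreal
  assumes w: "\<And>t. t \<in> {1..T} \<Longrightarrow> w t \<in> borel_measurable (path_space t)"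
    and growth: "\<And>t \<phi>. t \<in> {1..<T} \<Longrightarrow> \<phi> \<in> borel_measurable (path_space t) \<Longrightarrow>
      (\<integral>\<^sup>+x. G (Suc t) x * (\<phi> (history t x) * w (Suc t) x) \<partial>R (Suc t)) \<le>
      ennreal (C (Suc t)) * (\<integral>\<^sup>+x. G t x * (\<phi> x * w t x) \<partial>R t)"
    and C: "\<And>t. t \<in> {2..T} \<Longrightarrow> 0 \<le> C t"
    and V: "\<And>t. t \<in> {1..<T} \<Longrightarrow> (\<integral>\<^sup>+x. w t x * density_gap t x \<partial>R t) \<le> V"
    and t: "t \<in> {1..T}"
  shows "(\<integral>\<^sup>+x. w t x * overlap_deficit t x \<partial>R t) \<le>
    ennreal (\<Sum>i\<in>{1..<t}. \<Prod>s\<in>{i+1..t}. C s) * V"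
proof -
  from t have "1 \<le> t" "t \<le> T" by auto
  then show ?thesis
  proof (induction t rule: dec_induct)
    case base
    then show ?case
      using overlap_deficit_1[OF _ w[of 1]] by simp
  next
    case (step t)
    then have t: "t \<in> {1..<T}" by auto
    let ?b = "\<Sum>i\<in>{1..<t}. \<Prod>s\<in>{i+1..t}. C s"
    have b: "0 \<le> ?b"
      using t by (intro sum_nonneg prod_nonneg) (auto intro!: C)
    have C': "0 \<le> C (Suc t)"
      using t by (intro C) auto
    have "(\<integral>\<^sup>+x. w (Suc t) x * overlap_deficit (Suc t) x \<partial>R (Suc t)) \<le>
      ennreal (C (Suc t)) * ((\<integral>\<^sup>+x. w t x * overlap_deficit t x \<partial>R t) + (\<integral>\<^sup>+x. w t x * density_gap t x \<partial>R t))"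
      by (rule overlap_deficit_growth[OF _ _ _ growth[OF t]]) (use t in \<open>auto intro!: w\<close>)
    also have "\<dots> \<le> ennreal (C (Suc t)) * (ennreal ?b * V + V)"
      using step.IH V[OF t] t by (intro mult_left_mono add_mono) auto
    also have "\<dots> = ennreal (C (Suc t)) * (ennreal (?b + 1) * V)"
      using b by (simp add: ennreal_plus distrib_right del: ennreal_plus_if)
    also have "\<dots> = ennreal (C (Suc t) * (?b + 1)) * V"
      using b C' by (simp add: ennreal_mult mult.assoc)
    also have "C (Suc t) * (?b + 1) = (\<Sum>i\<in>{1..<Suc t}. \<Prod>s\<in>{i+1..Suc t}. C s)"
      using t by (simp add: sum_distrib_left distrib_left mult.commute prod.nat_ivl_Suc' )
    finally show ?case .
  qed
qed

text \<open>The gap is at most \<open>\<bar>F - G\<bar>\<close>. The two signed parts are bounded by the \<open>W\<close>-masses of the first and of the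
  second path on the event that the paths differ.\<close>

lemma density_gap_le_coupling_cost:
  assumes \<pi>: "\<pi> \<in> couplings \<mu> \<nu>" and sets: "sets \<mu> = sets (path_space T)" "sets \<nu> = sets (path_space T)"
    and \<mu>: "\<mu> = density (R T) (F T)" and \<nu>: "\<nu> = density (R T) (G T)"
    and W [measurable]: "W \<in> borel_measurable (path_space T)"
    and fin: "(\<integral>\<^sup>+x. W x \<partial>\<mu>) < \<infinity>" "(\<integral>\<^sup>+x. W x \<partial>\<nu>) < \<infinity>"
    and t: "t \<le> T" and w: "w \<in> borel_measurable (path_space t)" and wW: "\<And>x. w (history t x) \<le> W x"
  shows "(\<integral>\<^sup>+x. w x * density_gap t x \<partial>R t) \<le>
    (\<integral>\<^sup>+z. (W (fst z) + W (snd z)) * indicator {z. fst z \<noteq> snd z} z \<partial>\<pi>)"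
proof -
  interpret swap: density_disintegration T R r G F g f
    by (rule swap)
  have sets_\<pi> [measurable_cong]: "sets \<pi> = sets (pair_space T)"
    using \<pi> by (simp_all add: couplings_def sets cong: sets_pair_measure_cong)
  note [measurable_cong] = sets sets_R[OF t] and [measurable] = F[OF t] G[OF t] w
  have hist [measurable]: "history t \<in> path_space T \<rightarrow>\<^sub>M path_space t"
    by (rule measurable_history[OF t])
  note \<mu>_int = nn_integral_history[OF \<mu> t] and \<nu>_int = swap.nn_integral_history[OF \<nu> t]
  have X: "(\<integral>\<^sup>+x. F t x * h x \<partial>R t) = (\<integral>\<^sup>+z. h (history t (fst z)) \<partial>\<pi>)"
    and Y: "(\<integral>\<^sup>+x. G t x * h x \<partial>R t) = (\<integral>\<^sup>+z. h (history t (snd z)) \<partial>\<pi>)"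
    if h [measurable]: "h \<in> borel_measurable (path_space t)" for h
    unfolding \<mu>_int[OF h, symmetric] \<nu>_int[OF h, symmetric]
    by (rule couplings_nn_integral[OF \<pi>, symmetric], measurable)+
  have hist': "(\<lambda>z. history t (fst z)) \<in> \<pi> \<rightarrow>\<^sub>M R t" "(\<lambda>z. history t (snd z)) \<in> \<pi> \<rightarrow>\<^sub>M R t"
    by measurable
  have finF: "(\<integral>\<^sup>+x. F t x * w x \<partial>R t) < \<infinity>" and finG: "(\<integral>\<^sup>+x. G t x * w x \<partial>R t) < \<infinity>"
    unfolding \<mu>_int[OF w, symmetric] \<nu>_int[OF w, symmetric]
    by (rule le_less_trans[OF nn_integral_mono fin(1)], rule wW) (rule le_less_trans[OF nn_integral_mono fin(2)], rule wW)
  have "(\<integral>\<^sup>+x. w x * density_gap t x \<partial>R t) \<le> (\<integral>\<^sup>+x. w x * (F t x - G t x) + w x * (G t x - F t x) \<partial>R t)"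
    by (intro nn_integral_mono) (simp add: density_gap_def distrib_left)
  also have "\<dots> = (\<integral>\<^sup>+x. w x * (F t x - G t x) \<partial>R t) + (\<integral>\<^sup>+x. w x * (G t x - F t x) \<partial>R t)"
    by (rule nn_integral_add) measurable
  also have "\<dots> \<le> (\<integral>\<^sup>+z. W (fst z) * indicator {z. fst z \<noteq> snd z} z \<partial>\<pi>) +
      (\<integral>\<^sup>+z. W (snd z) * indicator {z. fst z \<noteq> snd z} z \<partial>\<pi>)"
  proof (rule add_mono)
    show "(\<integral>\<^sup>+x. w x * (F t x - G t x) \<partial>R t) \<le> (\<integral>\<^sup>+z. W (fst z) * indicator {z. fst z \<noteq> snd z} z \<partial>\<pi>)"
      by (rule nn_integral_density_excess_le[where X="\<lambda>z. history t (fst z)" and Y="\<lambda>z. history t (snd z)"])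
        (use finG X Y wW hist' in \<open>auto simp: measurable_cong_sets[OF sets_R[OF t] refl] simp del: One_nat_def split: split_indicator\<close>)
    show "(\<integral>\<^sup>+x. w x * (G t x - F t x) \<partial>R t) \<le> (\<integral>\<^sup>+z. W (snd z) * indicator {z. fst z \<noteq> snd z} z \<partial>\<pi>)"
      by (rule nn_integral_density_excess_le[where X="\<lambda>z. history t (snd z)" and Y="\<lambda>z. history t (fst z)"])
        (use finF X Y wW hist' in \<open>auto simp: measurable_cong_sets[OF sets_R[OF t] refl] simp del: One_nat_def split: split_indicator\<close>)
  qed
  also have "\<dots> = (\<integral>\<^sup>+z. (W (fst z) + W (snd z)) * indicator {z. fst z \<noteq> snd z} z \<partial>\<pi>)"
    by (subst nn_integral_add[symmetric]) (auto simp: distrib_right)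
  finally show ?thesis .
qed

lemma coupling_cost_plus_diagonal:
  fixes \<mu> \<nu> :: "'d path measure" and W :: "'d path \<Rightarrow> ennreal"
  assumes \<pi>: "\<pi> \<in> couplings \<mu> \<nu>" and sets: "sets \<mu> = sets (path_space T)" "sets \<nu> = sets (path_space T)"
    and W [measurable]: "W \<in> borel_measurable (path_space T)"
  shows "(\<integral>\<^sup>+z. (W (fst z) + W (snd z)) * indicator {z. fst z \<noteq> snd z} z \<partial>\<pi>) +
      2 * (\<integral>\<^sup>+z. W (fst z) * indicator {z. fst z = snd z} z \<partial>\<pi>) = (\<integral>\<^sup>+x. W x \<partial>\<mu>) + (\<integral>\<^sup>+x. W x \<partial>\<nu>)"
proof -
  have sets_\<pi> [measurable_cong]: "sets \<pi> = sets (pair_space T)"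
    using \<pi> by (simp_all add: couplings_def sets cong: sets_pair_measure_cong)
  note [measurable_cong] = sets
  have "(\<integral>\<^sup>+z. (W (fst z) + W (snd z)) * indicator {z. fst z \<noteq> snd z} z \<partial>\<pi>) +
      2 * (\<integral>\<^sup>+z. W (fst z) * indicator {z. fst z = snd z} z \<partial>\<pi>) =
      (\<integral>\<^sup>+z. (W (fst z) + W (snd z)) * indicator {z. fst z \<noteq> snd z} z +
        2 * (W (fst z) * indicator {z. fst z = snd z} z) \<partial>\<pi>)"
    by (subst nn_integral_cmult[symmetric], measurable, subst nn_integral_add[symmetric]) measurable
  also have "\<dots> = (\<integral>\<^sup>+z. W (fst z) + W (snd z) \<partial>\<pi>)"
    by (intro nn_integral_cong) (auto split: split_indicator simp: mult_2)
  also have "\<dots> = (\<integral>\<^sup>+z. W (fst z) \<partial>\<pi>) + (\<integral>\<^sup>+z. W (snd z) \<partial>\<pi>)"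
    by (rule nn_integral_add) measurable
  also have "\<dots> = (\<integral>\<^sup>+x. W x \<partial>\<mu>) + (\<integral>\<^sup>+x. W x \<partial>\<nu>)"
    using couplings_nn_integral(1)[OF \<pi>, of W] couplings_nn_integral(2)[OF \<pi>, of W]
    by (simp add: measurable_cong_sets[OF sets(1) refl] measurable_cong_sets[OF sets(2) refl])
  finally show ?thesis .
qed

text \<open>On the diagonal either coordinate may be used: the law of the first one where \<open>F \<le> G\<close> and that of
  the second one elsewhere.\<close>

lemma coupling_diagonal_le_overlap:
  assumes \<pi>: "\<pi> \<in> couplings \<mu> \<nu>" and sets: "sets \<mu> = sets (path_space T)" "sets \<nu> = sets (path_space T)"
    and \<mu>: "\<mu> = density (R T) (F T)" and \<nu>: "\<nu> = density (R T) (G T)"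
    and W [measurable]: "W \<in> borel_measurable (path_space T)"
  shows "(\<integral>\<^sup>+z. W (fst z) * indicator {z. fst z = snd z} z \<partial>\<pi>) \<le> (\<integral>\<^sup>+x. W x * overlap_density T x \<partial>R T)"
proof -
  have sets_\<pi> [measurable_cong]: "sets \<pi> = sets (pair_space T)"
    using \<pi> by (simp_all add: couplings_def sets cong: sets_pair_measure_cong)
  note [measurable_cong] = sets sets_R[OF order_refl]
  have [measurable]: "F T \<in> borel_measurable (path_space T)" "G T \<in> borel_measurable (path_space T)"
    using F G by auto
  have [measurable]: "Measurable.pred (path_space T) (\<lambda>x. F T x \<le> G T x)"
    unfolding pred_def by (rule borel_measurable_le) measurable
  let ?a = "\<lambda>x. W x * of_bool (F T x \<le> G T x)" and ?b = "\<lambda>x. W x * of_bool (\<not> F T x \<le> G T x)"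
  have "(\<integral>\<^sup>+z. W (fst z) * indicator {z. fst z = snd z} z \<partial>\<pi>) \<le> (\<integral>\<^sup>+z. ?a (fst z) + ?b (snd z) \<partial>\<pi>)"
    by (intro nn_integral_mono) (auto split: split_indicator)
  also have "\<dots> = (\<integral>\<^sup>+z. ?a (fst z) \<partial>\<pi>) + (\<integral>\<^sup>+z. ?b (snd z) \<partial>\<pi>)"
    by (rule nn_integral_add) measurable
  also have "(\<integral>\<^sup>+z. ?a (fst z) \<partial>\<pi>) = (\<integral>\<^sup>+x. ?a x \<partial>\<mu>)"
    by (rule couplings_nn_integral[OF \<pi>]) measurable
  also have "\<dots> = (\<integral>\<^sup>+x. F T x * ?a x \<partial>R T)"
    unfolding \<mu> by (rule nn_integral_density) measurable
  also have "(\<integral>\<^sup>+z. ?b (snd z) \<partial>\<pi>) = (\<integral>\<^sup>+x. ?b x \<partial>\<nu>)"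
    by (rule couplings_nn_integral[OF \<pi>]) measurable
  also have "\<dots> = (\<integral>\<^sup>+x. G T x * ?b x \<partial>R T)"
    unfolding \<nu> by (rule nn_integral_density) measurable
  also have "(\<integral>\<^sup>+x. F T x * ?a x \<partial>R T) + (\<integral>\<^sup>+x. G T x * ?b x \<partial>R T) = (\<integral>\<^sup>+x. F T x * ?a x + G T x * ?b x \<partial>R T)"
    by (rule nn_integral_add[symmetric]) measurable
  also have "\<dots> = (\<integral>\<^sup>+x. W x * overlap_density T x \<partial>R T)"
    by (intro nn_integral_cong) (auto simp: overlap_density_def min_def mult.commute)
  finally show ?thesis .
qed

text \<open>Mismatch plus twice the diagonal is the same for all couplings, so the mismatches differ by
  twice the difference of the diagonals, which the overlap deficit bounds.\<close>

theorem greedy_coupling_cost_le: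
  fixes w :: "nat \<Rightarrow> 'd path \<Rightarrow> ennreal" and C :: "nat \<Rightarrow> real"
  assumes \<pi>: "\<pi> \<in> couplings \<mu> \<nu>" and sets: "sets \<mu> = sets (path_space T)" "sets \<nu> = sets (path_space T)"
    and \<mu>: "\<mu> = density (R T) (F T)" and \<nu>: "\<nu> = density (R T) (G T)" and T: "1 \<le> T"
    and w: "\<And>t. t \<in> {1..T} \<Longrightarrow> w t \<in> borel_measurable (path_space t)"
    and mono: "\<And>t x. t \<in> {1..T} \<Longrightarrow> w t (history t x) \<le> w T x"
    and fin: "(\<integral>\<^sup>+x. w T x \<partial>\<mu>) < \<infinity>" "(\<integral>\<^sup>+x. w T x \<partial>\<nu>) < \<infinity>"
    and growth: "\<And>t \<phi>. t \<in> {1..<T} \<Longrightarrow> \<phi> \<in> borel_measurable (path_space t) \<Longrightarrow>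
      (\<integral>\<^sup>+x. \<phi> (history t x) * w (Suc t) (history (Suc t) x) \<partial>\<nu>) \<le>
      ennreal (C (Suc t)) * (\<integral>\<^sup>+x. \<phi> (history t x) * w t (history t x) \<partial>\<nu>)"
    and C: "\<And>t. t \<in> {2..T} \<Longrightarrow> 0 \<le> C t"
  shows "(\<integral>\<^sup>+z. (w T (fst z) + w T (snd z)) * indicator {z. fst z \<noteq> snd z} z \<partial>greedy_coupling T) \<le>
    ennreal (1 + 2 * (\<Sum>t\<in>{1..T-1}. \<Prod>s\<in>{t+1..T}. C s)) *
      (\<integral>\<^sup>+z. (w T (fst z) + w T (snd z)) * indicator {z. fst z \<noteq> snd z} z \<partial>\<pi>)"
proof -
  interpret swap: density_disintegration T R r G F g f
    by (rule swap)
  define cost where "cost \<pi> = (\<integral>\<^sup>+z. (w T (fst z) + w T (snd z)) * indicator {z. fst z \<noteq> snd z} z \<partial>\<pi>)" for \<pi>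
  define diag where "diag \<pi> = (\<integral>\<^sup>+z. w T (fst z) * indicator {z. fst z = snd z} z \<partial>\<pi>)" for \<pi>
  have wT [measurable]: "w T \<in> borel_measurable (path_space T)"
    using T by (intro w) simp
  note [measurable_cong] = sets_R[OF order_refl]
    and [measurable] = measurable_overlap_deficit[OF order_refl] measurable_diagonal_density[OF order_refl]
  let ?b = "\<Sum>t\<in>{1..<T}. \<Prod>s\<in>{t+1..T}. C s"
  define D where "D = (\<integral>\<^sup>+x. w T x * diagonal_density T x \<partial>R T)"
  have deficit: "(\<integral>\<^sup>+x. w T x * overlap_deficit T x \<partial>R T) \<le> ennreal ?b * cost \<pi>"
  proof (rule overlap_deficit_bound[OF w _ C])
    fix t and \<phi> :: "'d path \<Rightarrow> ennreal" assume t: "t \<in> {1..<T}" and \<phi> [measurable]: "\<phi> \<in> borel_measurable (path_space t)"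
    have [measurable]: "history t \<in> path_space (Suc t) \<rightarrow>\<^sub>M path_space t"
      by (rule measurable_history) simp
    have [measurable]: "w t \<in> borel_measurable (path_space t)" "w (Suc t) \<in> borel_measurable (path_space (Suc t))"
      using t by (auto intro!: w)
    have "(\<integral>\<^sup>+x. G (Suc t) x * (\<phi> (history t x) * w (Suc t) x) \<partial>R (Suc t)) =
        (\<integral>\<^sup>+x. \<phi> (history t (history (Suc t) x)) * w (Suc t) (history (Suc t) x) \<partial>\<nu>)"
      using t by (intro swap.nn_integral_history[OF \<nu>, symmetric]) measurable
    also have "\<dots> = (\<integral>\<^sup>+x. \<phi> (history t x) * w (Suc t) (history (Suc t) x) \<partial>\<nu>)"
      by (simp only: history_history[OF le_SucI[OF order_refl]])
    also have "\<dots> \<le> ennreal (C (Suc t)) * (\<integral>\<^sup>+x. \<phi> (history t x) * w t (history t x) \<partial>\<nu>)"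
      by (rule growth[OF t \<phi>])
    also have "(\<integral>\<^sup>+x. \<phi> (history t x) * w t (history t x) \<partial>\<nu>) = (\<integral>\<^sup>+x. G t x * (\<phi> x * w t x) \<partial>R t)"
      using t by (intro swap.nn_integral_history[OF \<nu>]) measurable
    finally show "(\<integral>\<^sup>+x. G (Suc t) x * (\<phi> (history t x) * w (Suc t) x) \<partial>R (Suc t)) \<le>
        ennreal (C (Suc t)) * (\<integral>\<^sup>+x. G t x * (\<phi> x * w t x) \<partial>R t)" .
  next
    fix t assume "t \<in> {1..<T}"
    then show "(\<integral>\<^sup>+x. w t x * density_gap t x \<partial>R t) \<le> cost \<pi>"
      unfolding cost_def by (intro density_gap_le_coupling_cost[OF \<pi> sets \<mu> \<nu> wT fin] w mono) auto
  qed (use T in auto)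
  have overlap: "(\<integral>\<^sup>+x. w T x * overlap_density T x \<partial>R T) \<le>
      D + (\<integral>\<^sup>+x. w T x * overlap_deficit T x \<partial>R T)"
  proof -
    have "(\<integral>\<^sup>+x. w T x * overlap_density T x \<partial>R T) \<le>
      (\<integral>\<^sup>+x. w T x * (diagonal_density T x + overlap_deficit T x) \<partial>R T)"
      unfolding overlap_deficit_def by (intro nn_integral_mono mult_left_mono ennreal_le_add_diff) auto
    also have "\<dots> = D + (\<integral>\<^sup>+x. w T x * overlap_deficit T x \<partial>R T)"
      unfolding D_def distrib_left by (rule nn_integral_add) measurable
    finally show ?thesis .
  qed
  have D_diag: "D \<le> diag (greedy_coupling T)"
    unfolding D_def diag_def
    using diagonal_density_le_greedy_coupling[OF order_refl wT] by (simp add: mult.commute)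
  have total: "cost \<pi>' + 2 * diag \<pi>' = (\<integral>\<^sup>+x. w T x \<partial>\<mu>) + (\<integral>\<^sup>+x. w T x \<partial>\<nu>)" if "\<pi>' \<in> couplings \<mu> \<nu>" for \<pi>'
    unfolding cost_def diag_def by (rule coupling_cost_plus_diagonal[OF that sets wT])
  have greedy: "greedy_coupling T \<in> couplings \<mu> \<nu>"
    by (rule greedy_coupling_in_couplings[OF sets \<mu> \<nu>])
  \<comment> \<open>Finiteness of \<open>D\<close> allows it to be cancelled at the end.\<close>
  have "2 * D \<le> cost (greedy_coupling T) + 2 * diag (greedy_coupling T)"
    using D_diag by (intro add_increasing mult_left_mono) auto
  then have "2 * D < \<infinity>"
    unfolding total[OF greedy] using fin by (auto intro: le_less_trans)
  have b: "0 \<le> ?b"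
    by (intro sum_nonneg prod_nonneg) (auto intro!: C)
  have "2 * D + cost (greedy_coupling T) \<le> cost (greedy_coupling T) + 2 * diag (greedy_coupling T)"
    using D_diag by (subst add.commute) (intro add_mono mult_left_mono; simp)
  also have "\<dots> = cost \<pi> + 2 * diag \<pi>"
    by (simp add: total[OF greedy] total[OF \<pi>])
  also have "\<dots> \<le> cost \<pi> + 2 * (D + ennreal ?b * cost \<pi>)"
    using coupling_diagonal_le_overlap[OF \<pi> sets \<mu> \<nu> wT] overlap deficit unfolding diag_def
    by (intro add_mono mult_left_mono order_refl) (auto intro: order_trans add_left_mono)
  also have "\<dots> = 2 * D + ennreal (1 + 2 * ?b) * cost \<pi>"
    using b by (simp add: ennreal_plus ennreal_mult distrib_left distrib_right mult.assoc add_ac del: ennreal_plus_if)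
  finally have "cost (greedy_coupling T) \<le> ennreal (1 + 2 * ?b) * cost \<pi>"
    using \<open>2 * D < \<infinity>\<close> by (auto simp: ennreal_add_left_cancel_le)
  moreover have "{1..<T} = {1..T-1}"
    using T by auto
  ultimately show ?thesis
    by (simp only: cost_def)
qed

end

section \<open>Existence of a common density disintegration\<close>

lemma dominating_prob_space_exists:
  assumes \<mu>: "prob_space \<mu>" and \<nu>: "prob_space \<nu>" and sets: "sets \<mu> = sets M" "sets \<nu> = sets M"
  obtains \<rho> where "prob_space \<rho>" "sets \<rho> = sets M"
    "\<And>A. A \<in> sets M \<Longrightarrow> emeasure \<mu> A \<le> 2 * emeasure \<rho> A"
    "\<And>A. A \<in> sets M \<Longrightarrow> emeasure \<nu> A \<le> 2 * emeasure \<rho> A"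
proof
  let ?B = "measure_pmf (bernoulli_pmf (1/2))"
  define \<rho> where "\<rho> = ?B \<bind> (\<lambda>b. if b then \<mu> else \<nu>)"
  have B: "?B \<in> space (prob_algebra (count_space UNIV))"
    by (simp add: space_prob_algebra prob_space_measure_pmf)
  have k: "(\<lambda>b. if b then \<mu> else \<nu>) \<in> count_space UNIV \<rightarrow>\<^sub>M prob_algebra M"
    using \<mu> \<nu> sets by (auto simp: space_prob_algebra)
  show "prob_space \<rho>"
    unfolding \<rho>_def by (rule prob_space_bind'[OF B k])
  show "sets \<rho> = sets M"
    unfolding \<rho>_def by (rule sets_bind'[OF B k])
  have half: "2 * (inverse 2 * z) = z" for z :: ennreal
    using ennreal_divide_self[of 2] by (simp add: divide_ennreal_def mult.assoc[symmetric])
  have "2 * emeasure \<rho> A = emeasure \<mu> A + emeasure \<nu> A" if A: "A \<in> sets M" for A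
  proof -
    have "emeasure \<rho> A = inverse 2 * emeasure \<mu> A + inverse 2 * emeasure \<nu> A"
      unfolding \<rho>_def using emeasure_bind_prob_algebra[OF B k A]
      by (simp add: nn_integral_measure_pmf nn_integral_count_space_bool)
    then show ?thesis
      by (simp only: distrib_left half)
  qed
  then show "emeasure \<mu> A \<le> 2 * emeasure \<rho> A" "emeasure \<nu> A \<le> 2 * emeasure \<rho> A" if "A \<in> sets M" for A
    using that by simp_all
qed

text \<open>The Radon-Nikodym derivative is at most 2 almost everywhere and may be truncated elsewhere. The
  uniform bound is inherited by the conditional means of the density, which are therefore finite everywhere.\<close>

lemma bounded_density_exists:
  assumes P: "prob_space P" and sets: "sets Q = sets P"
    and le: "\<And>A. A \<in> sets P \<Longrightarrow> emeasure Q A \<le> 2 * emeasure P A"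
  obtains F where "F \<in> borel_measurable P" "\<And>x. F x \<le> (2 :: ennreal)" "density P F = Q"
proof
  interpret P: prob_space P by (rule P)
  let ?D = "RN_deriv P Q"
  have "absolutely_continuous P Q"
    using le by (fastforce simp: absolutely_continuous_def null_sets_def sets)
  then have D: "density P ?D = Q"
    by (rule P.density_RN_deriv[OF _ sets])
  have bound: "AE x in P. ?D x \<le> 2"
  proof (rule AE_le_if_set_integrals_le)
    fix A assume A: "A \<in> sets P"
    then have "(\<integral>\<^sup>+x. ?D x * indicator A x \<partial>P) = emeasure Q A"
      by (subst D[symmetric]) (simp add: emeasure_density)
    also have "\<dots> \<le> (\<integral>\<^sup>+x. 2 * indicator A x \<partial>P)"
      using le[OF A] A by (simp add: nn_integral_cmult_indicator)
    finally show "(\<integral>\<^sup>+x. ?D x * indicator A x \<partial>P) \<le> (\<integral>\<^sup>+x. 2 * indicator A x \<partial>P)" .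
  qed (auto simp: P.emeasure_space_1)
  show "(\<lambda>x. min 2 (?D x)) \<in> borel_measurable P" "min 2 (?D x) \<le> 2" for x
    by auto
  have "density P (\<lambda>x. min 2 (?D x)) = density P ?D"
    using bound by (intro density_cong) (auto elim!: eventually_mono simp: min_def)
  then show "density P (\<lambda>x. min 2 (?D x)) = Q"
    by (simp add: D)
qed

text \<open>Disintegrate the reference law step by step. The density of the full path is given, and
  integrating out the last step with the kernels, backwards in time, gives the densities of the histories, so
  that consecutive densities are compatible at every point.\<close>

lemma density_disintegration_exists:
  fixes \<mu> \<nu> :: "('d::finite) path measure"
  assumes \<mu>: "prob_space \<mu>" and \<nu>: "prob_space \<nu>"
    and sets: "sets \<mu> = sets (path_space T)" "sets \<nu> = sets (path_space T)"
  obtains R r F G f g where "density_disintegration T R r F G f g"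
    "\<mu> = density (R T) (F T)" "\<nu> = density (R T) (G T)"
proof -
  obtain \<rho> where \<rho>: "prob_space \<rho>" and sets_\<rho> [measurable_cong]: "sets \<rho> = sets (path_space T)"
    and dom: "\<And>A. A \<in> sets (path_space T) \<Longrightarrow> emeasure \<mu> A \<le> 2 * emeasure \<rho> A"
      "\<And>A. A \<in> sets (path_space T) \<Longrightarrow> emeasure \<nu> A \<le> 2 * emeasure \<rho> A"
    using dominating_prob_space_exists[OF \<mu> \<nu> sets] by blast
  define R where "R t = distr \<rho> (path_space t) (history t)" for t
  have hist: "history t \<in> \<rho> \<rightarrow>\<^sub>M path_space t" if "t \<le> T" for t
    using measurable_history[OF that] by (simp add: measurable_cong_sets[OF sets_\<rho> refl])
  have prob_R: "prob_space (R t)" if "t \<le> T" for t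
    unfolding R_def by (rule prob_space.prob_space_distr[OF \<rho> hist[OF that]])
  have sets_R: "sets (R t) = sets (path_space t)" for t
    by (simp add: R_def)
  have R_T: "R T = \<rho>"
  proof -
    have "distr \<rho> (path_space T) (history T) = distr \<rho> (path_space T) (\<lambda>x. x)"
      using sets_eq_imp_space_eq[OF sets_\<rho>] by (intro distr_cong refl) (simp add: history_full del: One_nat_def)
    also have "\<dots> = \<rho>"
      using sets_\<rho> by (intro distr_id2) simp
    finally show ?thesis
      by (simp only: R_def)
  qed

  have "\<forall>t. \<exists>k. t < T \<longrightarrow> step_cond_law \<rho> t k"
  proof
    fix t
    show "\<exists>k. t < T \<longrightarrow> step_cond_law \<rho> t k"
    proof (cases "t < T")
      case True
      have "(\<lambda>x. x (Suc t)) \<in> borel_measurable \<rho>"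
        using True measurable_path_coordinate[of "Suc t" T] by (simp add: measurable_cong_sets[OF sets_\<rho> refl])
      with True show ?thesis
        unfolding step_cond_law_def
        using vec_regular_cond_law_exists[OF \<rho> hist[OF less_imp_le[OF True]]] by blast
    qed auto
  qed
  then obtain r where r: "\<And>t. t < T \<Longrightarrow> step_cond_law \<rho> t (r t)"
    by metis
  have r_meas: "r t \<in> path_space t \<rightarrow>\<^sub>M prob_algebra borel" if "t < T" for t
    using r[OF that] by (simp add: step_cond_law_def regular_cond_law_def)

  have R_Suc: "(\<integral>\<^sup>+x. h x \<partial>R (Suc t)) = (\<integral>\<^sup>+x. (\<integral>\<^sup>+v. h (x(Suc t := v)) \<partial>r t x) \<partial>R t)"
    if t: "t < T" and h: "h \<in> borel_measurable (path_space (Suc t))" for t h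
  proof -
    have ext: "(\<lambda>z. h ((fst z)(Suc t := snd z))) \<in> borel_measurable (path_space t \<Otimes>\<^sub>M borel)"
      by (rule measurable_compose[OF measurable_path_extend h]) measurable
    have coord: "(\<lambda>x. x (Suc t)) \<in> borel_measurable \<rho>"
      using t measurable_path_coordinate[of "Suc t" T] by (simp add: measurable_cong_sets[OF sets_\<rho> refl])
    have hist_t: "history t \<in> \<rho> \<rightarrow>\<^sub>M path_space t" "history (Suc t) \<in> \<rho> \<rightarrow>\<^sub>M path_space (Suc t)"
      using t by (auto intro!: hist simp del: One_nat_def)
    have "(\<integral>\<^sup>+x. h x \<partial>R (Suc t)) = (\<integral>\<^sup>+x. h (history (Suc t) x) \<partial>\<rho>)"
      unfolding R_def using hist_t(2) h by (subst nn_integral_distr) simp_all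
    also have "\<dots> = (\<integral>\<^sup>+x. h ((history t x)(Suc t := x (Suc t))) \<partial>\<rho>)"
    proof (intro nn_integral_cong)
      fix x :: "'d path"
      have "history (Suc t) x = (history t x)(Suc t := x (Suc t))"
        by (auto simp: fun_eq_iff)
      then show "h (history (Suc t) x) = h ((history t x)(Suc t := x (Suc t)))"
        by simp
    qed
    also have "\<dots> = (\<integral>\<^sup>+x. (\<integral>\<^sup>+v. h ((history t x)(Suc t := v)) \<partial>r t (history t x)) \<partial>\<rho>)"
      using regular_cond_law_nn_integral[OF \<rho> hist_t(1) coord r[OF t, unfolded step_cond_law_def] ext] by simp
    also have "\<dots> = (\<integral>\<^sup>+x. (\<integral>\<^sup>+v. h (x(Suc t := v)) \<partial>r t x) \<partial>R t)"
    proof -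
      have "(\<lambda>x. \<integral>\<^sup>+v. h (x(Suc t := v)) \<partial>r t x) \<in> borel_measurable (path_space t)"
        by (rule nn_integral_measurable_subprob_algebra2[where N=borel])
          (use ext measurable_prob_algebraD[OF r_meas[OF t]] in \<open>auto simp: case_prod_beta'\<close>)
      then show ?thesis
        unfolding R_def using hist_t(1) by (subst nn_integral_distr) simp_all
    qed
    finally show ?thesis .
  qed

  define disintegrated where "disintegrated F f \<longleftrightarrow> (\<integral>\<^sup>+x. F 0 x \<partial>R 0) = 1 \<and>
      (\<forall>t\<le>T. F t \<in> borel_measurable (path_space t) \<and> (\<forall>x\<in>space (path_space t). F t x < \<infinity>)) \<and>
      (\<forall>t<T. f t \<in> borel_measurable (path_space t \<Otimes>\<^sub>M borel) \<and>
        (\<forall>x\<in>space (path_space t). (\<integral>\<^sup>+v. f t (x, v) \<partial>r t x) = 1) \<and>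
        (AE x in R t. AE v in r t x. F (Suc t) (x(Suc t := v)) = F t x * f t (x, v)))"
    for F :: "nat \<Rightarrow> 'd path \<Rightarrow> ennreal" and f
  have disintegrated_exists: "\<exists>F f. M = density (R T) (F T) \<and> disintegrated F f"
    if M: "prob_space M" "sets M = sets (path_space T)"
      "\<And>A. A \<in> sets (path_space T) \<Longrightarrow> emeasure M A \<le> 2 * emeasure \<rho> A" for M
  proof -
    obtain F\<^sub>T where F\<^sub>T: "F\<^sub>T \<in> borel_measurable \<rho>" "\<And>x. F\<^sub>T x \<le> 2" and M_eq: "density \<rho> F\<^sub>T = M"
      using bounded_density_exists[OF \<rho>, of M] M(2,3) sets_\<rho> by auto
    have "emeasure M (space \<rho>) = 1"
      using prob_space.emeasure_space_1[OF M(1)] sets_eq_imp_space_eq[of M \<rho>] M(2) sets_\<rho> by simp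
    then have mass: "(\<integral>\<^sup>+x. F\<^sub>T x \<partial>\<rho>) = 1"
      using F\<^sub>T(1) by (simp add: M_eq[symmetric] emeasure_density cong: nn_integral_cong)
    define F where "F t = rec_nat F\<^sub>T (\<lambda>n h x. \<integral>\<^sup>+v. h (x(T - n := v)) \<partial>r (T - Suc n) x) (T - t)" for t
    have F_T: "F T = F\<^sub>T"
      by (simp add: F_def)
    have F_rec: "F t x = (\<integral>\<^sup>+v. F (Suc t) (x(Suc t := v)) \<partial>r t x)" if "t < T" for t x
    proof -
      have "T - t = Suc (T - Suc t)" "T - (T - Suc t) = Suc t" "T - Suc (T - Suc t) = t"
        using that by auto
      then show ?thesis
        by (simp add: F_def)
    qed
    have F: "F t \<in> borel_measurable (path_space t) \<and> (\<forall>x\<in>space (path_space t). F t x \<le> 2) \<and> (\<integral>\<^sup>+x. F t x \<partial>R t) = 1" if "t \<le> T" for t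
      using that
    proof (induction t rule: inc_induct)
      case base
      then show ?case
        using F\<^sub>T mass by (simp add: F_T R_T measurable_cong_sets[OF sets_\<rho> refl])
    next
      case (step t)
      then have t: "t < T" and F: "F (Suc t) \<in> borel_measurable (path_space (Suc t))" by auto
      have "F t \<in> borel_measurable (path_space t)"
        unfolding F_rec[OF t, abs_def]
        by (rule nn_integral_measurable_subprob_algebra2[where N=borel])
          (use measurable_compose[OF measurable_path_extend F] measurable_prob_algebraD[OF r_meas[OF t]] in \<open>auto simp: case_prod_beta'\<close>)
      moreover have "F t x \<le> 2" if x: "x \<in> space (path_space t)" for x
      proof -
        interpret prob_space "r t x"
          using measurable_space[OF r_meas[OF t] x] by (simp add: space_prob_algebra)
        have "x(Suc t := v) \<in> space (path_space (Suc t))" for v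
          using x by (auto simp: in_space_path_space extensional_def)
        then have "F t x \<le> (\<integral>\<^sup>+v. 2 \<partial>r t x)"
          unfolding F_rec[OF t] using step.IH by (intro nn_integral_mono) auto
        then show ?thesis
          by (simp add: emeasure_space_1)
      qed
      moreover have "(\<integral>\<^sup>+x. F t x \<partial>R t) = 1"
        using R_Suc[OF t F] step.IH by (simp add: F_rec[OF t])
      ultimately show ?case by blast
    qed
    have "\<exists>f. f \<in> borel_measurable (path_space t \<Otimes>\<^sub>M borel) \<and>
        (\<forall>x\<in>space (path_space t). (\<integral>\<^sup>+v. f (x, v) \<partial>r t x) = 1) \<and>
        (AE x in R t. AE v in r t x. F (Suc t) (x(Suc t := v)) = F t x * f (x, v))" if t: "t < T" for t
    proof -
      have F_t: "F t \<in> borel_measurable (path_space t)" "F (Suc t) \<in> borel_measurable (path_space (Suc t))"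
        using F[of t] F[of "Suc t"] t by simp_all
      have ext: "(\<lambda>z. F (Suc t) ((fst z)(Suc t := snd z))) \<in> borel_measurable (path_space t \<Otimes>\<^sub>M borel)"
        by (rule measurable_compose[OF measurable_path_extend F_t(2)]) measurable
      have fin: "AE x in R t. F t x < \<infinity>"
        using F[of t] t sets_eq_imp_space_eq[OF sets_R[of t]] by (intro AE_I2) (auto intro: le_less_trans[of _ 2])
      have int: "AE x in R t. (\<integral>\<^sup>+v. F (Suc t) ((fst (x, v))(Suc t := snd (x, v))) \<partial>r t x) = F t x"
        by (simp add: F_rec[OF t])
      obtain f where "f \<in> borel_measurable (path_space t \<Otimes>\<^sub>M borel)"
        "\<And>x. x \<in> space (path_space t) \<Longrightarrow> (\<integral>\<^sup>+v. f (x, v) \<partial>r t x) = 1"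
        "AE x in R t. AE v in r t x. F (Suc t) ((fst (x, v))(Suc t := snd (x, v))) = F t x * f (x, v)"
        using conditional_density_exists[OF sets_R r_meas[OF t] F_t(1) ext int fin] by blast
      then show ?thesis
        by (intro exI[of _ f]) simp
    qed
    then have "\<forall>t. \<exists>f. t < T \<longrightarrow> f \<in> borel_measurable (path_space t \<Otimes>\<^sub>M borel) \<and>
        (\<forall>x\<in>space (path_space t). (\<integral>\<^sup>+v. f (x, v) \<partial>r t x) = 1) \<and>
        (AE x in R t. AE v in r t x. F (Suc t) (x(Suc t := v)) = F t x * f (x, v))"
      by blast
    from choice[OF this] obtain f where "\<forall>t<T. f t \<in> borel_measurable (path_space t \<Otimes>\<^sub>M borel) \<and>
        (\<forall>x\<in>space (path_space t). (\<integral>\<^sup>+v. f t (x, v) \<partial>r t x) = 1) \<and>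
        (AE x in R t. AE v in r t x. F (Suc t) (x(Suc t := v)) = F t x * f t (x, v))"
      by blast
    then have "disintegrated F f"
      unfolding disintegrated_def using F by (auto intro: le_less_trans[of _ 2])
    then show ?thesis
      using M_eq by (intro exI[of _ F] exI[of _ f]) (simp add: F_T R_T)
  qed
  obtain F f where F: "\<mu> = density (R T) (F T)" "disintegrated F f"
    using disintegrated_exists[OF \<mu> sets(1) dom(1)] by blast
  obtain G g where G: "\<nu> = density (R T) (G T)" "disintegrated G g"
    using disintegrated_exists[OF \<nu> sets(2) dom(2)] by blast
  have "density_disintegration T R r F G f g"
  proof (rule density_disintegration.intro)
    show "(\<integral>\<^sup>+x. h x \<partial>R (Suc t)) = (\<integral>\<^sup>+x. (\<integral>\<^sup>+v. h (x(Suc t := v)) \<partial>r t x) \<partial>R t)"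
      if "t < T" "h \<in> borel_measurable (path_space (Suc t))" for t h
      by (rule R_Suc[OF that])
  qed (use F(2) G(2) in \<open>simp_all add: prob_R sets_R r_meas disintegrated_def\<close>)
  then show ?thesis
    using F(1) G(1) by (rule that)
qed

section \<open>The moment weights and the final estimates\<close>

text \<open>A single coupling is compared with all competitors, so that the bound passes to the infimum
  over the latter.\<close>

theorem bicausal_coupling_exists:
  fixes \<mu> \<nu> :: "('d::finite) path measure" and w :: "nat \<Rightarrow> 'd path \<Rightarrow> real" and C :: "nat \<Rightarrow> real"
  assumes \<mu>: "prob_space \<mu>" and \<nu>: "prob_space \<nu>"
    and sets: "sets \<mu> = sets (path_space T)" "sets \<nu> = sets (path_space T)" and T: "1 \<le> T"
    and w: "\<And>t. t \<in> {1..T} \<Longrightarrow> w t \<in> borel_measurable (path_space t)"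
    and nonneg: "\<And>x. 0 \<le> w T x"
    and mono: "\<And>t x. t \<in> {1..T} \<Longrightarrow> w t (history t x) \<le> w T x"
    and fin: "(\<integral>\<^sup>+x. ennreal (w T x) \<partial>\<mu>) < \<infinity>" "(\<integral>\<^sup>+x. ennreal (w T x) \<partial>\<nu>) < \<infinity>"
    and growth: "\<And>t \<phi>. t \<in> {1..<T} \<Longrightarrow> \<phi> \<in> borel_measurable (path_space t) \<Longrightarrow>
      (\<integral>\<^sup>+x. \<phi> (history t x) * ennreal (w (Suc t) (history (Suc t) x)) \<partial>\<nu>) \<le>
      ennreal (C (Suc t)) * (\<integral>\<^sup>+x. \<phi> (history t x) * ennreal (w t (history t x)) \<partial>\<nu>)"
    and C: "\<And>t. t \<in> {2..T} \<Longrightarrow> 0 \<le> C t"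
  obtains \<pi> where "\<pi> \<in> bicausal_couplings T \<mu> \<nu>"
    "\<And>\<pi>'. \<pi>' \<in> couplings \<mu> \<nu> \<Longrightarrow> weighted_mismatch (w T) \<pi> \<le>
      ennreal (1 + 2 * (\<Sum>t\<in>{1..T-1}. \<Prod>s\<in>{t+1..T}. C s)) * weighted_mismatch (w T) \<pi>'"
proof -
  obtain R r F G f g where D: "density_disintegration T R r F G f g"
    and \<mu>_eq: "\<mu> = density (R T) (F T)" and \<nu>_eq: "\<nu> = density (R T) (G T)"
    by (rule density_disintegration_exists[OF \<mu> \<nu> sets])
  interpret density_disintegration T R r F G f g by (rule D)
  have mismatch: "weighted_mismatch (w T) \<pi> =
      (\<integral>\<^sup>+z. (ennreal (w T (fst z)) + ennreal (w T (snd z))) * indicator {z. fst z \<noteq> snd z} z \<partial>\<pi>)" for \<pi>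
    unfolding weighted_mismatch_def case_prod_beta'
    by (simp add: nonneg indicator_def)
  show ?thesis
  proof (rule that)
    show "greedy_coupling T \<in> bicausal_couplings T \<mu> \<nu>"
      by (rule greedy_coupling_bicausal[OF sets \<mu>_eq \<nu>_eq T])
    show "weighted_mismatch (w T) (greedy_coupling T) \<le>
      ennreal (1 + 2 * (\<Sum>t\<in>{1..T-1}. \<Prod>s\<in>{t+1..T}. C s)) * weighted_mismatch (w T) \<pi>'"
      if "\<pi>' \<in> couplings \<mu> \<nu>" for \<pi>'
      unfolding mismatch
      by (rule greedy_coupling_cost_le[OF that sets \<mu>_eq \<nu>_eq T, where w="\<lambda>t x. ennreal (w t x)"])
        (use w mono fin growth C in \<open>auto intro!: ennreal_leI simp del: One_nat_def\<close>)
  qed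
qed

lemma lp_pow_nonneg: "0 \<le> lp_pow p v"
  by (simp add: lp_pow_def sum_nonneg)

lemma path_lp_pow_nonneg: "0 \<le> path_lp_pow p t x"
  by (simp add: path_lp_pow_def sum_nonneg lp_pow_nonneg)

lemma measurable_lp_pow [measurable]: "lp_pow p \<in> borel_measurable borel"
  unfolding lp_pow_def by measurable

lemma measurable_path_lp_pow: "path_lp_pow p t \<in> borel_measurable (path_space t)"
  unfolding path_lp_pow_def
  by (intro borel_measurable_sum measurable_compose[OF measurable_path_coordinate measurable_lp_pow])

lemma path_lp_pow_history: "path_lp_pow p t (history t x) = path_lp_pow p t x"
  by (simp add: path_lp_pow_def)

lemma path_lp_pow_Suc: "path_lp_pow p (Suc t) x = path_lp_pow p t x + lp_pow p (x (Suc t))"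
  by (simp add: path_lp_pow_def)

lemma path_lp_pow_mono: "s \<le> t \<Longrightarrow> path_lp_pow p s x \<le> path_lp_pow p t x"
  unfolding path_lp_pow_def by (intro sum_mono2) (auto simp: lp_pow_nonneg)

text \<open>Testing the conditional expectation with functions of the history turns the essential bound on
  it into a bound on integrals. The bound also forces \<open>c\<close> to be nonnegative, since the conditional
  expectation is.\<close>

lemma growth_const_bound:
  fixes \<nu> :: "('d::finite) path measure"
  assumes \<nu>: "\<nu> \<in> finite_moment_measures p T" and t: "t \<in> {1..<T}" and c: "growth_const p \<nu> (Suc t) = ereal c"
  shows "0 \<le> c"
    and "\<And>\<phi>. \<phi> \<in> borel_measurable (path_space t) \<Longrightarrow>
      (\<integral>\<^sup>+x. \<phi> (history t x) * ennreal (lp_pow p (x (Suc t))) \<partial>\<nu>) \<le>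
      ennreal c * (\<integral>\<^sup>+x. \<phi> (history t x) * ennreal (1 + path_lp_pow p t x) \<partial>\<nu>)"
proof -
  interpret \<nu>: prob_space \<nu>
    using \<nu> by (simp add: finite_moment_measures_def)
  have sets [measurable_cong]: "sets \<nu> = sets (path_space T)" and int: "integrable \<nu> (path_lp_pow p T)"
    using \<nu> by (simp_all add: finite_moment_measures_def)
  let ?H = "history_algebra \<nu> t"
  have hist: "history t \<in> \<nu> \<rightarrow>\<^sub>M path_space t"
    using measurable_history[of t T] t by (simp add: measurable_cong_sets[OF sets refl])
  have hist_H: "history t \<in> ?H \<rightarrow>\<^sub>M path_space t"
    unfolding history_algebra_def using measurable_space[OF hist] by (intro measurable_vimage_algebra1) auto
  have sub: "subalgebra \<nu> ?H"
    unfolding subalgebra_def history_algebra_def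
    using measurable_sets[OF hist] by (auto simp: sets_vimage_algebra2[OF measurable_space[OF hist, THEN funcsetI, simplified]] Pi_iff measurable_space[OF hist])
  interpret finite_measure_subalgebra \<nu> ?H
    by unfold_locales (rule sub)
  have coord: "(\<lambda>x. x (Suc t)) \<in> borel_measurable \<nu>"
    using measurable_path_coordinate[of "Suc t" T] t by (simp add: measurable_cong_sets[OF sets refl])
  define X where "X x = ennreal (lp_pow p (x (Suc t)))" for x :: "'d path"
  define E where "E = nn_cond_exp \<nu> ?H X"
  have X [measurable]: "X \<in> borel_measurable \<nu>"
    unfolding X_def using measurable_compose[OF coord measurable_lp_pow] by measurable
  have E_int: "(\<integral>\<^sup>+x. k x * E x \<partial>\<nu>) = (\<integral>\<^sup>+x. k x * X x \<partial>\<nu>)" if "k \<in> borel_measurable ?H" for k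
    unfolding E_def by (rule nn_cond_exp_intg[OF that X])
  have "(\<integral>\<^sup>+x. X x \<partial>\<nu>) \<le> (\<integral>\<^sup>+x. ennreal (path_lp_pow p T x) \<partial>\<nu>)"
  proof (intro nn_integral_mono)
    fix x :: "'d path"
    have "lp_pow p (x (Suc t)) \<le> path_lp_pow p (Suc t) x"
      by (simp add: path_lp_pow_Suc path_lp_pow_nonneg)
    also have "\<dots> \<le> path_lp_pow p T x"
      using t by (intro path_lp_pow_mono) simp
    finally show "X x \<le> ennreal (path_lp_pow p T x)"
      unfolding X_def by (rule ennreal_leI)
  qed
  also have "\<dots> < \<infinity>"
    using int by (simp add: nn_integral_eq_integral path_lp_pow_nonneg)
  finally have "(\<integral>\<^sup>+x. E x \<partial>\<nu>) < \<infinity>"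
    using E_int[of "\<lambda>_. 1"] by simp
  moreover have E_meas [measurable]: "E \<in> borel_measurable \<nu>"
    unfolding E_def by simp
  ultimately have E_fin: "AE x in \<nu>. E x \<noteq> \<infinity>"
    by (intro nn_integral_PInf_AE) auto
  have zero: "AE x in \<nu>. nn_cond_exp \<nu> ?H (\<lambda>x. ennreal (- lp_pow p (x (Suc t)))) x = 0"
  proof -
    \<comment> \<open>The real conditional expectation is defined as a difference of two extended ones; the
      subtracted one conditions the negative part, which is 0 here.\<close>
    have neg: "(\<lambda>x :: 'd path. ennreal (- lp_pow p (x (Suc t)))) = (\<lambda>_. 0)"
      by (simp add: fun_eq_iff ennreal_neg lp_pow_nonneg)
    have "AE x in \<nu>. 0 = nn_cond_exp \<nu> ?H (\<lambda>_. 0) x"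
      by (rule nn_cond_exp_F_meas) simp
    then show ?thesis
      unfolding neg by eventually_elim simp
  qed
  have bound: "AE x in \<nu>. real_cond_exp \<nu> ?H (\<lambda>x. lp_pow p (x (Suc t))) x / (1 + path_lp_pow p t x) \<le> c"
    using esssup_AE[where M=\<nu> and f="\<lambda>x. ereal (real_cond_exp \<nu> ?H (\<lambda>x. lp_pow p (x (Suc t))) x / (1 + path_lp_pow p t x))"] c
    by (simp add: growth_const_def)
  have pos: "0 < 1 + path_lp_pow p t x" for x :: "'d path"
    using path_lp_pow_nonneg[of p t x] by simp
  have le: "AE x in \<nu>. 0 \<le> c \<and> E x \<le> ennreal (c * (1 + path_lp_pow p t x))"
    using E_fin zero bound
  proof eventually_elim
    case (elim x)
    have "real_cond_exp \<nu> ?H (\<lambda>x. lp_pow p (x (Suc t))) x = enn2real (E x)"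
      using elim(2) by (simp add: real_cond_exp_def E_def X_def[abs_def])
    with elim(3) pos[of x] have *: "enn2real (E x) \<le> c * (1 + path_lp_pow p t x)"
      by (simp add: divide_le_eq)
    then have "0 \<le> c * (1 + path_lp_pow p t x)"
      using enn2real_nonneg order_trans by blast
    then have "0 \<le> c"
      using pos[of x] by (simp add: zero_le_mult_iff)
    moreover have "E x = ennreal (enn2real (E x))"
      using elim(1) by (simp add: less_top)
    ultimately show ?case
      using * by (metis ennreal_leI)
  qed
  show c_nonneg: "0 \<le> c"
    using le by (auto dest: \<nu>.AE_contr)
  fix \<phi> :: "'d path \<Rightarrow> ennreal" assume \<phi>: "\<phi> \<in> borel_measurable (path_space t)"
  have \<phi>_H: "(\<lambda>x. \<phi> (history t x)) \<in> borel_measurable ?H"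
    by (rule measurable_compose[OF hist_H \<phi>])
  have [measurable]: "(\<lambda>x. \<phi> (history t x)) \<in> borel_measurable \<nu>"
    by (rule measurable_compose[OF hist \<phi>])
  have [measurable]: "path_lp_pow p t \<in> borel_measurable \<nu>"
    using measurable_compose[OF hist measurable_path_lp_pow[of p t]] by (simp only: path_lp_pow_history)
  have "(\<integral>\<^sup>+x. \<phi> (history t x) * X x \<partial>\<nu>) = (\<integral>\<^sup>+x. \<phi> (history t x) * E x \<partial>\<nu>)"
    by (rule E_int[OF \<phi>_H, symmetric])
  also have "\<dots> \<le> (\<integral>\<^sup>+x. ennreal c * (\<phi> (history t x) * ennreal (1 + path_lp_pow p t x)) \<partial>\<nu>)"
  proof (rule nn_integral_mono_AE)
    show "AE x in \<nu>. \<phi> (history t x) * E x \<le> ennreal c * (\<phi> (history t x) * ennreal (1 + path_lp_pow p t x))"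
      using le
    proof eventually_elim
      case (elim x)
      then have "E x \<le> ennreal c * ennreal (1 + path_lp_pow p t x)"
        using ennreal_mult[of c "1 + path_lp_pow p t x"] pos[of x] by auto
      then have "\<phi> (history t x) * E x \<le> \<phi> (history t x) * (ennreal c * ennreal (1 + path_lp_pow p t x))"
        by (rule mult_left_mono) simp
      then show ?case
        by (simp only: mult_ac)
    qed
  qed
  also have "\<dots> = ennreal c * (\<integral>\<^sup>+x. \<phi> (history t x) * ennreal (1 + path_lp_pow p t x) \<partial>\<nu>)"
    by (rule nn_integral_cmult) measurable
  finally show "(\<integral>\<^sup>+x. \<phi> (history t x) * ennreal (lp_pow p (x (Suc t))) \<partial>\<nu>) \<le>
      ennreal c * (\<integral>\<^sup>+x. \<phi> (history t x) * ennreal (1 + path_lp_pow p t x) \<partial>\<nu>)"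
    by (simp only: X_def)
qed

text \<open>For \<open>c = 0\<close> and empty \<open>A\<close> the right side would be \<open>0 * \<infinity> = 0\<close>.\<close>

lemma le_cmult_INF_ennreal:
  fixes f :: "'a \<Rightarrow> ennreal"
  assumes "A \<noteq> {}" and le: "\<And>a. a \<in> A \<Longrightarrow> x \<le> ennreal c * f a"
  shows "x \<le> ennreal c * (INF a\<in>A. f a)"
proof (cases "c \<le> 0")
  case True
  then show ?thesis
    using assms by (auto simp: ennreal_neg)
next
  case False
  have c: "ennreal (1 / c) * (ennreal c * y) = y" "ennreal c * (ennreal (1 / c) * y) = y" for y
    using False by (simp_all add: mult.assoc[symmetric] ennreal_mult[symmetric])
  have "ennreal (1 / c) * x \<le> (INF a\<in>A. f a)"
  proof (rule INF_greatest)
    fix a assume "a \<in> A"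
    then have "ennreal (1 / c) * x \<le> ennreal (1 / c) * (ennreal c * f a)"
      by (intro mult_left_mono le) auto
    then show "ennreal (1 / c) * x \<le> f a"
      by (simp only: c)
  qed
  then have "ennreal c * (ennreal (1 / c) * x) \<le> ennreal c * (INF a\<in>A. f a)"
    by (rule mult_left_mono) simp
  then show ?thesis
    by (simp only: c)
qed

lemma lp_pow_diff_le:
  assumes p: "1 \<le> p"
  shows "lp_pow p (u - v) \<le> 2 powr p * (lp_pow p u + lp_pow p v)"
proof -
  have "\<bar>a - b\<bar> powr p \<le> 2 powr p * (\<bar>a\<bar> powr p + \<bar>b\<bar> powr p)" for a b :: real
  proof -
    have "\<bar>a - b\<bar> powr p \<le> (2 * max \<bar>a\<bar> \<bar>b\<bar>) powr p"
      using p by (intro powr_mono2) auto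
    also have "\<dots> = 2 powr p * (max \<bar>a\<bar> \<bar>b\<bar> powr p)"
      by (simp add: powr_mult)
    also have "\<dots> \<le> 2 powr p * (\<bar>a\<bar> powr p + \<bar>b\<bar> powr p)"
      by (intro mult_left_mono) (auto simp: max_def)
    finally show ?thesis .
  qed
  then show ?thesis
    by (simp add: lp_pow_def sum_distrib_left sum.distrib[symmetric] sum_mono)
qed

lemma path_lp_pow_diff_le:
  assumes p: "1 \<le> p"
  shows "path_lp_pow p T (\<lambda>t. x t - y t) \<le> 2 powr p * (path_lp_pow p T x + path_lp_pow p T y)"
  unfolding path_lp_pow_def sum_distrib_left sum.distrib[symmetric]
  by (intro sum_mono lp_pow_diff_le[OF p])

lemma path_lp_pow_zero: "path_lp_pow p T (\<lambda>t. 0) = 0"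
  by (simp add: path_lp_pow_def lp_pow_def)

text \<open>On the diagonal both integrands vanish.\<close>

lemma coupling_cost_le_mismatch:
  fixes w :: "('d::finite) path \<Rightarrow> real"
  assumes a: "0 \<le> a"
    and le: "AE (x, y) in \<pi>. x \<noteq> y \<longrightarrow> path_lp_pow p T (\<lambda>t. x t - y t) \<le> a * (w x + w y)"
    and meas: "(\<lambda>(x, y). ennreal (w x + w y) * indicator {(x, y). x \<noteq> y} (x, y)) \<in> borel_measurable \<pi>"
  shows "(\<integral>\<^sup>+(x, y). ennreal (path_lp_pow p T (\<lambda>t. x t - y t)) \<partial>\<pi>) \<le> ennreal a * weighted_mismatch w \<pi>"
proof -
  have "(\<integral>\<^sup>+(x, y). ennreal (path_lp_pow p T (\<lambda>t. x t - y t)) \<partial>\<pi>) \<le>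
      (\<integral>\<^sup>+z. ennreal a * (case z of (x, y) \<Rightarrow> ennreal (w x + w y) * indicator {(x, y). x \<noteq> y} (x, y)) \<partial>\<pi>)"
  proof (rule nn_integral_mono_AE)
    show "AE z in \<pi>. (case z of (x, y) \<Rightarrow> ennreal (path_lp_pow p T (\<lambda>t. x t - y t))) \<le>
        ennreal a * (case z of (x, y) \<Rightarrow> ennreal (w x + w y) * indicator {(x, y). x \<noteq> y} (x, y))"
      using le
    proof eventually_elim
      case (elim z)
      obtain x y where z: "z = (x, y)" by (cases z)
      show ?case
      proof (cases "x = y")
        case True
        then show ?thesis
          by (simp add: z path_lp_pow_zero)
      next
        case False
        then have "ennreal (path_lp_pow p T (\<lambda>t. x t - y t)) \<le> ennreal (a * (w x + w y))"
          using elim by (intro ennreal_leI) (simp add: z)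
        then show ?thesis
          using False a by (simp add: z ennreal_mult')
      qed
    qed
  qed
  also have "\<dots> = ennreal a * weighted_mismatch w \<pi>"
    unfolding weighted_mismatch_def by (rule nn_integral_cmult[OF meas])
  finally show ?thesis .
qed

lemma measurable_mismatch_integrand:
  fixes \<pi> :: "(('d::finite) path \<times> 'd path) measure"
  assumes \<pi>: "\<pi> \<in> couplings \<mu> \<nu>" and sets: "sets \<mu> = sets (path_space T)" "sets \<nu> = sets (path_space T)"
    and [measurable]: "w \<in> borel_measurable (path_space T)"
  shows "(\<lambda>(x, y). ennreal (w x + w y) * indicator {(x, y). x \<noteq> y} (x, y)) \<in> borel_measurable \<pi>"
proof -
  have [measurable_cong]: "sets \<pi> = sets (path_space T \<Otimes>\<^sub>M path_space T)"
    using \<pi> by (simp add: couplings_def sets cong: sets_pair_measure_cong)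
  have "(\<lambda>z. ennreal (w (fst z) + w (snd z)) * of_bool (fst z \<noteq> snd z)) \<in> borel_measurable \<pi>"
    by measurable
  then show ?thesis
    by (simp add: case_prod_beta' indicator_def of_bool_def)
qed

lemma couplings_AE:
  assumes \<pi>: "\<pi> \<in> couplings \<mu> \<nu>" and x: "AE x in \<mu>. P x" and y: "AE y in \<nu>. Q y"
  shows "AE (x, y) in \<pi>. P x \<and> Q y"
proof -
  have [measurable_cong]: "sets \<pi> = sets (\<mu> \<Otimes>\<^sub>M \<nu>)" and fst: "distr \<pi> \<mu> fst = \<mu>" and snd: "distr \<pi> \<nu> snd = \<nu>"
    using \<pi> by (auto simp: couplings_def)
  have "AE x in distr \<pi> \<mu> fst. P x" "AE y in distr \<pi> \<nu> snd. Q y"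
    unfolding fst snd by (rule x, rule y)
  then have "AE z in \<pi>. P (fst z)" "AE z in \<pi>. Q (snd z)"
    by (auto intro!: AE_distrD[where M'=\<mu>] AE_distrD[where M'=\<nu>])
  then show ?thesis
    by eventually_elim auto
qed

lemma path_lp_pow_diff_le_diam:
  assumes p: "1 \<le> p" and K: "path_diam p T K < \<infinity>" and x: "x \<in> K" "y \<in> K"
  shows "path_lp_pow p T (\<lambda>t. x t - y t) \<le> enn2real (path_diam p T K) powr p"
proof -
  have "ennreal (path_lp_dist p T x y) \<le> path_diam p T K"
    unfolding path_diam_def using x by (auto intro: SUP_upper2)
  moreover have nonneg: "0 \<le> path_lp_dist p T x y"
    by (simp add: path_lp_dist_def)
  ultimately have "path_lp_dist p T x y \<le> enn2real (path_diam p T K)"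
    using K by (metis enn2real_ennreal enn2real_mono infinity_ennreal_def)
  then have "path_lp_dist p T x y powr p \<le> enn2real (path_diam p T K) powr p"
    using p nonneg by (intro powr_mono2) auto
  moreover have "path_lp_dist p T x y powr p = path_lp_pow p T (\<lambda>t. x t - y t)"
    using p path_lp_pow_nonneg[of p T "\<lambda>t. x t - y t"]
    by (cases "path_lp_pow p T (\<lambda>t. x t - y t) = 0") (simp_all add: path_lp_dist_def powr_powr)
  ultimately show ?thesis by simp
qed

lemma ATV_le_TV:
  assumes "\<pi> \<in> bicausal_couplings T \<mu> \<nu>"
    and le: "\<And>\<pi>'. \<pi>' \<in> couplings \<mu> \<nu> \<Longrightarrow> weighted_mismatch w \<pi> \<le> ennreal c * weighted_mismatch w \<pi>'"
  shows "ATV_w T w \<mu> \<nu> \<le> ennreal c * TV_w w \<mu> \<nu>"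
proof -
  have "ATV_w T w \<mu> \<nu> \<le> weighted_mismatch w \<pi>"
    unfolding ATV_w_def by (rule INF_lower) fact
  also have "\<dots> \<le> ennreal c * TV_w w \<mu> \<nu>"
    unfolding TV_w_def using assms(1) by (intro le_cmult_INF_ennreal le) (auto simp: bicausal_couplings_def)
  finally show ?thesis .
qed

lemma AW_pow_le_ATV:
  fixes \<mu> \<nu> :: "('d::finite) path measure"
  assumes sets: "sets \<mu> = sets (path_space T)" "sets \<nu> = sets (path_space T)" and a: "0 \<le> a"
    and w: "w \<in> borel_measurable (path_space T)"
    and ne: "bicausal_couplings T \<mu> \<nu> \<noteq> {}"
    and le: "\<And>\<pi>. \<pi> \<in> couplings \<mu> \<nu> \<Longrightarrow> AE (x, y) in \<pi>. x \<noteq> y \<longrightarrow> path_lp_pow p T (\<lambda>t. x t - y t) \<le> a * (w x + w y)"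
  shows "AW_pow p T \<mu> \<nu> \<le> ennreal a * ATV_w T w \<mu> \<nu>"
  unfolding ATV_w_def
proof (rule le_cmult_INF_ennreal[OF ne])
  fix \<pi> assume \<pi>: "\<pi> \<in> bicausal_couplings T \<mu> \<nu>"
  then have \<pi>': "\<pi> \<in> couplings \<mu> \<nu>"
    by (simp add: bicausal_couplings_def)
  have "AW_pow p T \<mu> \<nu> \<le> (\<integral>\<^sup>+(x, y). ennreal (path_lp_pow p T (\<lambda>t. x t - y t)) \<partial>\<pi>)"
    unfolding AW_pow_def by (rule INF_lower[OF \<pi>])
  also have "\<dots> \<le> ennreal a * weighted_mismatch w \<pi>"
    by (rule coupling_cost_le_mismatch[OF a le[OF \<pi>'] measurable_mismatch_integrand[OF \<pi>' sets w]])
  finally show "AW_pow p T \<mu> \<nu> \<le> ennreal a * weighted_mismatch w \<pi>" .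
qed

theorem corollary2p7:
  fixes p :: real and T :: nat
    and \<mu> \<nu> :: "('d::finite) path measure"
    and c :: "nat \<Rightarrow> real"
  assumes "T \<ge> 1" and "p \<ge> 1"
    and "\<mu> \<in> finite_moment_measures p T" and "\<nu> \<in> finite_moment_measures p T"
    and "\<forall>t\<in>{2..T}. growth_const p \<nu> t = ereal (c t)"
  shows
    "AW_pow p T \<mu> \<nu> \<le> ennreal (2 powr p) * ATV_pow p T \<mu> \<nu> \<and>
     ennreal (2 powr p) * ATV_pow p T \<mu> \<nu>
       \<le> ennreal (2 powr p * (1 + 2 * (\<Sum>t\<in>{1..T-1}. \<Prod>s\<in>{t+1..T}. (1 + c s)))) * TV_pow p T \<mu> \<nu> \<and>
     (\<forall>K\<in>sets (path_space T).
        (AE x in \<mu>. x \<in> K) \<longrightarrow> (AE x in \<nu>. x \<in> K) \<longrightarrow> path_diam p T K < \<infinity> \<longrightarrow>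
        AW_pow p T \<mu> \<nu> \<le> ennreal (enn2real (path_diam p T K) powr p) * ATV T \<mu> \<nu> \<and>
        ennreal (enn2real (path_diam p T K) powr p) * ATV T \<mu> \<nu>
          \<le> ennreal ((2 * real T - 1) * enn2real (path_diam p T K) powr p) * TV \<mu> \<nu>)"
proof -
  have \<mu>: "prob_space \<mu>" and \<nu>: "prob_space \<nu>"
    and sets: "sets \<mu> = sets (path_space T)" "sets \<nu> = sets (path_space T)"
    and int: "integrable \<mu> (path_lp_pow p T)" "integrable \<nu> (path_lp_pow p T)"
    using assms(3,4) by (auto simp: finite_moment_measures_def)
  interpret \<mu>: prob_space \<mu> by (rule \<mu>)
  interpret \<nu>: prob_space \<nu> by (rule \<nu>)
  have c_Suc: "growth_const p \<nu> (Suc t) = ereal (c (Suc t))" if "t \<in> {1..<T}" for t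
    using assms(5) that by auto
  have c: "0 \<le> c t" if "t \<in> {2..T}" for t
    using growth_const_bound(1)[OF assms(4) _ c_Suc, of "t - 1"] that by (cases t) auto
  define w where "w t x = 1 + path_lp_pow p t x" for t and x :: "'d path"
  have w_meas: "w t \<in> borel_measurable (path_space t)" for t
    unfolding w_def using measurable_path_lp_pow[of p t] by measurable
  have fin: "(\<integral>\<^sup>+x. ennreal (w T x) \<partial>M) < \<infinity>" if "prob_space M" "integrable M (path_lp_pow p T)" for M
  proof -
    interpret prob_space M by (rule that(1))
    have "integrable M (w T)"
      unfolding w_def using that(2) by simp
    then have "(\<integral>\<^sup>+x. ennreal (w T x) \<partial>M) = ennreal (\<integral>x. w T x \<partial>M)"
      by (rule nn_integral_eq_integral) (simp add: w_def path_lp_pow_nonneg)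
    then show ?thesis
      by simp
  qed
  obtain \<pi> where \<pi>: "\<pi> \<in> bicausal_couplings T \<mu> \<nu>"
    and \<pi>_le: "\<And>\<pi>'. \<pi>' \<in> couplings \<mu> \<nu> \<Longrightarrow> weighted_mismatch (w T) \<pi> \<le>
      ennreal (1 + 2 * (\<Sum>t\<in>{1..T-1}. \<Prod>s\<in>{t+1..T}. (1 + c s))) * weighted_mismatch (w T) \<pi>'"
  proof (rule bicausal_coupling_exists[OF \<mu> \<nu> sets assms(1), where w=w and C="\<lambda>s. 1 + c s"])
    show "w t (history t x) \<le> w T x" if "t \<in> {1..T}" for t x
      unfolding w_def path_lp_pow_history using that by (simp add: path_lp_pow_mono)
    show "0 \<le> 1 + c t" if "t \<in> {2..T}" for t
      using c[OF that] by simp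
    fix t and \<phi> :: "'d path \<Rightarrow> ennreal" assume t: "t \<in> {1..<T}" and \<phi>: "\<phi> \<in> borel_measurable (path_space t)"
    have hist: "history t \<in> \<nu> \<rightarrow>\<^sub>M path_space t"
      using measurable_history[of t T] t by (simp add: measurable_cong_sets[OF sets(2) refl])
    have [measurable]: "(\<lambda>x. x (Suc t)) \<in> borel_measurable \<nu>"
      using measurable_path_coordinate[of "Suc t" T] t by (simp add: measurable_cong_sets[OF sets(2) refl])
    have [measurable]: "(\<lambda>x. \<phi> (history t x)) \<in> borel_measurable \<nu>"
      by (rule measurable_compose[OF hist \<phi>])
    have "(\<lambda>x. w t (history t x)) = w t"
      by (simp add: fun_eq_iff w_def path_lp_pow_history del: One_nat_def)
    then have [measurable]: "w t \<in> borel_measurable \<nu>"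
      using measurable_compose[OF hist w_meas] by (simp only:)
    have c': "0 \<le> c (Suc t)"
      using t by (intro c) auto
    have "(\<integral>\<^sup>+x. \<phi> (history t x) * ennreal (w (Suc t) (history (Suc t) x)) \<partial>\<nu>) =
        (\<integral>\<^sup>+x. \<phi> (history t x) * ennreal (w t x) + \<phi> (history t x) * ennreal (lp_pow p (x (Suc t))) \<partial>\<nu>)"
      unfolding w_def path_lp_pow_history path_lp_pow_Suc
      by (intro nn_integral_cong) (simp add: distrib_left[symmetric] ennreal_plus[symmetric] path_lp_pow_nonneg lp_pow_nonneg add.assoc del: ennreal_plus)
    also have "\<dots> = (\<integral>\<^sup>+x. \<phi> (history t x) * ennreal (w t x) \<partial>\<nu>) + (\<integral>\<^sup>+x. \<phi> (history t x) * ennreal (lp_pow p (x (Suc t))) \<partial>\<nu>)"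
      by (rule nn_integral_add) measurable
    also have "\<dots> \<le> (\<integral>\<^sup>+x. \<phi> (history t x) * ennreal (w t x) \<partial>\<nu>) + ennreal (c (Suc t)) * (\<integral>\<^sup>+x. \<phi> (history t x) * ennreal (w t x) \<partial>\<nu>)"
      using growth_const_bound(2)[OF assms(4) t c_Suc[OF t] \<phi>] by (intro add_left_mono) (simp only: w_def)
    also have "\<dots> = ennreal (1 + c (Suc t)) * (\<integral>\<^sup>+x. \<phi> (history t x) * ennreal (w t (history t x)) \<partial>\<nu>)"
      using c' unfolding w_def path_lp_pow_history by (simp add: distrib_right)
    finally show "(\<integral>\<^sup>+x. \<phi> (history t x) * ennreal (w (Suc t) (history (Suc t) x)) \<partial>\<nu>) \<le>
        ennreal (1 + c (Suc t)) * (\<integral>\<^sup>+x. \<phi> (history t x) * ennreal (w t (history t x)) \<partial>\<nu>)" .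
  qed (use w_meas fin[OF \<mu> int(1)] fin[OF \<nu> int(2)] in \<open>auto simp: w_def path_lp_pow_nonneg\<close>)
  have ne: "bicausal_couplings T \<mu> \<nu> \<noteq> {}"
    using \<pi> by auto
  have "AW_pow p T \<mu> \<nu> \<le> ennreal (2 powr p) * ATV_w T (w T) \<mu> \<nu>"
  proof (rule AW_pow_le_ATV[OF sets _ w_meas ne])
    have "path_lp_pow p T (\<lambda>t. x t - y t) \<le> 2 powr p * (w T x + w T y)" for x y :: "'d path"
    proof -
      have "path_lp_pow p T (\<lambda>t. x t - y t) \<le> 2 powr p * (path_lp_pow p T x + path_lp_pow p T y)"
        by (rule path_lp_pow_diff_le[OF assms(2)])
      also have "\<dots> \<le> 2 powr p * (w T x + w T y)"
        by (intro mult_left_mono) (auto simp: w_def)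
      finally show ?thesis .
    qed
    then show "AE (x, y) in \<pi>'. x \<noteq> y \<longrightarrow> path_lp_pow p T (\<lambda>t. x t - y t) \<le> 2 powr p * (w T x + w T y)" for \<pi>'
      by simp
  qed simp
  moreover have "ennreal (2 powr p) * ATV_w T (w T) \<mu> \<nu> \<le>
      ennreal (2 powr p * (1 + 2 * (\<Sum>t\<in>{1..T-1}. \<Prod>s\<in>{t+1..T}. (1 + c s)))) * TV_w (w T) \<mu> \<nu>"
    using mult_left_mono[OF ATV_le_TV[OF \<pi> \<pi>_le], of "ennreal (2 powr p)"]
    by (simp add: ennreal_mult' mult.assoc)
  moreover have "AW_pow p T \<mu> \<nu> \<le> ennreal (enn2real (path_diam p T K) powr p) * ATV T \<mu> \<nu> \<and>
        ennreal (enn2real (path_diam p T K) powr p) * ATV T \<mu> \<nu>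
          \<le> ennreal ((2 * real T - 1) * enn2real (path_diam p T K) powr p) * TV \<mu> \<nu>"
    if K: "AE x in \<mu>. x \<in> K" "AE x in \<nu>. x \<in> K" "path_diam p T K < \<infinity>" for K
  proof
    let ?D = "enn2real (path_diam p T K) powr p"
    show "AW_pow p T \<mu> \<nu> \<le> ennreal ?D * ATV T \<mu> \<nu>"
    proof (rule AW_pow_le_ATV[OF sets _ _ ne])
      fix \<pi>' assume "\<pi>' \<in> couplings \<mu> \<nu>"
      from couplings_AE[OF this K(1,2)]
      show "AE (x, y) in \<pi>'. x \<noteq> y \<longrightarrow> path_lp_pow p T (\<lambda>t. x t - y t) \<le> ?D * (1 + 1)"
      proof eventually_elim
        case (elim z)
        then show ?case
          using path_lp_pow_diff_le_diam[OF assms(2) K(3), of "fst z" "snd z"]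
          by (auto simp: case_prod_beta' intro: order_trans)
      qed
    qed auto
    obtain \<pi>' where \<pi>': "\<pi>' \<in> bicausal_couplings T \<mu> \<nu>"
      and \<pi>'_le: "\<And>\<pi>''. \<pi>'' \<in> couplings \<mu> \<nu> \<Longrightarrow> weighted_mismatch (\<lambda>_. 1) \<pi>' \<le>
        ennreal (1 + 2 * (\<Sum>t\<in>{1..T-1}. \<Prod>s\<in>{t+1..T}. 1)) * weighted_mismatch (\<lambda>_. 1) \<pi>''"
      by (rule bicausal_coupling_exists[OF \<mu> \<nu> sets assms(1), where w="\<lambda>_ _. 1" and C="\<lambda>_. 1"])
        (auto simp: \<mu>.emeasure_space_1 \<nu>.emeasure_space_1)
    have "ATV T \<mu> \<nu> \<le> ennreal (2 * real T - 1) * TV \<mu> \<nu>"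
      using ATV_le_TV[OF \<pi>' \<pi>'_le] assms(1) by (simp add: of_nat_diff)
    then have "ennreal ?D * ATV T \<mu> \<nu> \<le> ennreal ?D * (ennreal (2 * real T - 1) * TV \<mu> \<nu>)"
      by (rule mult_left_mono) simp
    also have "\<dots> = ennreal ((2 * real T - 1) * ?D) * TV \<mu> \<nu>"
      using assms(1) by (simp add: ennreal_mult mult_ac)
    finally show "ennreal ?D * ATV T \<mu> \<nu> \<le> ennreal ((2 * real T - 1) * ?D) * TV \<mu> \<nu>" .
  qed
  ultimately show ?thesis
    by (simp add: w_def[abs_def])
qed

end
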